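(* Let $k\geq 1$ be a fixed integer. Then the following two statements hold: (1) There is a polynomial-time algorithm that, given a finite set $V$ and a $k$-hypergraph $\mathcal{H}$ on $V$, decides whether $\mathcal{H}$ is orderable. (2) There is a polynomial-time algorithm that, given an orderable $k$-hypergraph $\mathcal{H}$ on a finite set $V$, decides whether $\mathcal{H}$ has a perfect matching.
   Context: A $k$-hypergraph on a finite set $V$ is a set $\mathcal{H}$ of $k$-element subsets of $V$; elements of $V$ are vertices and elements of $\mathcal{H}$ are edges. A perfect matching in $\mathcal{H}$ is a subset $\{E_1,\dots,E_m\}\subseteq\mathcal{H}$ such that $V$ is the disjoint union of $E_1,\dots,E_m$. Let $n=|V|$. A $k$-hypergraph is orderable if there is an ordering $v_1,\dots,v_n$ of $V$ (an elimination order) such that each vertex $v_i$ is either dominating, meaning $E\in\mathcal{H}$ for every $k$-set $E$ with $v_i\in E\subseteq\{v_1,\dots,v_i\}$, or isolating, meaning $E\notin\mathcal{H}$ for every $k$-set $E$ with $v_i\in E\subseteq\{v_1,\dots,v_i\}$. Running time is measured in terms of $n$ (with $k$ fixed), the hypergraph being given by its list of edges. *)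

theory Defs
  imports Main
begin

definition k_hypergraph :: "nat \<Rightarrow> 'a set \<Rightarrow> 'a set set \<Rightarrow> bool" where
  "k_hypergraph k V H \<longleftrightarrow> finite V \<and> (\<forall>E\<in>H. E \<subseteq> V \<and> card E = k)"

definition has_perfect_matching :: "'a set \<Rightarrow> 'a set set \<Rightarrow> bool" where
  "has_perfect_matching V H \<longleftrightarrow>
     (\<exists>M. M \<subseteq> H \<and> (\<forall>E1\<in>M. \<forall>E2\<in>M. E1 \<noteq> E2 \<longrightarrow> E1 \<inter> E2 = {}) \<and> \<Union>M = V)"

definition dominating :: "nat \<Rightarrow> 'a set set \<Rightarrow> 'a list \<Rightarrow> nat \<Rightarrow> bool" where
  "dominating k H vs i \<longleftrightarrow>
     (\<forall>E. card E = k \<and> vs ! i \<in> E \<and> E \<subseteq> set (take (Suc i) vs) \<longrightarrow> E \<in> H)"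

definition isolating :: "nat \<Rightarrow> 'a set set \<Rightarrow> 'a list \<Rightarrow> nat \<Rightarrow> bool" where
  "isolating k H vs i \<longleftrightarrow>
     (\<forall>E. card E = k \<and> vs ! i \<in> E \<and> E \<subseteq> set (take (Suc i) vs) \<longrightarrow> E \<notin> H)"

definition orderable :: "nat \<Rightarrow> 'a set \<Rightarrow> 'a set set \<Rightarrow> bool" where
  "orderable k V H \<longleftrightarrow>
     (\<exists>vs. distinct vs \<and> set vs = V \<and>
        (\<forall>i < length vs. dominating k H vs i \<or> isolating k H vs i))"

text \<open>States 0..nstates-1, tape symbols 0..nsyms-1; state 0 is initial, state 1 accepting,
  state 2 rejecting (both halting). Symbol 0 is the blank. Head moves are -1, 0, 1.\<close>
record tm =
  nstates :: nat
  nsyms :: nat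
  delta :: "nat \<Rightarrow> nat \<Rightarrow> nat \<times> nat \<times> int"

definition is_TM :: "tm \<Rightarrow> bool" where
  "is_TM M \<longleftrightarrow> nstates M \<ge> 3 \<and> nsyms M \<ge> 5 \<and>
     (\<forall>q < nstates M. \<forall>s < nsyms M. case delta M q s of (q', w, d) \<Rightarrow>
        q' < nstates M \<and> w < nsyms M \<and> d \<in> {-1, 0, 1})"

type_synonym config = "nat \<times> (int \<Rightarrow> nat) \<times> int"

definition tm_step :: "tm \<Rightarrow> config \<Rightarrow> config" where
  "tm_step M c = (case c of (q, tp, h) \<Rightarrow>
     if q = 1 \<or> q = 2 then (q, tp, h)
     else (case delta M q (tp h) of (q', w, d) \<Rightarrow> (q', tp(h := w), h + d)))"

definition tm_init :: "nat list \<Rightarrow> config" where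
  "tm_init x = (0, (\<lambda>i. if 0 \<le> i \<and> nat i < length x then x ! nat i else 0), 0)"

definition tm_run :: "tm \<Rightarrow> nat list \<Rightarrow> nat \<Rightarrow> config" where
  "tm_run M x t = (tm_step M ^^ t) (tm_init x)"

fun bin :: "nat \<Rightarrow> nat list" where
  "bin n = (if n = 0 then [] else (n mod 2 + 1) # bin (n div 2))"

definition enc_nums :: "nat list \<Rightarrow> nat list" where
  "enc_nums xs = concat (map (\<lambda>x. bin x @ [3]) xs)"

definition enc_input :: "nat list \<Rightarrow> nat list list \<Rightarrow> nat list" where
  "enc_input vs es = enc_nums vs @ [4] @ concat (map (\<lambda>e. enc_nums e @ [4]) es)"

definition represents :: "nat set \<Rightarrow> nat set set \<Rightarrow> nat list \<Rightarrow> nat list list \<Rightarrow> bool" where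
  "represents V H vs es \<longleftrightarrow> distinct vs \<and> set vs = V \<and> (\<forall>e\<in>set es. distinct e) \<and>
     distinct (map set es) \<and> set (map set es) = H"

definition poly_time_decides ::
  "tm \<Rightarrow> (nat set \<Rightarrow> nat set set \<Rightarrow> bool) \<Rightarrow> (nat set \<Rightarrow> nat set set \<Rightarrow> bool) \<Rightarrow> bool" where
  "poly_time_decides M D P \<longleftrightarrow>
     (\<exists>c e::nat. \<forall>V H vs es. D V H \<longrightarrow> represents V H vs es \<longrightarrow>
        (\<exists>t \<le> c * (length (enc_input vs es) + 1) ^ e.
           fst (tm_run M (enc_input vs es) t) \<in> {1, 2} \<and>
           (fst (tm_run M (enc_input vs es) t) = 1 \<longleftrightarrow> P V H)))"

end

theory Submission
  imports Defs
begin

text \<open>Orderability is hereditary, so an elimination order is found greedily from its end: repeatedly remove a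
  vertex \<open>v\<close> that is dominating or isolating among the remaining vertices \<open>R\<close>. Whether \<open>v\<close> is such a vertex
  can be tested by exchanges: for every edge \<open>E \<subseteq> R\<close> containing \<open>v\<close>, every \<open>x \<in> E - {v}\<close> and every
  \<open>y \<in> R\<close> outside \<open>E - {x}\<close>, the set \<open>E - {x} \<union> {y}\<close> has to be an edge. For perfect matchings, note that a set
  is an edge iff its last vertex is dominating. While removing vertices, keep the number \<open>c\<close> of open places:
  a dominating vertex opens an edge with \<open>k - 1\<close> places, an isolating vertex fills a place and fails if
  there is none. If \<open>k\<close> divides the number of vertices, there is a perfect matching iff this never fails.

  Both algorithms use only sets of tape positions, finite-state sweeps over the tape and loops over the
  elements of such a set. Programs of this form are translated compositionally to Turing machines.\<close>

section \<open>Polynomial bounds\<close>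

text \<open>The running time is that of a one-tape machine, so the algorithms are shaped by what is
  easily said about such a machine. The exchange test fits: it only asks whether some listed edge
  lies in a marked set, and its nesting of loops does not depend on \<open>k\<close>. The parameter
  enters the programs only through adding \<open>k - 1\<close> places and counting modulo
  \<open>k\<close>.

  For matchings one has to see why opening an edge at every dominating vertex \<open>v\<close> loses
  nothing. If \<open>v\<close> fills a place in some solution while an edge \<open>E\<close> is
  still matched among the remaining vertices, then \<open>E\<close> can be dissolved: one of its
  vertices takes the place of \<open>v\<close>, the others complete a new edge with last vertex
  \<open>v\<close>. Divisibility keeps the number of remaining vertices minus \<open>c\<close> a
  multiple of \<open>k\<close> until it reaches zero. Up to then a newly opened edge always finds
  enough vertices; afterwards all remaining vertices fit into open places, and opening more edges on
  paper is harmless. A vertex contained in no \<open>k\<close>-set of remaining vertices is both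
  dominating and isolating; it is counted as isolating.\<close>

definition poly_bound :: "(nat \<Rightarrow> nat) \<Rightarrow> bool" where
  "poly_bound f \<longleftrightarrow> (\<exists>a b. \<forall>n. f n \<le> a * (n + 1) ^ b)"

lemma poly_bound_const: "poly_bound (\<lambda>n. c)"
  unfolding poly_bound_def by (rule exI[of _ c], rule exI[of _ 0]) simp

lemma poly_bound_id: "poly_bound (\<lambda>n. n)"
  unfolding poly_bound_def by (rule exI[of _ 1], rule exI[of _ 1]) simp

lemma poly_bound_add:
  assumes "poly_bound f" "poly_bound g"
  shows "poly_bound (\<lambda>n. f n + g n)"
proof -
  obtain a b a' b' where f: "\<And>n. f n \<le> a * (n + 1) ^ b" and g: "\<And>n. g n \<le> a' * (n + 1) ^ b'"
    using assms unfolding poly_bound_def by blast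
  have "f n + g n \<le> (a + a') * (n + 1) ^ (b + b')" for n
  proof -
    have "(n + 1) ^ b \<le> (n + 1) ^ (b + b')" "(n + 1) ^ b' \<le> (n + 1) ^ (b + b')"
      by (intro power_increasing; simp)+
    then have "a * (n + 1) ^ b + a' * (n + 1) ^ b' \<le> (a + a') * (n + 1) ^ (b + b')"
      unfolding distrib_right by (intro add_mono mult_le_mono2)
    with add_mono[OF f[of n] g[of n]] show ?thesis by (rule le_trans)
  qed
  then show ?thesis unfolding poly_bound_def by blast
qed

lemma poly_bound_mult:
  assumes "poly_bound f" "poly_bound g"
  shows "poly_bound (\<lambda>n. f n * g n)"
proof -
  obtain a b a' b' where f: "\<And>n. f n \<le> a * (n + 1) ^ b" and g: "\<And>n. g n \<le> a' * (n + 1) ^ b'"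
    using assms unfolding poly_bound_def by blast
  have "f n * g n \<le> (a * a') * (n + 1) ^ (b + b')" for n
    using mult_le_mono[OF f[of n] g[of n]] by (simp add: power_add ac_simps)
  then show ?thesis unfolding poly_bound_def by blast
qed

lemmas poly_bound_intros = poly_bound_const poly_bound_id poly_bound_add poly_bound_mult

section \<open>Sweep machines\<close>

text \<open>A tape cell carries an input symbol, which never changes, and a set of marks; a state \<open>\<sigma>\<close> records
  for each mark the set of positions carrying it. A control state is \<open>Base\<close> for the machine itself and
  \<open>Lft\<close>, \<open>Rgt\<close> for embedded machines. One round is a sweep over the word from left to right by
  \<open>\<delta>\<close>, after which \<open>\<epsilon>\<close> gives the control state of the next round, or \<open>None\<close> to stop.\<close>

datatype st = Base nat | Lft st | Rgt st

type_synonym 'm cell = "nat \<times> 'm set"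
type_synonym 'm state = "'m \<Rightarrow> nat set"
type_synonym 'm prog = "nat list \<Rightarrow> 'm state \<Rightarrow> 'm state"

fun sweep :: "('s \<Rightarrow> 'c \<Rightarrow> 's \<times> 'c) \<Rightarrow> 's \<Rightarrow> 'c list \<Rightarrow> 's \<times> 'c list" where
  "sweep \<delta> s [] = (s, [])"
| "sweep \<delta> s (c # u) =
    (case \<delta> s c of (s1, c1) \<Rightarrow> case sweep \<delta> s1 u of (s2, u2) \<Rightarrow> (s2, c1 # u2))"

lemma sweep_append:
  "sweep \<delta> s (u @ v) =
    (case sweep \<delta> s u of (s1, u1) \<Rightarrow> case sweep \<delta> s1 v of (s2, v1) \<Rightarrow> (s2, u1 @ v1))"
  by (induction u arbitrary: s) (auto split: prod.splits)

text \<open>A step sees a single cell, so a sweep is known once the state in front of every position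
  has been guessed as a function \<open>q\<close>. Both \<open>scan_state\<close> and the search in
  a loop are such guesses.\<close>

lemma sweep_map_upt:
  assumes "\<And>i. i < n \<Longrightarrow> \<delta> (q i) (f i) = (q (Suc i), g i)"
  shows "sweep \<delta> (q 0) (map f [0..<n]) = (q n, map g [0..<n])"
  using assms by (induction n) (auto simp: sweep_append)

text \<open>The index counts rounds rather than cell visits, so that the costs of combined machines
  simply add up. Since \<open>\<epsilon>\<close> is consulted only after a sweep, every run has at
  least one round.\<close>

inductive exec for \<delta> :: "'s \<Rightarrow> 'c \<Rightarrow> 's \<times> 'c" and \<epsilon> :: "'s \<Rightarrow> 's option" where
  exec_stop: "sweep \<delta> s u = (s', u') \<Longrightarrow> \<epsilon> s' = None \<Longrightarrow> exec \<delta> \<epsilon> (Suc 0) s u u'"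
| exec_step: "sweep \<delta> s u = (s', u') \<Longrightarrow> \<epsilon> s' = Some s'' \<Longrightarrow> exec \<delta> \<epsilon> n s'' u' v \<Longrightarrow>
    exec \<delta> \<epsilon> (Suc n) s u v"

definition cells :: "nat list \<Rightarrow> 'm state \<Rightarrow> 'm cell list" where
  "cells w \<sigma> = map (\<lambda>i. (w ! i, {m. i \<in> \<sigma> m})) [0..<length w]"

text \<open>Positions beyond the word have no cell, so \<open>cells\<close> would forget marks
  placed there.\<close>

definition wf_state :: "nat list \<Rightarrow> 'm state \<Rightarrow> bool" where
  "wf_state w \<sigma> \<longleftrightarrow> (\<forall>m. \<sigma> m \<subseteq> {..<length w})"

text \<open>The type \<open>st\<close> is infinite and common to all machines, so that combining
  programs never changes types; finiteness is the task of \<open>Q\<close>. Fixed input symbols keep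
  the alphabet within symbols paired with sets of marks.\<close>

definition closed_machine ::
  "st set \<Rightarrow> (st \<Rightarrow> 'm cell \<Rightarrow> st \<times> 'm cell) \<Rightarrow> (st \<Rightarrow> st option) \<Rightarrow> bool" where
  "closed_machine Q \<delta> \<epsilon> \<longleftrightarrow> finite Q \<and>
     (\<forall>s\<in>Q. \<forall>c. fst (\<delta> s c) \<in> Q \<and> fst (snd (\<delta> s c)) = fst c) \<and>
     (\<forall>s\<in>Q. \<forall>s'. \<epsilon> s = Some s' \<longrightarrow> s' \<in> Q)"

definition computes_with where
  "computes_with \<delta> \<epsilon> s0 T F \<longleftrightarrow> poly_bound T \<and> (\<forall>w \<sigma>. wf_state w \<sigma> \<longrightarrow> wf_state w (F w \<sigma>) \<and>
     (\<exists>n \<le> T (length w). exec \<delta> \<epsilon> n s0 (cells w \<sigma>) (cells w (F w \<sigma>))))"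

definition computable :: "'m prog \<Rightarrow> bool" where
  "computable F \<longleftrightarrow> (\<exists>Q \<delta> \<epsilon> s0 T. closed_machine Q \<delta> \<epsilon> \<and> s0 \<in> Q \<and> computes_with \<delta> \<epsilon> s0 T F)"

section \<open>Two machines embedded in one\<close>

definition mix_step where
  "mix_step d \<delta>1 \<delta>2 s c = (case s of
     Base n \<Rightarrow> map_prod Base id (d n c)
   | Lft s \<Rightarrow> map_prod Lft id (\<delta>1 s c)
   | Rgt s \<Rightarrow> map_prod Rgt id (\<delta>2 s c))"

text \<open>\<open>x1\<close> and \<open>x2\<close> are the continuations after an embedded machine
  stops: a state to jump to, or \<open>None\<close> if the compound stops as well. Sequence,
  branching and loop differ only in these, in the own rules \<open>d\<close> and \<open>e\<close>,
  and in the start state.\<close>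

definition mix_end where
  "mix_end e x1 \<epsilon>1 x2 \<epsilon>2 s = (case s of
     Base n \<Rightarrow> e n
   | Lft s \<Rightarrow> (case \<epsilon>1 s of None \<Rightarrow> x1 | Some s' \<Rightarrow> Some (Lft s'))
   | Rgt s \<Rightarrow> (case \<epsilon>2 s of None \<Rightarrow> x2 | Some s' \<Rightarrow> Some (Rgt s')))"

lemma mix_end_simps [simp]:
  "mix_end e x1 \<epsilon>1 x2 \<epsilon>2 (Base n) = e n"
  "mix_end e x1 \<epsilon>1 x2 \<epsilon>2 (Lft s) = (case \<epsilon>1 s of None \<Rightarrow> x1 | Some s' \<Rightarrow> Some (Lft s'))"
  "mix_end e x1 \<epsilon>1 x2 \<epsilon>2 (Rgt s) = (case \<epsilon>2 s of None \<Rightarrow> x2 | Some s' \<Rightarrow> Some (Rgt s'))"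
  by (auto simp: mix_end_def)

lemma sweep_mix:
  "sweep (mix_step d \<delta>1 \<delta>2) (Base n) u = map_prod Base id (sweep d n u)"
  "sweep (mix_step d \<delta>1 \<delta>2) (Lft s) u = map_prod Lft id (sweep \<delta>1 s u)"
  "sweep (mix_step d \<delta>1 \<delta>2) (Rgt s) u = map_prod Rgt id (sweep \<delta>2 s u)"
  by (induction u arbitrary: n s) (auto simp: mix_step_def split: prod.splits)

lemma exec_mix_Lft_exit:
  "exec \<delta>1 \<epsilon>1 n s u v \<Longrightarrow>
    exec (mix_step d \<delta>1 \<delta>2) (mix_end e None \<epsilon>1 x2 \<epsilon>2) n (Lft s) u v"
  by (induction rule: exec.induct)
     (auto intro!: exec.intros simp: sweep_mix)

lemma exec_mix_Rgt_exit:
  "exec \<delta>2 \<epsilon>2 n s u v \<Longrightarrow>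
    exec (mix_step d \<delta>1 \<delta>2) (mix_end e x1 \<epsilon>1 None \<epsilon>2) n (Rgt s) u v"
  by (induction rule: exec.induct)
     (auto intro!: exec.intros simp: sweep_mix)

text \<open>The round in which the embedded machine would stop ends with the jump to
  \<open>t\<close>, so the jump costs no round of its own.\<close>

lemma exec_mix_Lft_next:
  assumes "exec \<delta>1 \<epsilon>1 n s u v"
    and "exec (mix_step d \<delta>1 \<delta>2) (mix_end e (Some t) \<epsilon>1 x2 \<epsilon>2) m t v v'"
  shows "exec (mix_step d \<delta>1 \<delta>2) (mix_end e (Some t) \<epsilon>1 x2 \<epsilon>2) (n + m) (Lft s) u v'"
  using assms
proof (induction rule: exec.induct)
  case (exec_stop s u s' u')
  then show ?case by (auto intro!: exec.exec_step simp: sweep_mix)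
next
  case (exec_step s u s' u' s'' n v)
  then have "exec (mix_step d \<delta>1 \<delta>2) (mix_end e (Some t) \<epsilon>1 x2 \<epsilon>2) (n + m) (Lft s'') u' v'"
    by blast
  with exec_step(1,2) show ?case
    by (auto intro!: exec.exec_step simp: sweep_mix)
qed

lemma closed_mix:
  assumes "closed_machine Q1 \<delta>1 \<epsilon>1" "closed_machine Q2 \<delta>2 \<epsilon>2"
    and d: "\<And>q c. q < B \<Longrightarrow> fst (d q c) < B \<and> fst (snd (d q c)) = fst c"
    and e: "\<And>q s. q < B \<Longrightarrow> e q = Some s \<Longrightarrow> s \<in> Q"
    and x: "\<And>s. x1 = Some s \<Longrightarrow> s \<in> Q" "\<And>s. x2 = Some s \<Longrightarrow> s \<in> Q"
    and Q: "Q = Base ` {..<B} \<union> Lft ` Q1 \<union> Rgt ` Q2"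
  shows "closed_machine Q (mix_step d \<delta>1 \<delta>2) (mix_end e x1 \<epsilon>1 x2 \<epsilon>2)"
  unfolding closed_machine_def
proof (intro conjI ballI allI impI)
  show "finite Q" using assms(1,2) unfolding Q closed_machine_def by auto
next
  fix s c assume "s \<in> Q"
  then show "fst (mix_step d \<delta>1 \<delta>2 s c) \<in> Q"
    using assms(1,2) d[of _ c] unfolding Q closed_machine_def
    by (cases c; cases s) (simp_all add: mix_step_def image_iff)
  show "fst (snd (mix_step d \<delta>1 \<delta>2 s c)) = fst c"
    using assms(1,2) d[of _ c] \<open>s \<in> Q\<close> unfolding Q closed_machine_def
    by (cases c; cases s) (simp_all add: mix_step_def image_iff)
next
  fix s s' assume "s \<in> Q" "mix_end e x1 \<epsilon>1 x2 \<epsilon>2 s = Some s'"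
  then show "s' \<in> Q"
    using assms(1,2) e x unfolding closed_machine_def
    by (cases s) (auto simp: Q split: option.splits)
qed

section \<open>Programs computed by sweep machines\<close>

primrec scan_state :: "(nat \<Rightarrow> nat \<Rightarrow> ('m \<Rightarrow> bool) \<Rightarrow> nat) \<Rightarrow> nat list \<Rightarrow> 'm state \<Rightarrow> nat \<Rightarrow> nat" where
  "scan_state nx w \<sigma> 0 = 0"
| "scan_state nx w \<sigma> (Suc i) = nx (scan_state nx w \<sigma> i) (w ! i) (\<lambda>m. i \<in> \<sigma> m)"

text \<open>A Mealy machine: it reads symbols and old marks from left to right and writes the single
  mark \<open>x\<close>. Because \<open>scan_state\<close> refers to the old state only, freshly
  written marks do not influence the scan.\<close>

definition assign where
  "assign x nx out w \<sigma> =
     \<sigma>(x := {i. i < length w \<and> out (scan_state nx w \<sigma> i) (w ! i) (\<lambda>m. i \<in> \<sigma> m)})"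

definition skip :: "'m prog" where "skip w \<sigma> = \<sigma>"

definition seq :: "'m prog \<Rightarrow> 'm prog \<Rightarrow> 'm prog"  (infixr ";;" 60) where
  "(F ;; G) w \<sigma> = G w (F w \<sigma>)"

definition cond :: "(nat list \<Rightarrow> 'm state \<Rightarrow> bool) \<Rightarrow> 'm prog \<Rightarrow> 'm prog \<Rightarrow> 'm prog" where
  "cond b F G w \<sigma> = (if b w \<sigma> then F w \<sigma> else G w \<sigma>)"

text \<open>Since the body never changes the set \<open>t\<close> of positions still to be treated, the number of iterations
  is bounded by the length of the word: all programs run in polynomial time.\<close>

definition forl :: "'m \<Rightarrow> 'm \<Rightarrow> 'm prog \<Rightarrow> 'm prog" where
  "forl t p F w \<sigma> =
     (fold (\<lambda>i \<sigma>. F w (\<sigma>(t := \<sigma> t - {i}, p := {i}))) (sorted_list_of_set (\<sigma> t)) \<sigma>)(t := {}, p := {})"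

definition preserves :: "'m \<Rightarrow> 'm prog \<Rightarrow> bool" where
  "preserves m F \<longleftrightarrow> (\<forall>w \<sigma>. F w \<sigma> m = \<sigma> m)"

lemma computable_assign:
  fixes x :: 'm
  assumes B: "0 < B" "\<And>q a M. q < B \<Longrightarrow> nx q a M < B"
  shows "computable (assign x nx out)"
proof -
  define \<delta> :: "st \<Rightarrow> 'm cell \<Rightarrow> st \<times> 'm cell" where
    "\<delta> s c = (case s of Base q \<Rightarrow> (Base (nx q (fst c) (\<lambda>m. m \<in> snd c)),
        (fst c, if out q (fst c) (\<lambda>m. m \<in> snd c) then insert x (snd c) else snd c - {x}))
      | _ \<Rightarrow> (s, c))" for s c
  define \<epsilon> :: "st \<Rightarrow> st option" where "\<epsilon> s = None" for s
  have "closed_machine (Base ` {..<B}) \<delta> \<epsilon>"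
    using B unfolding closed_machine_def \<delta>_def \<epsilon>_def by auto
  moreover have "Base 0 \<in> Base ` {..<B}" using B by blast
  moreover have "computes_with \<delta> \<epsilon> (Base 0) (\<lambda>_. 1) (assign x nx out)"
    unfolding computes_with_def
  proof (intro conjI allI impI)
    fix w and \<sigma> :: "'m state" assume wf: "wf_state w \<sigma>"
    show "wf_state w (assign x nx out w \<sigma>)"
      using wf by (auto simp: wf_state_def assign_def)
    have "sweep \<delta> (Base (scan_state nx w \<sigma> 0)) (cells w \<sigma>) =
        (Base (scan_state nx w \<sigma> (length w)), cells w (assign x nx out w \<sigma>))"
      unfolding cells_def by (rule sweep_map_upt) (auto simp: \<delta>_def assign_def)
    then have "exec \<delta> \<epsilon> (Suc 0) (Base 0) (cells w \<sigma>) (cells w (assign x nx out w \<sigma>))"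
      by (intro exec_stop) (auto simp: \<epsilon>_def)
    then show "\<exists>n\<le>1. exec \<delta> \<epsilon> n (Base 0) (cells w \<sigma>) (cells w (assign x nx out w \<sigma>))"
      by auto
  qed (simp add: poly_bound_const)
  ultimately show ?thesis unfolding computable_def by blast
qed

lemma computable_skip: "computable (skip :: 'm prog)"
proof -
  have "closed_machine {Base 0} (\<lambda>s (c :: 'm cell). (s, c)) (\<lambda>_. None)"
    by (auto simp: closed_machine_def)
  moreover have "sweep (\<lambda>s (c :: 'm cell). (s, c)) s u = (s, u)" for s :: st and u
    by (induction u) auto
  then have "computes_with (\<lambda>s (c :: 'm cell). (s, c)) (\<lambda>_. None) (Base 0) (\<lambda>_. 1) skip"
    unfolding computes_with_def skip_def
    by (auto intro!: exI[of _ "Suc 0"] exec_stop poly_bound_const)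
  ultimately show ?thesis unfolding computable_def by blast
qed

lemma computable_seq:
  fixes F G :: "'m prog"
  assumes "computable F" "computable G"
  shows "computable (F ;; G)"
proof -
  obtain Q1 \<delta>1 \<epsilon>1 s1 T1 where 1: "closed_machine Q1 \<delta>1 \<epsilon>1" "s1 \<in> Q1" "computes_with \<delta>1 \<epsilon>1 s1 T1 F"
    using assms(1) unfolding computable_def by blast
  obtain Q2 \<delta>2 \<epsilon>2 s2 T2 where 2: "closed_machine Q2 \<delta>2 \<epsilon>2" "s2 \<in> Q2" "computes_with \<delta>2 \<epsilon>2 s2 T2 G"
    using assms(2) unfolding computable_def by blast
  let ?d = "\<lambda>q (c :: 'm cell). (q :: nat, c)"
  let ?\<delta> = "mix_step ?d \<delta>1 \<delta>2"
  let ?\<epsilon> = "mix_end (\<lambda>_. None) (Some (Rgt s2)) \<epsilon>1 None \<epsilon>2"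
  let ?Q = "Base ` {..<0} \<union> Lft ` Q1 \<union> Rgt ` Q2"
  have "closed_machine ?Q ?\<delta> ?\<epsilon>"
    using 1 2 by (intro closed_mix[where B = 0]) auto
  moreover have "Lft s1 \<in> ?Q" using 1 by blast
  moreover have "computes_with ?\<delta> ?\<epsilon> (Lft s1) (\<lambda>n. T1 n + T2 n) (F ;; G)"
    unfolding computes_with_def
  proof (intro conjI allI impI)
    show "poly_bound (\<lambda>n. T1 n + T2 n)"
      using 1 2 by (auto simp: computes_with_def intro: poly_bound_add)
    fix w and \<sigma> :: "'m state" assume wf: "wf_state w \<sigma>"
    have wf1: "wf_state w (F w \<sigma>)" using 1 wf by (auto simp: computes_with_def)
    show "wf_state w ((F ;; G) w \<sigma>)"
      using 2 wf1 by (auto simp: computes_with_def seq_def)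
    obtain n where n: "n \<le> T1 (length w)" "exec \<delta>1 \<epsilon>1 n s1 (cells w \<sigma>) (cells w (F w \<sigma>))"
      using 1 wf unfolding computes_with_def by blast
    obtain m where m: "m \<le> T2 (length w)"
      "exec \<delta>2 \<epsilon>2 m s2 (cells w (F w \<sigma>)) (cells w (G w (F w \<sigma>)))"
      using 2 wf1 unfolding computes_with_def by blast
    have "exec ?\<delta> ?\<epsilon> (n + m) (Lft s1) (cells w \<sigma>) (cells w (G w (F w \<sigma>)))"
      by (rule exec_mix_Lft_next[OF n(2) exec_mix_Rgt_exit[OF m(2)]])
    with n m show "\<exists>n\<le>T1 (length w) + T2 (length w).
        exec ?\<delta> ?\<epsilon> n (Lft s1) (cells w \<sigma>) (cells w ((F ;; G) w \<sigma>))"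
      by (auto simp: seq_def intro!: exI[of _ "n + m"])
  qed
  ultimately show ?thesis unfolding computable_def by blast
qed

text \<open>A test is characterised by what it can steer. Negation then exchanges the branches,
  while conjunction and disjunction nest them, so that no machine for a Boolean connective has to be
  built.\<close>

definition testable :: "(nat list \<Rightarrow> 'm state \<Rightarrow> bool) \<Rightarrow> bool" where
  "testable b \<longleftrightarrow> (\<forall>F G. computable F \<longrightarrow> computable G \<longrightarrow> computable (cond b F G))"

lemma computable_cond: "testable b \<Longrightarrow> computable F \<Longrightarrow> computable G \<Longrightarrow> computable (cond b F G)"
  by (simp add: testable_def)

lemma testable_not: assumes "testable b" shows "testable (\<lambda>w \<sigma>. \<not> b w \<sigma>)"
proof -
  have "cond (\<lambda>w \<sigma>. \<not> b w \<sigma>) F G = cond b G F" for F G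
    by (auto simp: cond_def fun_eq_iff)
  with assms show ?thesis by (auto simp: testable_def)
qed

lemma testable_and: assumes "testable b" "testable c" shows "testable (\<lambda>w \<sigma>. b w \<sigma> \<and> c w \<sigma>)"
proof -
  have "cond (\<lambda>w \<sigma>. b w \<sigma> \<and> c w \<sigma>) F G = cond b (cond c F G) G" for F G
    by (auto simp: cond_def fun_eq_iff)
  with assms show ?thesis by (auto simp: testable_def)
qed

lemma testable_or: assumes "testable b" "testable c" shows "testable (\<lambda>w \<sigma>. b w \<sigma> \<or> c w \<sigma>)"
proof -
  have "cond (\<lambda>w \<sigma>. b w \<sigma> \<or> c w \<sigma>) F G = cond b F (cond c F G)" for F G
    by (auto simp: cond_def fun_eq_iff)
  with assms show ?thesis by (auto simp: testable_def)
qed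

text \<open>One sweep that writes nothing leaves the outcome in the control state, where
  \<open>\<epsilon>\<close> selects the branch.\<close>

lemma testable_scan:
  fixes nx :: "nat \<Rightarrow> nat \<Rightarrow> ('m \<Rightarrow> bool) \<Rightarrow> nat"
  assumes B: "0 < B" "\<And>q a M. q < B \<Longrightarrow> nx q a M < B"
  shows "testable (\<lambda>w \<sigma>. acc (scan_state nx w \<sigma> (length w)))"
  unfolding testable_def
proof (intro allI impI)
  fix F G :: "'m prog"
  assume "computable F" "computable G"
  obtain Q1 \<delta>1 \<epsilon>1 s1 T1 where 1: "closed_machine Q1 \<delta>1 \<epsilon>1" "s1 \<in> Q1" "computes_with \<delta>1 \<epsilon>1 s1 T1 F"
    using \<open>computable F\<close> unfolding computable_def by blast
  obtain Q2 \<delta>2 \<epsilon>2 s2 T2 where 2: "closed_machine Q2 \<delta>2 \<epsilon>2" "s2 \<in> Q2" "computes_with \<delta>2 \<epsilon>2 s2 T2 G"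
    using \<open>computable G\<close> unfolding computable_def by blast
  let ?d = "\<lambda>q (c :: 'm cell). (nx q (fst c) (\<lambda>m. m \<in> snd c), c)"
  let ?\<delta> = "mix_step ?d \<delta>1 \<delta>2"
  let ?\<epsilon> = "mix_end (\<lambda>q. Some (if acc q then Lft s1 else Rgt s2)) None \<epsilon>1 None \<epsilon>2"
  let ?Q = "Base ` {..<B} \<union> Lft ` Q1 \<union> Rgt ` Q2"
  let ?C = "cond (\<lambda>w \<sigma>. acc (scan_state nx w \<sigma> (length w))) F G"
  have "closed_machine ?Q ?\<delta> ?\<epsilon>"
    using 1 2 B by (intro closed_mix[where B = B]) (auto split: if_splits)
  moreover have "Base 0 \<in> ?Q" using B by blast
  moreover have "computes_with ?\<delta> ?\<epsilon> (Base 0) (\<lambda>n. 1 + (T1 n + T2 n)) ?C"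
    unfolding computes_with_def
  proof (intro conjI allI impI)
    show "poly_bound (\<lambda>n. 1 + (T1 n + T2 n))"
      using 1 2 unfolding computes_with_def by (intro poly_bound_intros) auto
    fix w and \<sigma> :: "'m state" assume wf: "wf_state w \<sigma>"
    show "wf_state w (?C w \<sigma>)"
      using 1 2 wf by (auto simp: computes_with_def cond_def)
    obtain n where n: "n \<le> T1 (length w)" "exec \<delta>1 \<epsilon>1 n s1 (cells w \<sigma>) (cells w (F w \<sigma>))"
      using 1 wf unfolding computes_with_def by blast
    obtain m where m: "m \<le> T2 (length w)" "exec \<delta>2 \<epsilon>2 m s2 (cells w \<sigma>) (cells w (G w \<sigma>))"
      using 2 wf unfolding computes_with_def by blast
    have "sweep ?d (scan_state nx w \<sigma> 0) (cells w \<sigma>) = (scan_state nx w \<sigma> (length w), cells w \<sigma>)"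
      unfolding cells_def by (rule sweep_map_upt) auto
    then have sw: "sweep ?\<delta> (Base 0) (cells w \<sigma>) = (Base (scan_state nx w \<sigma> (length w)), cells w \<sigma>)"
      by (simp add: sweep_mix)
    show "\<exists>n\<le>1 + (T1 (length w) + T2 (length w)). exec ?\<delta> ?\<epsilon> n (Base 0) (cells w \<sigma>) (cells w (?C w \<sigma>))"
    proof (cases "acc (scan_state nx w \<sigma> (length w))")
      case True
      have "exec ?\<delta> ?\<epsilon> (Suc n) (Base 0) (cells w \<sigma>) (cells w (F w \<sigma>))"
        using sw exec_mix_Lft_exit[OF n(2)] True by (intro exec_step) auto
      with n True show ?thesis by (auto simp: cond_def intro!: exI[of _ "Suc n"])
    next
      case False
      have "exec ?\<delta> ?\<epsilon> (Suc m) (Base 0) (cells w \<sigma>) (cells w (G w \<sigma>))"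
        using sw exec_mix_Rgt_exit[OF m(2)] False by (intro exec_step) auto
      with m False show ?thesis by (auto simp: cond_def intro!: exI[of _ "Suc m"])
    qed
  qed
  ultimately show "computable ?C" unfolding computable_def by blast
qed

section \<open>Loops over a set of positions\<close>

lemma forl_empty: "\<sigma> t = {} \<Longrightarrow> forl t p F w \<sigma> = \<sigma>(t := {}, p := {})"
  by (simp add: forl_def)

text \<open>The fold fixes its list at the start, whereas a machine has to look for the leftmost
  remaining position each time. Both agree because the body leaves \<open>t\<close> alone, so that
  \<open>t\<close> always is the rest of the list.\<close>

lemma forl_nonempty:
  assumes "preserves t F" "t \<noteq> p" "finite (\<sigma> t)" "\<sigma> t \<noteq> {}"
  shows "forl t p F w \<sigma> = forl t p F w (F w (\<sigma>(t := \<sigma> t - {Min (\<sigma> t)}, p := {Min (\<sigma> t)})))"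
proof -
  let ?s = "F w (\<sigma>(t := \<sigma> t - {Min (\<sigma> t)}, p := {Min (\<sigma> t)}))"
  have "?s t = \<sigma> t - {Min (\<sigma> t)}" using assms(1,2) by (simp add: preserves_def)
  moreover have "sorted_list_of_set (\<sigma> t) = Min (\<sigma> t) # sorted_list_of_set (\<sigma> t - {Min (\<sigma> t)})"
    using assms by (simp add: sorted_list_of_set_nonempty)
  ultimately show ?thesis by (simp add: forl_def)
qed

lemma computable_forl:
  fixes F :: "'m prog"
  assumes "computable F" and pres: "preserves t F" and tp: "t \<noteq> p"
  shows "computable (forl t p F)"
proof -
  obtain Q1 \<delta>1 \<epsilon>1 s1 T1 where 1: "closed_machine Q1 \<delta>1 \<epsilon>1" "s1 \<in> Q1" "computes_with \<delta>1 \<epsilon>1 s1 T1 F"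
    using assms(1) unfolding computable_def by blast
  \<comment> \<open>State \<open>0\<close> searches for the leftmost \<open>t\<close>; there the
    mark moves from \<open>t\<close> to \<open>p\<close> and state \<open>1\<close> is entered. All
    other cells lose an old \<open>p\<close>. Ending in state \<open>0\<close> means that
    \<open>t\<close> is empty.\<close>
  let ?d = "\<lambda>q (c :: 'm cell).
     if q = (0::nat) \<and> t \<in> snd c then (1, (fst c, insert p (snd c - {t})))
     else (q, (fst c, snd c - {p}))"
  let ?\<delta> = "mix_step ?d \<delta>1 \<delta>1"
  let ?\<epsilon> = "mix_end (\<lambda>q. if q = 0 then None else Some (Lft s1)) (Some (Base 0)) \<epsilon>1 None \<epsilon>1"
  let ?Q = "Base ` {..<2} \<union> Lft ` Q1 \<union> Rgt ` Q1"
  have "closed_machine ?Q ?\<delta> ?\<epsilon>"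
    using 1 by (intro closed_mix[where B = 2]) (auto split: if_splits)
  moreover have "Base 0 \<in> ?Q" by auto
  \<comment> \<open>Each element costs one searching sweep and one run of the body; the final
    \<open>1\<close> is the search that finds nothing.\<close>
  moreover have "computes_with ?\<delta> ?\<epsilon> (Base 0) (\<lambda>n. n * (T1 n + 1) + 1) (forl t p F)"
    unfolding computes_with_def
  proof (intro conjI allI impI)
    show "poly_bound (\<lambda>n. n * (T1 n + 1) + 1)"
      using 1 unfolding computes_with_def by (intro poly_bound_intros) auto
    fix w and \<sigma> :: "'m state" assume wf: "wf_state w \<sigma>"
    have "wf_state w (forl t p F w \<sigma>) \<and> (\<exists>n \<le> card (\<sigma> t) * (T1 (length w) + 1) + 1.
        exec ?\<delta> ?\<epsilon> n (Base 0) (cells w \<sigma>) (cells w (forl t p F w \<sigma>)))"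
      using wf
    proof (induction "card (\<sigma> t)" arbitrary: \<sigma>)
      case 0
      have fin: "finite (\<sigma> t)" using "0.prems" by (auto simp: wf_state_def intro: finite_subset)
      with 0 have e: "\<sigma> t = {}" by simp
      have "sweep ?d 0 (cells w \<sigma>) = (0, cells w (\<sigma>(t := {}, p := {})))"
        unfolding cells_def using e tp
        by (intro sweep_map_upt[where q = "\<lambda>_. 0" and \<delta> = ?d]) (auto)
      then have "exec ?\<delta> ?\<epsilon> (Suc 0) (Base 0) (cells w \<sigma>) (cells w (forl t p F w \<sigma>))"
        using e by (intro exec_stop) (auto simp: sweep_mix forl_empty)
      moreover have "wf_state w (forl t p F w \<sigma>)"
        using "0.prems" e by (auto simp: wf_state_def forl_empty)
      ultimately show ?case by auto
    next
      case (Suc k)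
      have fin: "finite (\<sigma> t)" using Suc.prems by (auto simp: wf_state_def intro: finite_subset)
      have ne: "\<sigma> t \<noteq> {}" using Suc.hyps(2) by auto
      let ?i = "Min (\<sigma> t)"
      let ?\<sigma>1 = "\<sigma>(t := \<sigma> t - {?i}, p := {?i})"
      have i: "?i \<in> \<sigma> t" using fin ne by simp
      have ilt: "?i < length w" using i Suc.prems by (auto simp: wf_state_def)
      have wf1: "wf_state w ?\<sigma>1" using Suc.prems ilt by (auto simp: wf_state_def)
      have wf2: "wf_state w (F w ?\<sigma>1)" using 1 wf1 by (auto simp: computes_with_def)
      have t2: "F w ?\<sigma>1 t = \<sigma> t - {?i}" using pres tp by (simp add: preserves_def)
      have k: "k = card (F w ?\<sigma>1 t)" using Suc.hyps(2) i fin t2 by simp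
      obtain m where m: "m \<le> k * (T1 (length w) + 1) + 1"
        "exec ?\<delta> ?\<epsilon> m (Base 0) (cells w (F w ?\<sigma>1)) (cells w (forl t p F w (F w ?\<sigma>1)))"
        and wf3: "wf_state w (forl t p F w (F w ?\<sigma>1))"
        using Suc.hyps(1)[OF k wf2] unfolding k[symmetric] by blast
      obtain n where n: "n \<le> T1 (length w)" "exec \<delta>1 \<epsilon>1 n s1 (cells w ?\<sigma>1) (cells w (F w ?\<sigma>1))"
        using 1 wf1 unfolding computes_with_def by blast
      \<comment> \<open>The search is over once some element of \<open>\<sigma> t\<close> has been
        passed.\<close>
      let ?q = "\<lambda>i. if \<exists>j<i. j \<in> \<sigma> t then 1 else (0::nat)"
      have "sweep ?d (?q 0) (cells w \<sigma>) = (?q (length w), cells w ?\<sigma>1)"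
        unfolding cells_def
      proof (rule sweep_map_upt)
        fix j
        have "j = ?i \<longleftrightarrow> j \<in> \<sigma> t \<and> \<not> (\<exists>l<j. l \<in> \<sigma> t)"
          using fin ne by (metis Min_in Min_le linorder_not_le order_le_less)
        then show "?d (?q j) (w ! j, {m. j \<in> \<sigma> m}) = (?q (Suc j), w ! j, {m. j \<in> ?\<sigma>1 m})"
          using tp by (auto simp: less_Suc_eq)
      qed
      moreover have "?q (length w) = 1" using i ilt by auto
      ultimately have sw: "sweep ?\<delta> (Base 0) (cells w \<sigma>) = (Base 1, cells w ?\<sigma>1)"
        by (simp add: sweep_mix)
      have "exec ?\<delta> ?\<epsilon> (Suc (n + m)) (Base 0) (cells w \<sigma>) (cells w (forl t p F w (F w ?\<sigma>1)))"
        using sw exec_mix_Lft_next[OF n(2) m(2)] by (intro exec_step) auto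
      moreover have "Suc (n + m) \<le> card (\<sigma> t) * (T1 (length w) + 1) + 1"
        using n m Suc.hyps(2)[symmetric] by simp
      ultimately show ?case
        using wf3 unfolding forl_nonempty[where \<sigma> = \<sigma>, OF pres tp fin ne] by blast
    qed
    moreover have "card (\<sigma> t) \<le> length w"
      using wf card_mono[of "{..<length w}" "\<sigma> t"] by (auto simp: wf_state_def)
    then have "card (\<sigma> t) * (T1 (length w) + 1) + 1 \<le> length w * (T1 (length w) + 1) + 1"
      by (meson add_le_mono1 mult_le_mono1)
    ultimately show "wf_state w (forl t p F w \<sigma>)"
      "\<exists>n\<le>length w * (T1 (length w) + 1) + 1. exec ?\<delta> ?\<epsilon> n (Base 0) (cells w \<sigma>) (cells w (forl t p F w \<sigma>))"
      using le_trans by blast+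
  qed
  ultimately show ?thesis unfolding computable_def by blast
qed

section \<open>From sweep machines to Turing machines\<close>

datatype tstate = Go st | Back st | Scan bool | Yes | No

type_synonym 'm aconf = "tstate \<times> (int \<Rightarrow> 'm cell option) \<times> int"

text \<open>The blanks, read as \<open>None\<close>, delimit the word on both sides, and the head
  turns at them. When the sweep machine stops, the last return to the left is made in
  \<open>Scan\<close>, whose bit collects whether some cell carries \<open>acc\<close>.\<close>

definition tm_delta where
  "tm_delta \<delta> \<epsilon> acc q a = (case q of
     Go s \<Rightarrow> (case a of
         Some c \<Rightarrow> (case \<delta> s c of (s', c') \<Rightarrow> (Go s', Some c', 1))
       | None \<Rightarrow> (case \<epsilon> s of Some s' \<Rightarrow> (Back s', None, -1) | None \<Rightarrow> (Scan False, None, -1)))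
   | Back s \<Rightarrow> (case a of Some c \<Rightarrow> (Back s, a, -1) | None \<Rightarrow> (Go s, a, 1))
   | Scan b \<Rightarrow> (case a of
         Some c \<Rightarrow> (Scan (b \<or> acc \<in> snd c), a, -1)
       | None \<Rightarrow> (if b then Yes else No, a, 0))
   | _ \<Rightarrow> (q, a, 0 :: int))"

definition aconf_step where
  "aconf_step D c = (case c of (q, T, h) \<Rightarrow>
     case D q (T h) of (q', a, d) \<Rightarrow> (q', T(h := a), h + d))"

text \<open>\<open>X\<close> and \<open>Y\<close> record along the run that only listed states and
  symbols occur, since \<open>position\<close> can be decoded only for those. No step leaves
  \<open>Yes\<close> or \<open>No\<close> because \<open>tm_step\<close> does not consult
  \<open>delta\<close> there.\<close>

inductive areach for D :: "tstate \<Rightarrow> 'm cell option \<Rightarrow> tstate \<times> 'm cell option \<times> int" and X :: "tstate set" and Y :: "'m cell option set" where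
  areach_refl: "areach D X Y 0 c c"
| areach_step: "q \<in> X \<Longrightarrow> q \<noteq> Yes \<Longrightarrow> q \<noteq> No \<Longrightarrow> range T \<subseteq> Y \<Longrightarrow>
    areach D X Y n (aconf_step D (q, T, h)) c \<Longrightarrow> areach D X Y (Suc n) (q, T, h) c"

lemma areach_trans:
  "areach D X Y n c c' \<Longrightarrow> areach D X Y m c' c'' \<Longrightarrow> areach D X Y (n + m) c c''"
  by (induction rule: areach.induct) (auto intro: areach.intros)

section \<open>Numbering of states and symbols\<close>

definition position :: "'a list \<Rightarrow> 'a \<Rightarrow> nat" where
  "position xs x = (LEAST i. i < length xs \<and> xs ! i = x)"

lemma position:
  assumes "x \<in> set xs"
  shows "position xs x < length xs" "xs ! position xs x = x"
proof -
  have "\<exists>i. i < length xs \<and> xs ! i = x" using assms by (simp add: in_set_conv_nth)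
  then have "position xs x < length xs \<and> xs ! position xs x = x"
    unfolding position_def by (rule LeastI_ex)
  then show "position xs x < length xs" "xs ! position xs x = x" by auto
qed

lemma position_nth: "distinct xs \<Longrightarrow> i < length xs \<Longrightarrow> position xs (xs ! i) = i"
  using position[of "xs ! i" xs] nth_eq_iff_index_eq[of xs "position xs (xs ! i)" i] by simp

text \<open>The model prescribes the numbers of the initial, accepting and rejecting state, of the
  blank and of the input symbols. Enumerations with a prescribed beginning provide them.\<close>

lemma extend_distinct:
  assumes "finite X" "distinct xs" "set xs \<subseteq> X"
  shows "\<exists>ys. distinct (xs @ ys) \<and> set (xs @ ys) = X"
proof -
  obtain ys where "distinct ys" "set ys = X - set xs"
    using finite_distinct_list[of "X - set xs"] assms by auto
  with assms show ?thesis by (intro exI[of _ ys]) auto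
qed

definition coded_tm where
  "coded_tm qs as D = \<lparr>nstates = length qs, nsyms = length as,
     delta = \<lambda>q a. case D (qs ! q) (as ! a) of (q', a', d) \<Rightarrow> (position qs q', position as a', d)\<rparr>"

definition coded_conf where
  "coded_conf qs as c = (case c of (q, T, h) \<Rightarrow> (position qs q, \<lambda>i. position as (T i), h))"

lemma areach_coded:
  assumes "areach D (set qs) (set as) n c c'"
    and "distinct qs" "1 < length qs" "2 < length qs" "qs ! 1 = Yes" "qs ! 2 = No"
  shows "(tm_step (coded_tm qs as D) ^^ n) (coded_conf qs as c) = coded_conf qs as c'"
  using assms
proof (induction rule: areach.induct)
  case (areach_refl c)
  then show ?case by simp
next
  case (areach_step q T n h c)
  have q: "position qs q \<noteq> 1" "position qs q \<noteq> 2" "qs ! position qs q = q"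
    using areach_step.hyps areach_step.prems position[of q qs] by metis+
  have a: "as ! position as (T h) = T h"
    using areach_step.hyps by (intro position) auto
  have "tm_step (coded_tm qs as D) (coded_conf qs as (q, T, h)) =
      coded_conf qs as (aconf_step D (q, T, h))"
    using q a by (auto simp: tm_step_def coded_tm_def coded_conf_def aconf_step_def fun_eq_iff
        split: prod.splits)
  then show ?case
    using areach_step by (simp add: funpow_swap1)
qed

section \<open>Sweeps as head movements\<close>

definition tape :: "'c list \<Rightarrow> int \<Rightarrow> 'c option" where
  "tape u i = (if 0 \<le> i \<and> nat i < length u then Some (u ! nat i) else None)"

lemma tape_simps [simp]:
  "tape u (-1) = None" "tape u (int (length u)) = None"
  "j < length u \<Longrightarrow> tape u (int j) = Some (u ! j)"
  by (auto simp: tape_def)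

lemma tape_update: "(tape (l @ c # u))(int (length l) := Some c') = tape (l @ c' # u)"
  by (auto simp: tape_def fun_eq_iff nth_append nth_Cons split: nat.splits)

lemma sweep_fst:
  assumes "closed_machine Q \<delta> \<epsilon>" "s \<in> Q" "sweep \<delta> s u = (s', u')"
  shows "s' \<in> Q" "map fst u' = map fst u"
proof -
  have "s' \<in> Q \<and> map fst u' = map fst u"
    using assms(2,3)
  proof (induction u arbitrary: s u')
    case (Cons c u)
    obtain s1 c1 u1 where *: "\<delta> s c = (s1, c1)" "sweep \<delta> s1 u = (s', u1)" "u' = c1 # u1"
      using Cons.prems by (auto split: prod.splits)
    have "s1 \<in> Q" "fst c1 = fst c"
      using assms(1) Cons.prems(1) *(1) unfolding closed_machine_def by (metis fst_conv snd_conv)+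
    with Cons.IH[OF _ *(2)] * show ?case by auto
  qed auto
  then show "s' \<in> Q" "map fst u' = map fst u" by auto
qed

context
  fixes Q :: "st set" and \<delta> :: "st \<Rightarrow> 'm cell \<Rightarrow> st \<times> 'm cell" and \<epsilon> and acc :: 'm
    and D :: "tstate \<Rightarrow> 'm cell option \<Rightarrow> tstate \<times> 'm cell option \<times> int"
    and X and Y :: "'m cell option set"
  assumes cm: "closed_machine Q \<delta> \<epsilon>"
  defines "D \<equiv> tm_delta \<delta> \<epsilon> acc"
  defines "X \<equiv> {Yes, No} \<union> Scan ` UNIV \<union> Go ` Q \<union> Back ` Q"
  defines "Y \<equiv> insert None (Some ` ({1..4} \<times> UNIV))"
begin

private lemma tape_Y: "fst ` set u \<subseteq> {1..4} \<Longrightarrow> range (tape u) \<subseteq> Y"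
proof -
  assume *: "fst ` set u \<subseteq> {1..4}"
  have "u ! j \<in> {1..4} \<times> UNIV" if "j < length u" for j
    using * that nth_mem[OF that] by (cases "u ! j") force
  then show ?thesis by (auto simp: tape_def Y_def)
qed

private lemma go_right:
  assumes "s \<in> Q" "fst ` set (l @ u) \<subseteq> {1..4}" "sweep \<delta> s u = (s', u')"
  shows "areach D X Y (length u) (Go s, tape (l @ u), int (length l))
    (Go s', tape (l @ u'), int (length (l @ u)))"
  using assms
proof (induction u arbitrary: s l u')
  case Nil
  then show ?case by (auto intro: areach_refl)
next
  case (Cons c u)
  obtain s1 c1 u1 where *: "\<delta> s c = (s1, c1)" "sweep \<delta> s1 u = (s', u1)" "u' = c1 # u1"
    using Cons.prems by (auto split: prod.splits)
  have s1: "s1 \<in> Q" "fst c1 = fst c"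
    using cm Cons.prems(1) *(1) unfolding closed_machine_def by (metis fst_conv snd_conv)+
  have "tape (l @ c # u) (int (length l)) = Some c" by (simp add: nth_append)
  then have st: "aconf_step D (Go s, tape (l @ c # u), int (length l)) =
      (Go s1, tape ((l @ [c1]) @ u), int (length (l @ [c1])))"
    using *(1) by (simp add: aconf_step_def D_def tm_delta_def tape_update)
  have "areach D X Y (length u) (Go s1, tape ((l @ [c1]) @ u), int (length (l @ [c1])))
     (Go s', tape ((l @ [c1]) @ u1), int (length ((l @ [c1]) @ u)))"
    using s1 * Cons.prems by (intro Cons.IH) auto
  then have "areach D X Y (Suc (length u)) (Go s, tape (l @ c # u), int (length l))
     (Go s', tape ((l @ [c1]) @ u1), int (length ((l @ [c1]) @ u)))"
    using Cons.prems st tape_Y by (intro areach_step) (auto simp: X_def)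
  with * show ?case by simp
qed

private lemma go_back:
  assumes "s \<in> Q" "fst ` set u \<subseteq> {1..4}" "j \<le> length u"
  shows "areach D X Y j (Back s, tape u, int j - 1) (Back s, tape u, -1)"
  using assms(3)
proof (induction j)
  case (Suc j)
  then have st: "aconf_step D (Back s, tape u, int j) = (Back s, tape u, int j - 1)"
    by (auto simp: aconf_step_def D_def tm_delta_def fun_eq_iff)
  have "areach D X Y (Suc j) (Back s, tape u, int j) (Back s, tape u, -1)"
    using Suc tape_Y assms by (intro areach_step) (auto simp: st X_def)
  then show ?case by simp
qed (auto intro: areach_refl)

private lemma scan_back:
  assumes "fst ` set u \<subseteq> {1..4}" "j \<le> length u"
  shows "areach D X Y j (Scan b, tape u, int j - 1)
    (Scan (b \<or> (\<exists>i<j. acc \<in> snd (u ! i))), tape u, -1)"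
  using assms(2)
proof (induction j arbitrary: b)
  case (Suc j)
  then have st: "aconf_step D (Scan b, tape u, int j) =
      (Scan (b \<or> acc \<in> snd (u ! j)), tape u, int j - 1)"
    by (auto simp: aconf_step_def D_def tm_delta_def fun_eq_iff)
  have "areach D X Y (Suc j) (Scan b, tape u, int j)
      (Scan ((b \<or> acc \<in> snd (u ! j)) \<or> (\<exists>i<j. acc \<in> snd (u ! i))), tape u, -1)"
    using Suc.prems Suc.IH[of "b \<or> acc \<in> snd (u ! j)"] tape_Y assms
    by (intro areach_step) (auto simp: st X_def disj_assoc)
  moreover have "((b \<or> acc \<in> snd (u ! j)) \<or> (\<exists>i<j. acc \<in> snd (u ! i))) = (b \<or> (\<exists>i<Suc j. acc \<in> snd (u ! i)))"
    by (auto simp: less_Suc_eq)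
  ultimately show ?case by simp
qed (auto intro: areach_refl)

text \<open>A round takes one step per cell in either direction and one on each of the two blanks.
  The closing scan costs as much as a return, so the last round has the same price.\<close>

private lemma exec_areach:
  assumes "exec \<delta> \<epsilon> n s u v" "s \<in> Q" "fst ` set u \<subseteq> {1..4}"
  shows "areach D X Y (n * (2 * length u + 2)) (Go s, tape u, 0)
    (if \<exists>c\<in>set v. acc \<in> snd c then Yes else No, tape v, -1)"
  using assms
proof (induction rule: exec.induct)
  case (exec_stop s u s' u')
  have mf: "map fst u' = map fst u" and s': "s' \<in> Q"
    using sweep_fst[OF cm _ exec_stop.hyps(1)] exec_stop.prems by auto
  have len: "length u' = length u" using mf map_eq_imp_length_eq by blast
  have u': "fst ` set u' \<subseteq> {1..4}" using exec_stop.prems mf by (metis set_map)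
  have 1: "areach D X Y (length u) (Go s, tape u, 0) (Go s', tape u', int (length u'))"
    using go_right[of s "[]" u s' u'] exec_stop len by simp
  have "aconf_step D (Go s', tape u', int (length u')) = (Scan False, tape u', int (length u') - 1)"
    using exec_stop.hyps(2) by (auto simp: aconf_step_def D_def tm_delta_def fun_eq_iff)
  then have 2: "areach D X Y (Suc (length u)) (Go s', tape u', int (length u'))
      (Scan (\<exists>i<length u'. acc \<in> snd (u' ! i)), tape u', -1)"
    using scan_back[OF u' order.refl, of False] s' tape_Y[OF u'] len
    by (intro areach_step) (auto simp: X_def)
  let ?b = "\<exists>i<length u'. acc \<in> snd (u' ! i)"
  have b: "?b = (\<exists>c\<in>set u'. acc \<in> snd c)" by (metis in_set_conv_nth)
  have "aconf_step D (Scan ?b, tape u', -1) = (if ?b then Yes else No, tape u', -1)"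
    by (auto simp: aconf_step_def D_def tm_delta_def fun_eq_iff)
  then have 3: "areach D X Y (Suc 0) (Scan ?b, tape u', -1) (if ?b then Yes else No, tape u', -1)"
    using tape_Y[OF u'] by (intro areach_step) (auto simp: X_def intro: areach_refl)
  have "areach D X Y (length u + (Suc (length u) + Suc 0)) (Go s, tape u, 0)
      (if ?b then Yes else No, tape u', -1)"
    by (intro areach_trans[OF 1] areach_trans[OF 2] 3)
  moreover have "length u + (Suc (length u) + Suc 0) = Suc 0 * (2 * length u + 2)" by simp
  ultimately show ?case unfolding b by argo
next
  case (exec_step s u s' u' s'' n v)
  have mf: "map fst u' = map fst u" and s': "s' \<in> Q"
    using sweep_fst[OF cm _ exec_step.hyps(1)] exec_step.prems by auto
  have s'': "s'' \<in> Q" using s' exec_step.hyps(2) cm unfolding closed_machine_def by blast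
  have len: "length u' = length u" using mf map_eq_imp_length_eq by blast
  have u': "fst ` set u' \<subseteq> {1..4}" using exec_step.prems mf by (metis set_map)
  have 1: "areach D X Y (length u) (Go s, tape u, 0) (Go s', tape u', int (length u'))"
    using go_right[of s "[]" u s' u'] exec_step len by simp
  have "aconf_step D (Go s', tape u', int (length u')) = (Back s'', tape u', int (length u') - 1)"
    using exec_step.hyps(2) by (auto simp: aconf_step_def D_def tm_delta_def fun_eq_iff)
  then have 2: "areach D X Y (Suc (length u)) (Go s', tape u', int (length u'))
      (Back s'', tape u', -1)"
    using go_back[OF s'' u' order.refl] s' tape_Y[OF u'] len
    by (intro areach_step) (auto simp: X_def)
  have "aconf_step D (Back s'', tape u', -1) = (Go s'', tape u', 0)"
    by (auto simp: aconf_step_def D_def tm_delta_def fun_eq_iff)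
  then have 3: "areach D X Y (Suc 0) (Back s'', tape u', -1) (Go s'', tape u', 0)"
    using tape_Y[OF u'] s'' by (intro areach_step) (auto simp: X_def intro: areach_refl)
  have 4: "areach D X Y (n * (2 * length u + 2)) (Go s'', tape u', 0)
      (if \<exists>c\<in>set v. acc \<in> snd c then Yes else No, tape v, -1)"
    using exec_step.IH[OF s'' u'] len by simp
  have "areach D X Y (length u + (Suc (length u) + (Suc 0 + n * (2 * length u + 2)))) (Go s, tape u, 0)
      (if \<exists>c\<in>set v. acc \<in> snd c then Yes else No, tape v, -1)"
    by (intro areach_trans[OF 1] areach_trans[OF 2] areach_trans[OF 3] 4)
  moreover have "length u + (Suc (length u) + (Suc 0 + n * (2 * length u + 2))) =
    Suc n * (2 * length u + 2)" by simp
  ultimately show ?case by argo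
qed

lemma machine_to_tm:
  assumes "finite (UNIV :: 'm set)" "s0 \<in> Q"
  shows "\<exists>M. is_TM M \<and> (\<forall>w \<sigma> n. set w \<subseteq> {1..4} \<longrightarrow>
    exec \<delta> \<epsilon> n s0 (cells w (\<lambda>_. {})) (cells w \<sigma>) \<longrightarrow> wf_state w \<sigma> \<longrightarrow>
    fst (tm_run M w (n * (2 * length w + 2))) = (if \<sigma> acc \<noteq> {} then 1 else 2))"
proof -
  have "finite X" using cm by (auto simp: X_def closed_machine_def)
  moreover have "distinct [Go s0, Yes, No]" "set [Go s0, Yes, No] \<subseteq> X"
    using assms by (auto simp: X_def)
  ultimately obtain qs' where "distinct ([Go s0, Yes, No] @ qs')" "set ([Go s0, Yes, No] @ qs') = X"
    using extend_distinct by blast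
  then obtain qs where qs: "distinct qs" "set qs = X" "qs = [Go s0, Yes, No] @ qs'" by blast
  have "finite (UNIV :: 'm set set)" using assms(1) by (metis Pow_UNIV finite_Pow_iff)
  then have "finite Y" unfolding Y_def by (intro finite.insertI finite_imageI finite_cartesian_product) auto
  \<comment> \<open>In this order the blank gets number \<open>0\<close> and the unmarked symbol
    \<open>j\<close> gets number \<open>j\<close>, so that the plain input already is the coded
    initial tape.\<close>
  let ?sy = "[None, Some (1, {}), Some (2, {}), Some (3, {}), Some (4, {})]
    :: 'm cell option list"
  have "distinct ?sy" "set ?sy \<subseteq> Y" by (auto simp: Y_def)
  with \<open>finite Y\<close> obtain as' where "distinct (?sy @ as')" "set (?sy @ as') = Y"
    using extend_distinct by blast
  then obtain as where as: "distinct as" "set as = Y" "as = ?sy @ as'" by blast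
  have nq: "qs ! 0 = Go s0" "qs ! 1 = Yes" "qs ! 2 = No" "2 < length qs"
    using qs by auto
  have na: "as ! 0 = None" "\<And>j. 1 \<le> j \<Longrightarrow> j \<le> 4 \<Longrightarrow> as ! j = Some (j, {})" "4 < length as"
    using as by (auto simp: nth_Cons' numeral_eq_Suc not_less_eq_eq le_Suc_eq)
  let ?M = "coded_tm qs as D"
  have DX: "fst (D q a) \<in> X \<and> fst (snd (D q a)) \<in> Y \<and> snd (snd (D q a)) \<in> {-1, 0, 1}"
    if "q \<in> X" "a \<in> Y" for q a
  proof -
    have "fst (\<delta> s c) \<in> Q" "fst (snd (\<delta> s c)) = fst c" "\<epsilon> s = Some s' \<Longrightarrow> s' \<in> Q"
      if "s \<in> Q" for s c s'
      using cm that unfolding closed_machine_def by blast+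
    note * = this
    show ?thesis
    proof (cases q)
      case (Go s)
      then have s: "s \<in> Q" using \<open>q \<in> X\<close> by (auto simp: X_def)
      show ?thesis
      proof (cases a)
        case None
        then show ?thesis using Go s *(3)[OF s] by (auto simp: D_def tm_delta_def X_def Y_def split: option.splits)
      next
        case (Some c)
        obtain s1 b M where d: "\<delta> s c = (s1, (b, M))" by (metis prod.exhaust)
        have "s1 \<in> Q" "b \<in> {1..4}" using *(1)[OF s, where c = c] *(2)[OF s, where c = c] d \<open>a \<in> Y\<close> Some by (auto simp: Y_def)
        then show ?thesis using Go Some d by (auto simp: D_def tm_delta_def X_def Y_def)
      qed
    qed (use that in \<open>auto simp: D_def tm_delta_def X_def Y_def split: option.splits\<close>)
  qed
  have "is_TM ?M"
    unfolding is_TM_def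
  proof (intro conjI allI impI)
    show "3 \<le> nstates ?M" "5 \<le> nsyms ?M" using nq na by (auto simp: coded_tm_def)
    fix q a assume "q < nstates ?M" "a < nsyms ?M"
    then have "qs ! q \<in> X" "as ! a \<in> Y"
      using qs(2) as(2) nth_mem unfolding coded_tm_def by fastforce+
    then have "fst (D (qs ! q) (as ! a)) \<in> set qs" "fst (snd (D (qs ! q) (as ! a))) \<in> set as"
        "snd (snd (D (qs ! q) (as ! a))) \<in> {-1, 0, 1}"
      using DX qs as by blast+
    then show "case delta ?M q a of (q', w, d) \<Rightarrow> q' < nstates ?M \<and> w < nsyms ?M \<and> d \<in> {- 1, 0, 1}"
      by (auto simp: coded_tm_def position(1) split: prod.splits)
  qed
  moreover have "fst (tm_run ?M w (n * (2 * length w + 2))) = (if \<sigma> acc \<noteq> {} then 1 else 2)"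
    if w: "set w \<subseteq> {1..4}" and ex: "exec \<delta> \<epsilon> n s0 (cells w (\<lambda>_. {})) (cells w \<sigma>)" and wf: "wf_state w \<sigma>"
    for w \<sigma> n
  proof -
    let ?u = "cells w (\<lambda>_. {} :: nat set) :: 'm cell list"
    have len: "length ?u = length w" by (simp add: cells_def)
    have u: "fst ` set ?u \<subseteq> {1..4}"
      using w by (auto simp: cells_def subset_iff)
    have acc: "(\<exists>c\<in>set (cells w \<sigma>). acc \<in> snd c) = (\<sigma> acc \<noteq> {})"
      using wf by (fastforce simp: cells_def wf_state_def)
    have r: "areach D X Y (n * (2 * length w + 2)) (Go s0, tape ?u, 0)
      (if \<sigma> acc \<noteq> {} then Yes else No, tape (cells w \<sigma>), -1)"
      using exec_areach[OF ex assms(2) u] unfolding len acc .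
    have p0: "position qs (Go s0) = 0" "position qs Yes = 1" "position qs No = 2"
      using position_nth[OF qs(1), of 0] position_nth[OF qs(1), of 1] position_nth[OF qs(1), of 2] nq
        less_trans[OF _ nq(4), of 0] by auto
    have pa: "position as None = 0" "\<And>j. 1 \<le> j \<Longrightarrow> j \<le> 4 \<Longrightarrow> position as (Some (j, {})) = j"
      using position_nth[OF as(1)] na
      by (metis (no_types, lifting) le_less_trans le0, metis (no_types, lifting) le_less_trans)
    have "tm_init w = coded_conf qs as (Go s0, tape ?u, 0)"
    proof -
      have "(if 0 \<le> i \<and> nat i < length w then w ! nat i else 0) = position as (tape ?u i)" for i
      proof (cases "0 \<le> i \<and> nat i < length w")
        case True
        then have "w ! nat i \<in> {1..4}" using w nth_mem by blast
        with True show ?thesis using pa(2) by (simp add: tape_def len) (simp add: cells_def)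
      qed (auto simp: tape_def len pa)
      then show ?thesis by (simp add: tm_init_def coded_conf_def p0)
    qed
    then have "tm_run ?M w (n * (2 * length w + 2)) =
        coded_conf qs as (if \<sigma> acc \<noteq> {} then Yes else No, tape (cells w \<sigma>), -1)"
      unfolding tm_run_def using areach_coded[of D qs as, unfolded qs(2) as(2), OF r qs(1)] nq by simp
    then show ?thesis by (simp add: coded_conf_def p0)
  qed
  ultimately show ?thesis by blast
qed

end

lemma computable_poly_time_decides:
  fixes F :: "('m :: finite) prog"
  assumes "computable F"
    and correct: "\<And>V H vs es. D V H \<Longrightarrow> represents V H vs es \<Longrightarrow>
      F (enc_input vs es) (\<lambda>_. {}) acc \<noteq> {} \<longleftrightarrow> P V H"
  shows "\<exists>M. is_TM M \<and> poly_time_decides M D P"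
proof -
  obtain Q \<delta> \<epsilon> s0 T where 1: "closed_machine Q \<delta> \<epsilon>" "s0 \<in> Q" "computes_with \<delta> \<epsilon> s0 T F"
    using assms(1) unfolding computable_def by blast
  obtain M where M: "is_TM M" "\<And>w \<sigma> n. set w \<subseteq> {1..4} \<Longrightarrow>
    exec \<delta> \<epsilon> n s0 (cells w (\<lambda>_. {})) (cells w \<sigma>) \<Longrightarrow> wf_state w \<sigma> \<Longrightarrow>
    fst (tm_run M w (n * (2 * length w + 2))) = (if \<sigma> acc \<noteq> {} then 1 else 2)"
    using machine_to_tm[OF 1(1) finite_UNIV 1(2), of acc] by blast
  have "poly_bound (\<lambda>n. T n * (2 * n + 2))"
    using 1(3) by (auto simp: computes_with_def intro!: poly_bound_intros)
  then obtain a b where ab: "\<And>n. T n * (2 * n + 2) \<le> a * (n + 1) ^ b"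
    unfolding poly_bound_def by blast
  have bin: "set (bin n) \<subseteq> {1..4}" for n
    by (induction n rule: bin.induct) (subst bin.simps, auto simp del: bin.simps)
  have num: "set (enc_nums xs) \<subseteq> {1..4}" for xs
    using bin by (auto simp: enc_nums_def simp del: bin.simps)
  have w: "set (enc_input vs es) \<subseteq> {1..4}" for vs es
    using num by (auto simp: enc_input_def)
  have "poly_time_decides M D P"
    unfolding poly_time_decides_def
  proof (rule exI[of _ a], rule exI[of _ b], intro allI impI)
    fix V H vs es assume D: "D V H" "represents V H vs es"
    let ?w = "enc_input vs es"
    have "wf_state ?w (\<lambda>_. {} :: nat set)" by (simp add: wf_state_def)
    then obtain n where n: "n \<le> T (length ?w)"
      "exec \<delta> \<epsilon> n s0 (cells ?w (\<lambda>_. {})) (cells ?w (F ?w (\<lambda>_. {})))" "wf_state ?w (F ?w (\<lambda>_. {}))"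
      using 1(3) unfolding computes_with_def by blast
    have le: "n * (2 * length ?w + 2) \<le> a * (length ?w + 1) ^ b"
      using ab[of "length ?w"] mult_le_mono1[OF n(1)] le_trans by blast
    show "\<exists>t\<le>a * (length ?w + 1) ^ b. fst (tm_run M ?w t) \<in> {1, 2} \<and> (fst (tm_run M ?w t) = 1) = P V H"
      using le M(2)[OF w n(2,3)] correct[OF D] by (intro exI[of _ "n * (2 * length ?w + 2)"]) auto
  qed
  with M(1) show ?thesis by blast
qed

section \<open>Positions in the encoded input\<close>

text \<open>A number in the input is represented by the position where its block starts (the position of its
  terminator \<open>3\<close> in case of the number \<open>0\<close>), an edge by the position of the symbol \<open>4\<close> preceding it.
  The last symbol \<open>4\<close> precedes no number, so it is excluded by requiring \<open>edge_occs w e \<noteq> {}\<close>.\<close>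

definition occ :: "nat list \<Rightarrow> nat \<Rightarrow> bool" where
  "occ w i \<longleftrightarrow> i < length w \<and> w ! i \<noteq> 4 \<and> (i = 0 \<or> w ! (i - 1) = 3 \<or> w ! (i - 1) = 4)"

definition block :: "nat list \<Rightarrow> nat \<Rightarrow> nat list" where
  "block w i = takeWhile (\<lambda>a. a = 1 \<or> a = 2) (drop i w)"

primrec unbin :: "nat list \<Rightarrow> nat" where
  "unbin [] = 0"
| "unbin (b # bs) = (b - 1) + 2 * unbin bs"

definition val :: "nat list \<Rightarrow> nat \<Rightarrow> nat" where
  "val w i = unbin (block w i)"

definition vertex_occs :: "nat list \<Rightarrow> nat set" where
  "vertex_occs w = {i. occ w i \<and> (\<forall>j<i. w ! j \<noteq> 4)}"

definition edge_occs :: "nat list \<Rightarrow> nat \<Rightarrow> nat set" where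
  "edge_occs w e = {i. occ w i \<and> e < i \<and> (\<forall>j. e < j \<and> j < i \<longrightarrow> w ! j \<noteq> 4)}"

declare bin.simps [simp del]

section \<open>Binary numerals in the word\<close>

lemma set_bin: "set (bin n) \<subseteq> {1, 2}"
  by (induction n rule: bin.induct) (subst bin.simps, auto)

lemma unbin_bin: "unbin (bin n) = n"
proof (induction n rule: bin.induct)
  case (1 n)
  then show ?case by (subst bin.simps) auto
qed

lemma enc_nums_simps [simp]:
  "enc_nums [] = []" "enc_nums (x # xs) = bin x @ 3 # enc_nums xs"
  by (auto simp: enc_nums_def)

lemma set_enc_nums: "set (enc_nums xs) \<subseteq> {1, 2, 3}"
  using set_bin by (induction xs) fastforce+

lemma block_bin: "drop i w = bin x @ 3 # r \<Longrightarrow> block w i = bin x"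
  using set_bin[of x] by (auto simp: block_def takeWhile_append)

lemma val_bin: "drop i w = bin x @ 3 # r \<Longrightarrow> val w i = x"
  by (simp add: val_def block_bin unbin_bin)

definition starts_number :: "nat list \<Rightarrow> nat \<Rightarrow> bool" where
  "starts_number w i \<longleftrightarrow> (\<exists>x r. drop i w = bin x @ 3 # r)"

lemma starts_number_block:
  assumes "starts_number w i"
  shows "i + length (block w i) < length w" "w ! (i + length (block w i)) = 3"
    "\<And>j. j < length (block w i) \<Longrightarrow> w ! (i + j) = block w i ! j"
    "set (block w i) \<subseteq> {1, 2}"
proof -
  obtain x r where x: "drop i w = bin x @ 3 # r" using assms by (auto simp: starts_number_def)
  have b: "block w i = bin x" using x by (rule block_bin)
  have "length (drop i w) = length (bin x) + Suc (length r)" using x by simp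
  then have l: "i + length (bin x) < length w" by simp
  have n: "w ! (i + j) = (bin x @ 3 # r) ! j" if "j \<le> length (bin x)" for j
    using that l x by (metis add_leD1 le_add_diff_inverse less_imp_le_nat nth_drop)
  show "i + length (block w i) < length w" "w ! (i + length (block w i)) = 3"
    "\<And>j. j < length (block w i) \<Longrightarrow> w ! (i + j) = block w i ! j" "set (block w i) \<subseteq> {1, 2}"
    using l n set_bin by (auto simp: b nth_append)
qed

text \<open>\<open>bin\<close> produces exactly one numeral per number, which is what makes a
  comparison symbol by symbol sound.\<close>

lemma val_eq_iff:
  assumes "starts_number w i" "starts_number w j"
  shows "val w i = val w j \<longleftrightarrow> block w i = block w j"
  using assms by (metis block_bin starts_number_def val_bin val_def)

text \<open>Only the lengths of \<open>l\<close> and \<open>u\<close> enter; the intended word is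
  \<open>l @ u @ r\<close>. Additivity in \<open>u\<close> drives the inductions over the
  encoding.\<close>

definition region :: "nat list \<Rightarrow> nat list \<Rightarrow> nat list \<Rightarrow> nat set" where
  "region l u w = {i. occ w i \<and> length l \<le> i \<and> i < length l + length u}"

lemma region_append:
  "region l (u @ v) w = region l u w \<union> region (l @ u) v w"
  by (auto simp: region_def)

text \<open>Every later position of the block is preceded by a digit, hence only the first one
  counts. For \<open>x = 0\<close> that first position is the terminator itself.\<close>

lemma region_number:
  assumes w: "w = l @ bin x @ 3 # r" and l: "l = [] \<or> last l = 3 \<or> last l = 4"
  shows "region l (bin x @ [3]) w = {length l}"
proof -
  have bx: "(bin x) ! j = 1 \<or> bin x ! j = 2" if "j < length (bin x)" for j
    using set_bin[of x] nth_mem[OF that] by blast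
  have "occ w (length l)"
  proof -
    have "w ! length l = (bin x @ 3 # r) ! 0" by (simp add: w nth_append)
    also have "\<dots> \<noteq> 4" using bx[of 0] by (auto simp: nth_append)
    finally have "w ! length l \<noteq> 4" .
    moreover have "w ! (length l - 1) = last l" if "l \<noteq> []"
      using that by (simp add: w nth_append last_conv_nth)
    ultimately show ?thesis using l by (auto simp: occ_def w)
  qed
  moreover have "i = length l" if i: "occ w i" "length l \<le> i" "i < length l + Suc (length (bin x))" for i
  proof (rule ccontr)
    assume "i \<noteq> length l"
    then obtain j where j: "i = Suc (length l + j)" using i(2)
      by (metis add_Suc_right le_add_diff_inverse less_iff_Suc_add order_le_imp_less_or_eq)
    then have "j < length (bin x)" using i(3) by simp
    then have "w ! (i - 1) = 1 \<or> w ! (i - 1) = 2" using bx j by (simp add: w nth_append)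
    with i(1) j show False by (auto simp: occ_def)
  qed
  ultimately show ?thesis by (auto simp: region_def)
qed

lemma region_enc_nums:
  assumes "w = l @ enc_nums xs @ r" "l = [] \<or> last l = 3 \<or> last l = 4"
  shows "val w ` region l (enc_nums xs) w = set xs \<and>
    (distinct xs \<longrightarrow> inj_on (val w) (region l (enc_nums xs) w)) \<and>
    (\<forall>i\<in>region l (enc_nums xs) w. starts_number w i)"
  using assms
proof (induction xs arbitrary: l)
  case Nil
  have "region l (enc_nums []) w = {}" by (auto simp: region_def)
  then show ?case by simp
next
  case (Cons x xs)
  have w1: "w = l @ bin x @ 3 # (enc_nums xs @ r)" using Cons.prems by simp
  have IH: "val w ` region (l @ bin x @ [3]) (enc_nums xs) w = set xs"
    "distinct xs \<Longrightarrow> inj_on (val w) (region (l @ bin x @ [3]) (enc_nums xs) w)"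
    "\<And>i. i \<in> region (l @ bin x @ [3]) (enc_nums xs) w \<Longrightarrow> starts_number w i"
    using Cons.IH[of "l @ bin x @ [3]"] Cons.prems by auto
  have reg: "region l (enc_nums (x # xs)) w = insert (length l) (region (l @ bin x @ [3]) (enc_nums xs) w)"
    using region_append[of l "bin x @ [3]" "enc_nums xs" w] region_number[OF w1 Cons.prems(2)] by simp
  have dr: "drop (length l) w = bin x @ 3 # (enc_nums xs @ r)" using w1 by simp
  have v: "val w (length l) = x" using val_bin[OF dr] .
  have "starts_number w (length l)" using dr unfolding starts_number_def by blast
  moreover have "inj_on (val w) (region l (enc_nums (x # xs)) w)" if "distinct (x # xs)"
  proof -
    have "x \<notin> val w ` region (l @ bin x @ [3]) (enc_nums xs) w" unfolding IH(1) using that by simp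
    then show ?thesis unfolding reg using IH(2) that v by (auto simp: inj_on_insert)
  qed
  moreover have "val w ` region l (enc_nums (x # xs)) w = set (x # xs)"
    unfolding reg image_insert IH(1) v by simp
  ultimately show ?case using IH(3) unfolding reg by auto
qed

lemma nth_enc_nums_neq_4: "j < length (enc_nums xs) \<Longrightarrow> enc_nums xs ! j \<noteq> 4"
  using set_enc_nums[of xs] nth_mem by fastforce

abbreviation enc_edges :: "nat list list \<Rightarrow> nat list" where
  "enc_edges es \<equiv> concat (map (\<lambda>e. enc_nums e @ [4]) es)"

text \<open>The induction moves the prefix \<open>l\<close> past one edge at a time, and
  \<open>l\<close> always ends in the \<open>4\<close> that stands for the next edge; hence
  \<open>length l - 1\<close>. The last \<open>4\<close> is followed by no number, and neither would
  be the \<open>4\<close> of an empty edge, which is why empty edges are excluded.\<close>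

lemma enc_edges_occs:
  assumes "w = l @ enc_edges es" "l \<noteq> []" "last l = 4" "[] \<notin> set es"
  shows "{val w ` edge_occs w e | e. length l - 1 \<le> e \<and> e < length w \<and> w ! e = 4 \<and> edge_occs w e \<noteq> {}}
      = set ` set es \<and> (\<forall>i\<ge>length l. occ w i \<longrightarrow> starts_number w i)"
  using assms
proof (induction es arbitrary: l)
  case Nil
  have "edge_occs w e = {}" if "length l - 1 \<le> e" for e
    using that Nil by (auto simp: edge_occs_def occ_def)
  then show ?case using Nil by (auto simp: occ_def)
next
  case (Cons xs es)
  let ?l = "l @ enc_nums xs @ [4]"
  have w1: "w = l @ enc_nums xs @ 4 # enc_edges es" using Cons.prems by simp
  have IH: "{val w ` edge_occs w e | e. length ?l - 1 \<le> e \<and> e < length w \<and> w ! e = 4 \<and> edge_occs w e \<noteq> {}}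
      = set ` set es" "\<And>i. length ?l \<le> i \<Longrightarrow> occ w i \<Longrightarrow> starts_number w i"
    using Cons.IH[of ?l] Cons.prems by auto
  have R: "val w ` region l (enc_nums xs) w = set xs" "\<And>i. i \<in> region l (enc_nums xs) w \<Longrightarrow> starts_number w i"
    using region_enc_nums[OF w1] Cons.prems by auto
  have no4: "w ! j \<noteq> 4" if "length l \<le> j" "j < length l + length (enc_nums xs)" for j
    using nth_enc_nums_neq_4[of "j - length l" xs] that by (simp add: w1 nth_append)
  have at4: "w ! (length l + length (enc_nums xs)) = 4" by (simp add: w1 nth_append)
  have l4: "w ! (length l - 1) = 4" using Cons.prems(2,3) by (simp add: w1 nth_append last_conv_nth)
  have ll: "length l - 1 < length w" "0 < length l" using Cons.prems(2) by (auto simp: w1)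
  have e1: "edge_occs w (length l - 1) = region l (enc_nums xs) w"
  proof (intro set_eqI iffI)
    fix i assume i: "i \<in> edge_occs w (length l - 1)"
    then have "occ w i" "length l \<le> i" using ll by (auto simp: edge_occs_def)
    moreover have "i \<noteq> length l + length (enc_nums xs)" using \<open>occ w i\<close> at4 by (auto simp: occ_def)
    moreover have "\<not> length l + length (enc_nums xs) < i"
    proof
      assume *: "length l + length (enc_nums xs) < i"
      have "length l - 1 < length l + length (enc_nums xs)" using ll(2) by linarith
      with i * at4 show False unfolding edge_occs_def by blast
    qed
    ultimately show "i \<in> region l (enc_nums xs) w" by (auto simp: region_def)
  next
    fix i assume i: "i \<in> region l (enc_nums xs) w"
    then have "length l \<le> i" by (simp add: region_def)
    then have "length l - 1 < i" using ll(2) by linarith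
    with i show "i \<in> edge_occs w (length l - 1)" using no4 by (auto simp: edge_occs_def region_def)
  qed
  have "set xs \<noteq> {}" using Cons.prems(4) by auto
  then have ne: "edge_occs w (length l - 1) \<noteq> {}" using R(1) unfolding e1 by auto
  \<comment> \<open>The \<open>4\<close> closing this edge is at the same time the marker of the
    next one.\<close>
  have split: "length l - 1 \<le> e \<and> w ! e = 4 \<longleftrightarrow> e = length l - 1 \<or> length ?l - 1 \<le> e \<and> w ! e = 4" for e
  proof -
    have "length ?l - 1 = length l + length (enc_nums xs)" by simp
    moreover have "length l - 1 \<le> e \<longleftrightarrow> e = length l - 1 \<or> length l \<le> e" using ll(2) by linarith
    moreover have "length l \<le> e \<longleftrightarrow> length l \<le> e \<and> e < length l + length (enc_nums xs) \<or>
      length l + length (enc_nums xs) \<le> e" by linarith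
    ultimately show ?thesis using no4[of e] l4 by metis
  qed
  have "{val w ` edge_occs w e | e. length l - 1 \<le> e \<and> e < length w \<and> w ! e = 4 \<and> edge_occs w e \<noteq> {}}
    = insert (set xs) {val w ` edge_occs w e | e. length ?l - 1 \<le> e \<and> e < length w \<and> w ! e = 4 \<and> edge_occs w e \<noteq> {}}"
    (is "?A = insert _ ?B")
  proof (intro set_eqI iffI)
    fix X assume "X \<in> ?A"
    then obtain e where "X = val w ` edge_occs w e" "length l - 1 \<le> e \<and> w ! e = 4" "e < length w" "edge_occs w e \<noteq> {}"
      by blast
    then show "X \<in> insert (set xs) ?B" unfolding split using R(1) e1 by auto
  next
    fix X assume "X \<in> insert (set xs) ?B"
    then consider "X = set xs"
      | e where "X = val w ` edge_occs w e" "length ?l - 1 \<le> e \<and> w ! e = 4" "e < length w" "edge_occs w e \<noteq> {}"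
      by blast
    then show "X \<in> ?A"
    proof cases
      case 1
      then have "X = val w ` edge_occs w (length l - 1)" using R(1) e1 by simp
      with ne ll(1) l4 show ?thesis by blast
    next
      case (2 e)
      then have "length l - 1 \<le> e \<and> w ! e = 4" using split by blast
      with 2 show ?thesis by blast
    qed
  qed
  then have 1: "?A = set ` set (xs # es)" unfolding IH(1) by simp
  have 2: "starts_number w i" if "length l \<le> i" "occ w i" for i
  proof -
    have "i \<noteq> length l + length (enc_nums xs)" using that(2) at4 by (auto simp: occ_def)
    then consider "length ?l \<le> i" | "i < length l + length (enc_nums xs)" by fastforce
    then show ?thesis
    proof cases
      case 1
      then show ?thesis using IH(2) that by blast
    next
      case 2
      then show ?thesis using R(2)[of i] that by (auto simp: region_def)
    qed
  qed
  show ?case using 1 2 by blast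
qed

text \<open>The strict bound on the number of vertex positions, for which the separating
  \<open>4\<close> is responsible, later guarantees that as many rounds as the word has positions
  are enough.\<close>

lemma enc_input_occs:
  assumes "w = enc_input vs es" "[] \<notin> set es" "distinct vs"
  shows "val w ` vertex_occs w = set vs" "inj_on (val w) (vertex_occs w)"
    "{val w ` edge_occs w e | e. e < length w \<and> w ! e = 4 \<and> edge_occs w e \<noteq> {}} = set ` set es"
    "\<And>i. occ w i \<Longrightarrow> starts_number w i"
    "card (vertex_occs w) < length w"
proof -
  let ?l = "enc_nums vs @ [4]"
  have w: "w = [] @ enc_nums vs @ (4 # enc_edges es)" "w = ?l @ enc_edges es"
    using assms by (auto simp: enc_input_def)
  have R: "val w ` region [] (enc_nums vs) w = set vs" "inj_on (val w) (region [] (enc_nums vs) w)"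
    "\<And>i. i \<in> region [] (enc_nums vs) w \<Longrightarrow> starts_number w i"
    using region_enc_nums[OF w(1)] assms(3) by auto
  have E: "{val w ` edge_occs w e | e. length ?l - 1 \<le> e \<and> e < length w \<and> w ! e = 4 \<and> edge_occs w e \<noteq> {}}
      = set ` set es" "\<And>i. length ?l \<le> i \<Longrightarrow> occ w i \<Longrightarrow> starts_number w i"
    using enc_edges_occs[OF w(2)] assms(2) by auto
  have no4: "w ! j \<noteq> 4" if "j < length (enc_nums vs)" for j
    using nth_enc_nums_neq_4[of j vs] that by (simp add: w(1) nth_append)
  have at4: "w ! length (enc_nums vs) = 4" by (simp add: w(1) nth_append)
  have v: "vertex_occs w = region [] (enc_nums vs) w"
  proof (intro set_eqI iffI)
    fix i assume i: "i \<in> vertex_occs w"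
    then have "\<not> length (enc_nums vs) < i" using at4 by (auto simp: vertex_occs_def)
    moreover have "i \<noteq> length (enc_nums vs)" using i at4 by (auto simp: vertex_occs_def occ_def)
    ultimately show "i \<in> region [] (enc_nums vs) w" using i by (auto simp: vertex_occs_def region_def)
  next
    fix i assume "i \<in> region [] (enc_nums vs) w"
    then show "i \<in> vertex_occs w" using no4 by (auto simp: vertex_occs_def region_def)
  qed
  show "val w ` vertex_occs w = set vs" "inj_on (val w) (vertex_occs w)" using R v by auto
  show "{val w ` edge_occs w e | e. e < length w \<and> w ! e = 4 \<and> edge_occs w e \<noteq> {}} = set ` set es"
  proof -
    have "length ?l - 1 \<le> e" if "w ! e = 4" for e
      using that no4[of e] by (cases "e < length (enc_nums vs)") auto
    then show ?thesis unfolding E(1)[symmetric] by blast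
  qed
  show "starts_number w i" if "occ w i" for i
  proof -
    have "i \<noteq> length (enc_nums vs)" using that at4 by (auto simp: occ_def)
    then consider "length ?l \<le> i" | "i < length (enc_nums vs)" by fastforce
    then show ?thesis
      using E(2) R(3) that by cases (auto simp: region_def)
  qed
  have "vertex_occs w \<subseteq> {..<length (enc_nums vs)}" unfolding v by (auto simp: region_def)
  from card_mono[OF finite_lessThan this] have "card (vertex_occs w) \<le> length (enc_nums vs)" by simp
  then show "card (vertex_occs w) < length w" by (simp add: w(1))
qed

section \<open>Elimination orders and perfect matchings\<close>

text \<open>Being dominating or isolating depends only on the set of vertices up to the given one.
  This is the condition for an order of \<open>R\<close> with \<open>v\<close> last, so that orders
  need not be carried along.\<close>

definition uniform :: "nat \<Rightarrow> 'a set set \<Rightarrow> 'a set \<Rightarrow> 'a \<Rightarrow> bool" where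
  "uniform k H R v \<longleftrightarrow> (\<forall>E. card E = k \<and> v \<in> E \<and> E \<subseteq> R \<longrightarrow> E \<in> H) \<or>
     (\<forall>E. card E = k \<and> v \<in> E \<and> E \<subseteq> R \<longrightarrow> E \<notin> H)"

lemma orderable_extend:
  assumes "orderable k (R - {v}) H" "v \<in> R" "uniform k H R v"
  shows "orderable k R H"
proof -
  obtain vs where vs: "distinct vs" "set vs = R - {v}"
    "\<And>i. i < length vs \<Longrightarrow> dominating k H vs i \<or> isolating k H vs i"
    using assms(1) unfolding orderable_def by blast
  have "dominating k H (vs @ [v]) i \<or> isolating k H (vs @ [v]) i" if "i < length (vs @ [v])" for i
  proof (cases "i < length vs")
    case True
    with vs(3)[OF True] show ?thesis by (auto simp: dominating_def isolating_def nth_append)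
  next
    case False
    with that have "i = length vs" by simp
    moreover have "insert v (set vs) = R" using vs(2) assms(2) by blast
    ultimately show ?thesis
      using assms(3) by (auto simp: dominating_def isolating_def uniform_def)
  qed
  moreover have "distinct (vs @ [v])" "set (vs @ [v]) = R" using vs assms(2) by auto
  ultimately show ?thesis unfolding orderable_def by blast
qed

lemma orderable_last:
  assumes "orderable k R H" "R \<noteq> {}"
  shows "\<exists>v\<in>R. uniform k H R v \<and> orderable k (R - {v}) H"
proof -
  obtain vs where vs: "distinct vs" "set vs = R"
    "\<And>i. i < length vs \<Longrightarrow> dominating k H vs i \<or> isolating k H vs i"
    using assms(1) unfolding orderable_def by blast
  then obtain us v where us: "vs = us @ [v]" using assms(2) by (metis empty_set rev_exhaust)
  have "uniform k H R v"
    using vs(3)[of "length us"] vs(2) by (auto simp: us dominating_def isolating_def uniform_def)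
  moreover have "dominating k H us i \<or> isolating k H us i" if "i < length us" for i
    using vs(3)[of i] that by (auto simp: us dominating_def isolating_def nth_append)
  then have "orderable k (set us) H" using vs(1) us unfolding orderable_def by auto
  moreover have "set us = R - {v}" "v \<in> R" using vs us by auto
  ultimately show ?thesis by auto
qed

lemma orderable_empty: "orderable k {} H"
  by (auto simp: orderable_def)

text \<open>Deleting vertices from an elimination order only reduces the \<open>k\<close>-sets on
  which each remaining vertex has to be uniform.\<close>

lemma orderable_subset:
  assumes "finite R" "orderable k R H" "S \<subseteq> R"
  shows "orderable k S H"
  using assms
proof (induction "card R" arbitrary: R S)
  case 0
  then show ?case by (simp add: orderable_empty)
next
  case (Suc n)
  then have "R \<noteq> {}" by auto
  then obtain v where v: "v \<in> R" "uniform k H R v" "orderable k (R - {v}) H"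
    using orderable_last[OF Suc.prems(2)] by blast
  have IH: "orderable k S' H" if "S' \<subseteq> R - {v}" for S'
    using Suc.hyps(1)[of "R - {v}" S'] Suc.hyps(2) Suc.prems(1) v that by simp
  show ?case
  proof (cases "v \<in> S")
    case True
    have "uniform k H S v" using v(2) Suc.prems(3) unfolding uniform_def by blast
    moreover have "orderable k (S - {v}) H" using Suc.prems(3) by (intro IH) auto
    ultimately show ?thesis using orderable_extend True by metis
  next
    case False
    then show ?thesis using Suc.prems(3) by (intro IH) auto
  qed
qed

text \<open>This makes the greedy choice safe: any uniform vertex may be taken last, and no choice
  ever has to be revised.\<close>

lemma orderable_remove:
  assumes "finite R" "v \<in> R" "uniform k H R v"
  shows "orderable k (R - {v}) H \<longleftrightarrow> orderable k R H"
  using orderable_extend[OF _ assms(2,3)] orderable_subset[OF assms(1), of k H "R - {v}"] by blast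

text \<open>The \<open>k\<close>-subsets of \<open>R\<close> containing \<open>v\<close> are connected under exchanging one element other than \<open>v\<close>,
  so uniformity can be tested by single exchanges.\<close>

lemma uniform_iff_exchange:
  assumes "finite R" "\<And>E. E \<in> H \<Longrightarrow> card E = k" "v \<in> R" "k \<ge> 1"
  shows "uniform k H R v \<longleftrightarrow> (\<forall>E\<in>H. v \<in> E \<longrightarrow> E \<subseteq> R \<longrightarrow> (\<forall>x\<in>E - {v}. \<forall>y\<in>R - (E - {x}).
      \<exists>E'\<in>H. E' \<subseteq> insert y (E - {x})))" (is "_ \<longleftrightarrow> ?X")
proof
  assume u: "uniform k H R v"
  show ?X
  proof (intro ballI impI)
    fix E x y assume E: "E \<in> H" "v \<in> E" "E \<subseteq> R" "x \<in> E - {v}" "y \<in> R - (E - {x})"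
    have fin: "finite E" using E assms(1) finite_subset by blast
    have "card (insert y (E - {x})) = k"
      using E fin assms(2)[OF E(1)] assms(4) by (auto simp: card_insert_if)
    then have "insert y (E - {x}) \<in> H" using u E assms(2)[OF E(1)] unfolding uniform_def by blast
    then show "\<exists>E'\<in>H. E' \<subseteq> insert y (E - {x})" by (intro bexI[of _ "insert y (E - {x})"] order.refl)
  qed
next
  assume X: ?X
  \<comment> \<open>An edge \<open>E\<close> through \<open>v\<close> is moved towards
    \<open>F\<close>: some \<open>y\<close> of \<open>F - E\<close> comes in for some
    \<open>x\<close> of \<open>E - F\<close>, and \<open>x\<close> is not \<open>v\<close> because
    \<open>v\<close> lies in both.\<close>
  have step: "F \<in> H" if "E \<in> H" "v \<in> E" "E \<subseteq> R" "card F = k" "v \<in> F" "F \<subseteq> R" for E F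
    using that
  proof (induction "card (F - E)" arbitrary: E)
    case 0
    have "finite F" using 0 assms(1) finite_subset by blast
    with 0 have "F \<subseteq> E" by simp
    moreover have "finite E" using 0 assms(1) finite_subset by blast
    ultimately have "F = E" using 0 assms(2) by (metis card_subset_eq)
    then show ?case using 0 by simp
  next
    case (Suc n)
    have fin: "finite E" "finite F" using Suc.prems assms(1) finite_subset by blast+
    obtain y where y: "y \<in> F - E" using Suc.hyps(2) by (metis card.empty ex_in_conv nat.distinct(1))
    have "\<not> E \<subseteq> F"
      using y fin Suc.prems assms(2) card_subset_eq by (metis DiffE)
    then obtain x where x: "x \<in> E - F" by blast
    have xy: "x \<in> E - {v}" "y \<in> R - (E - {x})" using x y Suc.prems by auto
    obtain E' where E': "E' \<in> H" "E' \<subseteq> insert y (E - {x})"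
      using X[rule_format, OF Suc.prems(1,2,3) xy] by blast
    have "card (insert y (E - {x})) = k"
      using xy x y fin assms(2)[OF Suc.prems(1)] assms(4) by (auto simp: card_insert_if)
    \<comment> \<open>An edge contained in a set of \<open>k\<close> elements equals it. The
      criterion can therefore ask for containment, which is checked by running through the edge
      list.\<close>
    then have eq: "E' = insert y (E - {x})"
      using E' assms(2)[OF E'(1)] fin by (metis card_subset_eq finite_Diff finite_insert)
    have "F - E' = F - E - {y}" using eq x by blast
    then have "n = card (F - E')" using Suc.hyps(2) y fin by simp
    moreover have "v \<in> E'" "E' \<subseteq> R" using eq Suc.prems x y by auto
    ultimately show ?case using Suc.hyps(1)[of E'] E' Suc.prems by blast
  qed
  \<comment> \<open>If no edge through \<open>v\<close> lies in \<open>R\<close>, then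
    \<open>v\<close> is isolating; a single such edge yields all of them by
    \<open>step\<close>.\<close>
  show "uniform k H R v"
    unfolding uniform_def using step by blast
qed

text \<open>\<open>c\<close> counts the places in already opened edges that remaining vertices still have to fill;
  \<open>S\<close> is the set of vertices filling them. From \<open>card R \<le> c\<close> on, nothing can fail any more.\<close>

definition fillable :: "'a set set \<Rightarrow> 'a set \<Rightarrow> nat \<Rightarrow> bool" where
  "fillable H R c \<longleftrightarrow> card R \<le> c \<or> (\<exists>S\<subseteq>R. card S = c \<and> has_perfect_matching (R - S) H)"

lemma has_perfect_matching_empty: "has_perfect_matching {} H"
  by (auto simp: has_perfect_matching_def intro!: exI[of _ "{}"])

lemma fillable_zero:
  assumes "finite R"
  shows "fillable H R 0 \<longleftrightarrow> has_perfect_matching R H"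
proof -
  have "S = {}" if "S \<subseteq> R" "card S = 0" for S
    using that assms by (metis card_0_eq finite_subset)
  moreover have "R = {}" if "card R = 0" using that assms by simp
  ultimately show ?thesis
    unfolding fillable_def using has_perfect_matching_empty by (metis Diff_empty card.empty empty_subsetI le_zero_eq)
qed

section \<open>Perfect matchings and open places\<close>

lemma perfect_matching_remove:
  assumes "M \<subseteq> H" "\<forall>E1\<in>M. \<forall>E2\<in>M. E1 \<noteq> E2 \<longrightarrow> E1 \<inter> E2 = {}" "\<Union>M = R" "E \<in> M"
  shows "has_perfect_matching (R - E) H"
  unfolding has_perfect_matching_def
  using assms by (intro exI[of _ "M - {E}"]) blast

lemma perfect_matching_insert:
  assumes "has_perfect_matching R H" "E \<in> H" "E \<inter> R = {}"
  shows "has_perfect_matching (R \<union> E) H"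
proof -
  obtain M where M: "M \<subseteq> H" "\<forall>E1\<in>M. \<forall>E2\<in>M. E1 \<noteq> E2 \<longrightarrow> E1 \<inter> E2 = {}" "\<Union>M = R"
    using assms(1) unfolding has_perfect_matching_def by (elim exE conjE)
  then show ?thesis
    unfolding has_perfect_matching_def using assms(2,3)
    by (intro exI[of _ "insert E M"]) blast
qed

lemma perfect_matching_card:
  assumes "finite R" "has_perfect_matching R H" "\<And>E. E \<in> H \<Longrightarrow> card E = k"
  shows "k dvd card R"
proof -
  obtain M where M: "M \<subseteq> H" "\<forall>E1\<in>M. \<forall>E2\<in>M. E1 \<noteq> E2 \<longrightarrow> E1 \<inter> E2 = {}" "\<Union>M = R"
    using assms(2) unfolding has_perfect_matching_def by (elim exE conjE)
  have "finite E" if "E \<in> M" for E using that M(3) assms(1) by (metis Sup_upper finite_subset)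
  then have "card (\<Union>M) = sum card M"
    using M(2) by (intro card_Union_disjoint) (auto simp: pairwise_def disjnt_def)
  also have "\<dots> = card M * k" using M(1) assms(3) by (simp add: subset_iff)
  finally show ?thesis using M(3) by simp
qed

text \<open>From left to right of \<open>c\<close>, the exchange is: some matching edge
  \<open>E\<close> is spent, and the members of \<open>S \<union> E\<close> other than
  \<open>v\<close> fill the \<open>c + k - 1\<close> places. Back again, any \<open>k - 1\<close>
  place fillers form an edge with \<open>v\<close>. If \<open>card R \<le> c\<close> already, both
  sides hold outright, and the cap \<open>N\<close> is only felt in that case.\<close>

lemma fillable_dominating:
  assumes fin: "finite R" and v: "v \<in> R" and k: "k \<ge> 1" "\<And>E. E \<in> H \<Longrightarrow> card E = k"
    and dom: "\<And>E. card E = k \<Longrightarrow> v \<in> E \<Longrightarrow> E \<subseteq> R \<Longrightarrow> E \<in> H"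
    and dvd: "c < card R \<Longrightarrow> k dvd card R - c"
    and N: "card R \<le> N"
  defines "c' \<equiv> min N (c + k - 1)"
  shows "fillable H (R - {v}) c' \<longleftrightarrow> fillable H R c"
    and "c' < card (R - {v}) \<Longrightarrow> k dvd card (R - {v}) - c'"
proof -
  have cR: "card (R - {v}) = card R - 1" "0 < card R" using fin v by (auto simp: card_gt_0_iff)
  have *: "(fillable H (R - {v}) c' \<longleftrightarrow> fillable H R c) \<and>
    (c' < card (R - {v}) \<longrightarrow> k dvd card (R - {v}) - c')"
  proof (cases "c < card R")
    case False
    then have "card (R - {v}) \<le> c'" "card R \<le> c" using cR N k(1) by (auto simp: c'_def)
    then show ?thesis by (auto simp: fillable_def)
  next
    case True
    \<comment> \<open>A positive multiple of \<open>k\<close> is at least \<open>k\<close>: besides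
      \<open>v\<close> there are enough vertices for all places after opening an edge, and the cap
      is not reached.\<close>
    have le: "c + k \<le> card R" using dvd_imp_le[OF dvd[OF True]] True by simp
    then have c': "c' = c + (k - 1)" using k(1) N by (auto simp: c'_def)
    have dv: "card (R - {v}) - c' = card R - c - k" using c' cR k(1) by simp
    have "fillable H (R - {v}) c' \<longleftrightarrow> fillable H R c"
    proof
      assume "fillable H R c"
      then obtain S where S: "S \<subseteq> R" "card S = c" "has_perfect_matching (R - S) H"
        using True by (auto simp: fillable_def)
      from S(3) obtain M where M: "M \<subseteq> H" "\<forall>E1\<in>M. \<forall>E2\<in>M. E1 \<noteq> E2 \<longrightarrow> E1 \<inter> E2 = {}" "\<Union>M = R - S"
        unfolding has_perfect_matching_def by (elim exE conjE)
      have "R \<noteq> S" using S(2) True by blast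
      then have "R - S \<noteq> {}" using S(1) by (simp add: subset_antisym)
      \<comment> \<open>If \<open>v\<close> fills a place, any edge of the matching may be
        dissolved; otherwise the edge covering \<open>v\<close> is the one to take.\<close>
      then have "\<exists>E\<in>M. v \<in> S \<union> E"
      proof (cases "v \<in> S")
        case True
        from \<open>R - S \<noteq> {}\<close> have "\<Union>M \<noteq> {}" unfolding M(3) .
        then show ?thesis using True by auto
      next
        case False
        then have "v \<in> \<Union>M" unfolding M(3) using v by simp
        then show ?thesis by auto
      qed
      then obtain E where E: "E \<in> M" "v \<in> S \<union> E" by blast
      let ?S = "(S \<union> E) - {v}"
      have ER: "E \<subseteq> R - S" using Union_upper[OF E(1)] unfolding M(3) .
      have finS: "finite S" "finite E" using S ER fin by (auto intro: finite_subset)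
      have "card (S \<union> E) = c + k"
        using ER S k(2)[of E] M(1) E(1) finS by (subst card_Un_disjoint) auto
      then have "card ?S = c'" using E(2) finS c' k(1) by simp
      moreover have "R - {v} - ?S = R - S - E" using E(2) by blast
      ultimately show "fillable H (R - {v}) c'"
        unfolding fillable_def using perfect_matching_remove[OF M E(1)] S(1) ER
        by (intro disjI2 exI[of _ ?S]) auto
    next
      assume f: "fillable H (R - {v}) c'"
      have "\<exists>S\<subseteq>R - {v}. card S = c' \<and> has_perfect_matching (R - {v} - S) H"
      proof (cases "card (R - {v}) \<le> c'")
        case True
        \<comment> \<open>With \<open>le\<close> this bound is an equality, so that all remaining
          vertices fill places and the empty matching covers the rest.\<close>
        then have "card (R - {v}) = c'" using le c' cR k(1) by linarith
        then show ?thesis by (intro exI[of _ "R - {v}"]) (auto simp: has_perfect_matching_empty)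
      next
        case False
        with f show ?thesis by (auto simp: fillable_def)
      qed
      then obtain S where S: "S \<subseteq> R - {v}" "card S = c'" "has_perfect_matching (R - {v} - S) H"
        by blast
      have finS: "finite S" using S fin finite_subset by blast
      obtain K where K: "K \<subseteq> S" "card K = k - 1"
        by (rule obtain_subset_with_card_n[of "k - 1" S]) (use S(2) c' in simp)
      have finK: "finite K" using K finS finite_subset by blast
      have "card (insert v K) = k" using K S finK k(1) by (subst card_insert_disjoint) auto
      then have "insert v K \<in> H" using dom K S v by blast
      then have "has_perfect_matching ((R - {v} - S) \<union> insert v K) H"
        using S K by (intro perfect_matching_insert) auto
      moreover have "(R - {v} - S) \<union> insert v K = R - (S - K)" using S K v by blast
      moreover have "card (S - K) = c" using K finK S c' by (simp add: card_Diff_subset)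
      ultimately show "fillable H R c"
        unfolding fillable_def using S(1) by (intro disjI2 exI[of _ "S - K"] conjI) auto
    qed
    moreover have "k dvd card (R - {v}) - c'"
      unfolding dv by (intro dvd_diff_nat dvd[OF True] dvd_refl)
    ultimately show ?thesis by blast
  qed
  from * show "fillable H (R - {v}) c' \<longleftrightarrow> fillable H R c" by blast
  from * show "c' < card (R - {v}) \<Longrightarrow> k dvd card (R - {v}) - c'" by blast
qed

text \<open>No edge inside \<open>R\<close> covers \<open>v\<close>, so \<open>v\<close> belongs to
  every admissible \<open>S\<close>. Without an open place this is impossible.\<close>

lemma fillable_isolating:
  assumes fin: "finite R" and v: "v \<in> R" and iso: "\<And>E. E \<in> H \<Longrightarrow> v \<in> E \<Longrightarrow> \<not> E \<subseteq> R"
  shows "\<not> fillable H R 0"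
    and "0 < c \<Longrightarrow> fillable H (R - {v}) (c - 1) \<longleftrightarrow> fillable H R c"
proof -
  have out: "v \<in> S" if has: "has_perfect_matching (R - S) H" for S
  proof (rule ccontr)
    assume "v \<notin> S"
    obtain M where M: "M \<subseteq> H" "\<Union>M = R - S" using has unfolding has_perfect_matching_def by (elim exE conjE)
    have "v \<in> \<Union>M" unfolding M(2) using v \<open>v \<notin> S\<close> by simp
    then obtain E where E: "E \<in> M" "v \<in> E" by auto
    moreover have "E \<subseteq> R" using Union_upper[OF E(1)] unfolding M(2) by auto
    ultimately show False using iso M(1) by blast
  qed
  show "\<not> fillable H R 0"
    using fillable_zero[OF fin] out[of "{}"] by auto
  assume c: "0 < c"
  have cR: "card (R - {v}) = card R - 1" "0 < card R" using fin v by (auto simp: card_gt_0_iff)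
  show "fillable H (R - {v}) (c - 1) \<longleftrightarrow> fillable H R c"
  proof
    assume "fillable H R c"
    then consider "card R \<le> c" | S where "S \<subseteq> R" "card S = c" "has_perfect_matching (R - S) H"
      unfolding fillable_def by blast
    then show "fillable H (R - {v}) (c - 1)"
    proof cases
      case 1
      with cR have "card (R - {v}) \<le> c - 1" by linarith
      then show ?thesis by (simp add: fillable_def)
    next
      case 2
      have "v \<in> S" using out[OF 2(3)] .
      then have "R - {v} - (S - {v}) = R - S" by blast
      moreover have "card (S - {v}) = c - 1" using 2(2) \<open>v \<in> S\<close> by (simp add: card_Diff_singleton)
      ultimately show ?thesis
        unfolding fillable_def using 2(1,3)
        by (intro disjI2 exI[of _ "S - {v}"] conjI) (simp_all add: Diff_mono)
    qed
  next
    assume "fillable H (R - {v}) (c - 1)"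
    then consider "card (R - {v}) \<le> c - 1"
      | S where "S \<subseteq> R - {v}" "card S = c - 1" "has_perfect_matching (R - {v} - S) H"
      unfolding fillable_def by blast
    then show "fillable H R c"
    proof cases
      case 1
      with cR c have "card R \<le> c" by linarith
      then show ?thesis by (simp add: fillable_def)
    next
      case 2
      have "finite S" using 2 fin by (meson finite_Diff finite_subset)
      then have "card (insert v S) = c" using 2 c by (subst card_insert_disjoint) auto
      moreover have "R - insert v S = R - {v} - S" by blast
      ultimately show ?thesis
        unfolding fillable_def using 2(1,3) v
        by (intro disjI2 exI[of _ "insert v S"] conjI) auto
    qed
  qed
qed

section \<open>Basic programs\<close>

text \<open>The invariant depends on the set \<open>D\<close> of positions treated so far and not on
  their order. The loop marks are under control of the loop itself: \<open>T\<close> is an arbitrary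
  set of waiting positions, and \<open>J\<close> is claimed after both marks have been
  reset.\<close>

lemma forl_invariant:
  assumes pres: "preserves t F" and tp: "t \<noteq> p" and "finite (\<sigma> t)"
    and init: "I {} \<sigma>"
    and step: "\<And>D i \<tau> T. D \<subseteq> \<sigma> t \<Longrightarrow> i \<in> \<sigma> t - D \<Longrightarrow> I D \<tau> \<Longrightarrow> T \<subseteq> \<sigma> t \<Longrightarrow>
      I (insert i D) (F w (\<tau>(t := T, p := {i})))"
    and final: "\<And>\<tau>. I (\<sigma> t) \<tau> \<Longrightarrow> J (\<tau>(t := {}, p := {}))"
  shows "J (forl t p F w \<sigma>)"
proof -
  have "J (forl t p F w \<tau>)" if "\<tau> t \<subseteq> \<sigma> t" "I (\<sigma> t - \<tau> t) \<tau>" for \<tau>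
    using that
  proof (induction "card (\<tau> t)" arbitrary: \<tau>)
    case 0
    then have "\<tau> t = {}" using assms(3) finite_subset by fastforce
    moreover from this have "J (\<tau>(t := {}, p := {}))" using 0 by (intro final) simp
    ultimately show ?case by (simp only: forl_empty)
  next
    case (Suc n)
    have fin: "finite (\<tau> t)" and ne: "\<tau> t \<noteq> {}"
      using Suc.prems(1) Suc.hyps(2) assms(3) finite_subset by fastforce+
    let ?i = "Min (\<tau> t)"
    let ?\<tau> = "F w (\<tau>(t := \<tau> t - {?i}, p := {?i}))"
    have i: "?i \<in> \<tau> t" using fin ne by simp
    have t: "?\<tau> t = \<tau> t - {?i}" using pres tp by (simp add: preserves_def)
    have "I (insert ?i (\<sigma> t - \<tau> t)) ?\<tau>"
      using i Suc.prems by (intro step) auto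
    moreover have "insert ?i (\<sigma> t - \<tau> t) = \<sigma> t - ?\<tau> t" using i t Suc.prems(1) by auto
    moreover have "n = card (?\<tau> t)" using t i fin Suc.hyps(2) by simp
    moreover have "?\<tau> t \<subseteq> \<sigma> t" using t Suc.prems(1) by auto
    ultimately have "J (forl t p F w ?\<tau>)" by (intro Suc.hyps(1)) auto
    then show ?case by (simp only: forl_nonempty[where \<sigma> = \<tau>, OF pres tp fin ne])
  qed
  from this[of \<sigma>] init show ?thesis by simp
qed

section \<open>Marks left unchanged, and assignments made by one sweep\<close>

lemma preserves_skip: "preserves m skip"
  by (simp add: preserves_def skip_def)

lemma preserves_seq: "preserves m F \<Longrightarrow> preserves m G \<Longrightarrow> preserves m (F ;; G)"
  by (simp add: preserves_def seq_def)

lemma preserves_cond: "preserves m F \<Longrightarrow> preserves m G \<Longrightarrow> preserves m (cond b F G)"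
  by (simp add: preserves_def cond_def)

lemma preserves_assign: "m \<noteq> x \<Longrightarrow> preserves m (assign x nx out)"
  by (simp add: preserves_def assign_def)

lemma preserves_forl:
  assumes "m \<noteq> t" "m \<noteq> p" "preserves m F"
  shows "preserves m (forl t p F)"
proof -
  have "fold (\<lambda>i \<sigma>. F w (\<sigma>(t := \<sigma> t - {i}, p := {i}))) xs \<sigma> m = \<sigma> m" for xs w \<sigma>
    using assms by (induction xs arbitrary: \<sigma>) (auto simp: preserves_def)
  with assms show ?thesis by (simp add: preserves_def forl_def)
qed

definition assign_local where
  "assign_local x P = assign x (\<lambda>_ _ _. 0) (\<lambda>_. P)"

lemma assign_local_apply: "assign_local x P w \<sigma> = \<sigma>(x := {i. i < length w \<and> P (w ! i) (\<lambda>m. i \<in> \<sigma> m)})"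
  by (simp add: assign_local_def assign_def)

lemma computable_local: "computable (assign_local x P)"
  unfolding assign_local_def by (rule computable_assign[where B = 1]) auto

lemma preserves_local: "m \<noteq> x \<Longrightarrow> preserves m (assign_local x P)"
  unfolding assign_local_def by (rule preserves_assign)

definition occurs where
  "occurs P w \<sigma> \<longleftrightarrow> (\<exists>i < length w. P (w ! i) (\<lambda>m. i \<in> \<sigma> m))"

lemma testable_occurs: "testable (occurs P)"
proof -
  let ?nx = "\<lambda>q a M. if q = (1::nat) \<or> P a M then 1 else 0"
  have "scan_state ?nx w \<sigma> n = (if \<exists>i<n. P (w ! i) (\<lambda>m. i \<in> \<sigma> m) then 1 else 0)" for w \<sigma> n
    by (induction n) (auto simp: less_Suc_eq)
  then have "occurs P = (\<lambda>w \<sigma>. scan_state ?nx w \<sigma> (length w) = 1)"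
    by (auto simp: occurs_def fun_eq_iff)
  moreover have "testable (\<lambda>w \<sigma>. scan_state ?nx w \<sigma> (length w) = 1)"
    by (rule testable_scan[where B = 2]) auto
  ultimately show ?thesis by simp
qed

text \<open>A mark on the last cell falls off the word. A pointer that stands on a digit never does
  so, because a terminator follows.\<close>

definition shift where
  "shift x = assign x (\<lambda>_ _ M. if M x then 1 else 0) (\<lambda>q _ _. q = 1)"

lemma shift_apply: "shift x w \<sigma> = \<sigma>(x := {i. i < length w \<and> 0 < i \<and> i - 1 \<in> \<sigma> x})"
proof -
  have "scan_state (\<lambda>_ _ M. if M x then 1 else 0) w \<sigma> i = (if 0 < i \<and> i - 1 \<in> \<sigma> x then 1 else 0)" for i
    by (cases i) auto
  then show ?thesis by (auto simp: shift_def assign_def fun_eq_iff)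
qed

definition mark_occs where
  "mark_occs x = assign x (\<lambda>_ a _. if a = 3 \<or> a = 4 then 0 else 1) (\<lambda>q a _. q = 0 \<and> a \<noteq> 4)"

lemma mark_occs_apply: "mark_occs x w \<sigma> = \<sigma>(x := {i. occ w i})"
proof -
  have "scan_state (\<lambda>_ a _. if a = 3 \<or> a = 4 then 0 else 1) w \<sigma> i =
    (if i = 0 \<or> w ! (i - 1) = 3 \<or> w ! (i - 1) = 4 then 0 else 1)" for i
    by (cases i) auto
  then show ?thesis by (auto simp: mark_occs_def assign_def occ_def fun_eq_iff)
qed

definition mark_vertices where
  "mark_vertices x y = assign x (\<lambda>q a _. if q = 1 \<or> a = 4 then 1 else 0) (\<lambda>q a M. q = 0 \<and> M y)"

lemma mark_vertices_apply:
  assumes "\<sigma> y = {i. occ w i}"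
  shows "mark_vertices x y w \<sigma> = \<sigma>(x := vertex_occs w)"
proof -
  have "scan_state (\<lambda>q a _. if q = 1 \<or> a = 4 then 1 else 0) w \<sigma> i =
    (if \<exists>j<i. w ! j = 4 then 1 else 0)" for i
    by (induction i) (auto simp: less_Suc_eq)
  with assms show ?thesis
    by (auto simp: mark_vertices_def assign_def vertex_occs_def fun_eq_iff occ_def)
qed

text \<open>State \<open>1\<close> means that the last \<open>4\<close> passed carries
  \<open>z\<close>.\<close>

definition mark_edge where
  "mark_edge x y z = assign x (\<lambda>q a M. if a = 4 then if M z then 1 else 0 else q) (\<lambda>q a M. q = 1 \<and> M y)"

lemma mark_edge_apply:
  assumes "\<sigma> y = {i. occ w i}" "\<sigma> z = {e}" "e < length w" "w ! e = 4"
  shows "mark_edge x y z w \<sigma> = \<sigma>(x := edge_occs w e)"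
proof -
  have "scan_state (\<lambda>q a M. if a = 4 then if M z then 1 else 0 else q) w \<sigma> i =
    (if e < i \<and> (\<forall>j. e < j \<and> j < i \<longrightarrow> w ! j \<noteq> 4) then 1 else 0)" for i
    using assms by (induction i) (auto simp: less_Suc_eq)
  with assms(1) show ?thesis
    by (auto simp: mark_edge_def assign_def edge_occs_def fun_eq_iff occ_def)
qed

text \<open>A counter is the number of positions carrying a mark, wherever they are. Adding fills
  the first free position and thus saturates on a full word; subtracting erases the first
  mark.\<close>

definition add_one where
  "add_one x = assign x (\<lambda>q _ M. if M x then q else 1) (\<lambda>q _ M. M x \<or> q = 0)"

lemma add_one_apply:
  assumes "\<sigma> x \<subseteq> {..<length w}"
  obtains X where "add_one x w \<sigma> = \<sigma>(x := X)" "X \<subseteq> {..<length w}"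
    "card X = min (length w) (Suc (card (\<sigma> x)))"
proof -
  let ?X = "{i. i < length w \<and> (i \<in> \<sigma> x \<or> (\<forall>j<i. j \<in> \<sigma> x))}"
  have "scan_state (\<lambda>q _ M. if M x then q else 1) w \<sigma> i = (if \<forall>j<i. j \<in> \<sigma> x then 0 else 1)" for i
    by (induction i) (auto simp: less_Suc_eq)
  then have 1: "add_one x w \<sigma> = \<sigma>(x := ?X)"
    by (auto simp: add_one_def assign_def fun_eq_iff)
  have fin: "finite (\<sigma> x)" using assms finite_subset by blast
  have 2: "card ?X = min (length w) (Suc (card (\<sigma> x)))"
  proof (cases "\<sigma> x = {..<length w}")
    case True
    then have "?X = {..<length w}" by auto
    with True show ?thesis by simp
  next
    case False
    obtain j where j: "j < length w" "j \<notin> \<sigma> x" using False assms by auto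
    then obtain m where m: "m \<notin> \<sigma> x" "m < length w" "\<And>i. i < m \<Longrightarrow> i \<in> \<sigma> x"
      using exists_least_iff[of "\<lambda>i. i \<notin> \<sigma> x"] by (metis less_trans linorder_neqE_nat)
    have "i = m" if "i \<in> ?X" "i \<notin> \<sigma> x" for i
      using that m by (metis (mono_tags, lifting) linorder_neqE_nat mem_Collect_eq)
    moreover have "m \<in> ?X" using m by blast
    moreover have "\<sigma> x \<subseteq> ?X" using assms by blast
    ultimately have "?X = insert m (\<sigma> x)" by blast
    then have "card ?X = Suc (card (\<sigma> x))" using m fin by simp
    moreover have "card (\<sigma> x) < length w"
      using psubset_card_mono[of "{..<length w}" "\<sigma> x"] False assms by auto
    ultimately show ?thesis by simp
  qed
  show thesis by (rule that[OF 1 _ 2]) auto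
qed

definition remove_one where
  "remove_one x = assign x (\<lambda>q _ M. if M x then 1 else q) (\<lambda>q _ M. M x \<and> q = 1)"

lemma remove_one_apply:
  assumes "\<sigma> x \<subseteq> {..<length w}"
  obtains X where "remove_one x w \<sigma> = \<sigma>(x := X)" "X \<subseteq> {..<length w}"
    "card X = card (\<sigma> x) - 1"
proof -
  let ?X = "{i. i \<in> \<sigma> x \<and> (\<exists>j<i. j \<in> \<sigma> x)}"
  have "scan_state (\<lambda>q _ M. if M x then 1 else q) w \<sigma> i = (if \<exists>j<i. j \<in> \<sigma> x then 1 else 0)" for i
    by (induction i) (auto simp: less_Suc_eq)
  then have 1: "remove_one x w \<sigma> = \<sigma>(x := ?X)"
    using assms by (auto simp: remove_one_def assign_def fun_eq_iff)
  have fin: "finite (\<sigma> x)" using assms finite_subset by blast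
  have 2: "card ?X = card (\<sigma> x) - 1"
  proof (cases "\<sigma> x = {}")
    case False
    let ?m = "Min (\<sigma> x)"
    have m: "?m \<in> \<sigma> x" "\<And>i. i \<in> \<sigma> x \<Longrightarrow> ?m \<le> i" using fin False by auto
    have "?X = \<sigma> x - {?m}"
      using m by (auto simp: order_le_less) fastforce
    then show ?thesis using m(1) by (simp add: card_Diff_singleton)
  qed auto
  show thesis by (rule that[OF 1 _ 2]) (use assms in auto)
qed

definition count_dvd where
  "count_dvd k x w \<sigma> \<longleftrightarrow> k dvd card (\<sigma> x \<inter> {..<length w})"

text \<open>The control state holds the count modulo \<open>k\<close>, which is a finite amount of
  information because \<open>k\<close> is fixed.\<close>

lemma testable_count_dvd: assumes "k \<ge> 1" shows "testable (count_dvd k x)"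
proof -
  let ?nx = "\<lambda>q _ M. if M x then (q + 1) mod k else (q::nat)"
  have "scan_state ?nx w \<sigma> n = card (\<sigma> x \<inter> {..<n}) mod k" for w \<sigma> n
    by (induction n) (auto simp: lessThan_Suc mod_Suc_eq)
  then have "count_dvd k x = (\<lambda>w \<sigma>. scan_state ?nx w \<sigma> (length w) = 0)"
    by (auto simp: count_dvd_def fun_eq_iff dvd_eq_mod_eq_0)
  moreover have "testable (\<lambda>w \<sigma>. scan_state ?nx w \<sigma> (length w) = 0)"
    using assms by (intro testable_scan[where B = k]) auto
  ultimately show ?thesis by simp
qed

text \<open>Loops are nested, so each has its own pair of marks for waiting and current positions. A
  mark ending in \<open>Eq\<close> receives all occurrences of the number at the current
  position.\<close>

datatype mark = Occs | Verts | Rest | Cnt | Fail | Accept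
  | CmpTodo | CmpCur | PtrA | PtrB | BitTodo | BitCur
  | EdgeTodo | EdgeCur | EdgeEls | SpanTodo | SpanCur | SpanEq | Span
  | OutTodo | OutCur | OutEq | InTodo | InCur | InEq | Target
  | ProbeTodo | ProbeCur | ProbeEls | Found
  | VertTodo | VertCur | VertEq | RoundTodo | RoundCur | Bad | Dom

instance mark :: finite
proof
  have "(UNIV :: mark set) \<subseteq> {Occs, Verts, Rest, Cnt, Fail, Accept, CmpTodo, CmpCur, PtrA, PtrB, BitTodo, BitCur,
    EdgeTodo, EdgeCur, EdgeEls, SpanTodo, SpanCur, SpanEq, Span, OutTodo, OutCur, OutEq,
    InTodo, InCur, InEq, Target, ProbeTodo, ProbeCur, ProbeEls, Found,
    VertTodo, VertCur, VertEq, RoundTodo, RoundCur, Bad, Dom}" (is "_ \<subseteq> ?S")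
  proof
    fix x :: mark show "x \<in> ?S" by (cases x) simp_all
  qed
  then show "finite (UNIV :: mark set)" by (rule finite_subset) simp
qed

section \<open>Testing a vertex\<close>

lemmas preserves_intros = preserves_skip preserves_seq preserves_cond preserves_local preserves_forl

lemma computable_shift: "computable (shift x)"
  unfolding shift_def by (rule computable_assign[where B = 2]) auto

lemma preserves_shift: "m \<noteq> x \<Longrightarrow> preserves m (shift x)"
  unfolding shift_def by (rule preserves_assign)

lemma computable_mark_edge: "computable (mark_edge x y z)"
  unfolding mark_edge_def by (rule computable_assign[where B = 2]) auto

lemma preserves_mark_edge: "m \<noteq> x \<Longrightarrow> preserves m (mark_edge x y z)"
  unfolding mark_edge_def by (rule preserves_assign)

lemmas computable_intros = computable_skip computable_seq computable_cond computable_local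
  computable_forl computable_shift computable_mark_edge testable_and testable_or testable_not testable_occurs

text \<open>The loop positions serve as fuel: there are more of them than digits in any block. Both
  pointers move while they see the same digit, and finally rest at a difference or at
  terminators.\<close>

definition advance_pointers :: "mark prog" where
  "advance_pointers = forl BitTodo BitCur (cond
     (\<lambda>w \<sigma>. (occurs (\<lambda>a M. a = 1 \<and> M PtrA) w \<sigma> \<and> occurs (\<lambda>a M. a = 1 \<and> M PtrB) w \<sigma>) \<or>
       (occurs (\<lambda>a M. a = 2 \<and> M PtrA) w \<sigma> \<and> occurs (\<lambda>a M. a = 2 \<and> M PtrB) w \<sigma>))
     (shift PtrA ;; shift PtrB) skip)"

definition compare :: "mark \<Rightarrow> mark \<Rightarrow> mark prog" where
  "compare a b =
     assign_local b (\<lambda>_ _. False) ;;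
     assign_local CmpTodo (\<lambda>_ M. M Occs) ;;
     forl CmpTodo CmpCur (
       assign_local PtrA (\<lambda>_ M. M a) ;;
       assign_local PtrB (\<lambda>_ M. M CmpCur) ;;
       assign_local BitTodo (\<lambda>_ _. True) ;;
       advance_pointers ;;
       cond (\<lambda>w \<sigma>. occurs (\<lambda>a M. a = 3 \<and> M PtrA) w \<sigma> \<and> occurs (\<lambda>a M. a = 3 \<and> M PtrB) w \<sigma>)
         (assign_local b (\<lambda>_ M. M b \<or> M CmpCur)) skip)"

abbreviation "cmp_marks \<equiv> {CmpTodo, CmpCur, PtrA, PtrB, BitTodo, BitCur}"

lemma preserves_advance_pointers: "m \<notin> {PtrA, PtrB, BitTodo, BitCur} \<Longrightarrow> preserves m advance_pointers"
  unfolding advance_pointers_def by (intro preserves_intros preserves_shift) auto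

lemma computable_advance_pointers: "computable advance_pointers"
  unfolding advance_pointers_def by (intro computable_intros preserves_intros preserves_shift) auto

lemma preserves_compare: "m \<notin> cmp_marks \<Longrightarrow> m \<noteq> b \<Longrightarrow> preserves m (compare a b)"
  unfolding compare_def by (intro preserves_intros preserves_advance_pointers) auto

lemma computable_compare: "b \<noteq> CmpTodo \<Longrightarrow> computable (compare a b)"
  unfolding compare_def
  by (intro computable_intros computable_advance_pointers preserves_intros preserves_advance_pointers) auto

text \<open>\<open>EdgeEls\<close> marks the elements of an edge only where that edge lists them.
  \<open>Span\<close> marks all their occurrences in the word, so that it can be compared with other
  edges and with \<open>Rest\<close>.\<close>

definition span :: "mark prog" where
  "span =
     assign_local Span (\<lambda>_ _. False) ;;
     assign_local SpanTodo (\<lambda>_ M. M EdgeEls) ;;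
     forl SpanTodo SpanCur (compare SpanCur SpanEq ;; assign_local Span (\<lambda>_ M. M Span \<or> M SpanEq))"

text \<open>Asking for at least one element excludes the final \<open>4\<close>, which would
  otherwise pass as an empty edge inside every target.\<close>

definition probe :: "mark prog" where
  "probe =
     assign_local Found (\<lambda>_ _. False) ;;
     assign_local ProbeTodo (\<lambda>a _. a = 4) ;;
     forl ProbeTodo ProbeCur (
       mark_edge ProbeEls Occs ProbeCur ;;
       cond (\<lambda>w \<sigma>. occurs (\<lambda>_ M. M ProbeEls) w \<sigma> \<and> \<not> occurs (\<lambda>_ M. M ProbeEls \<and> \<not> M Target) w \<sigma>)
         (assign_local Found (\<lambda>_ _. True)) skip)"

definition exchange_in :: "mark prog" where
  "exchange_in =
     assign_local InTodo (\<lambda>_ M. M Verts \<and> M Rest \<and> \<not> (M Span \<and> \<not> M OutEq)) ;;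
     forl InTodo InCur (
       compare InCur InEq ;;
       assign_local Target (\<lambda>_ M. (M Span \<and> \<not> M OutEq) \<or> M InEq) ;;
       probe ;;
       cond (occurs (\<lambda>_ M. M Found)) skip (assign_local Bad (\<lambda>_ _. True)))"

definition exchange_out :: "mark prog" where
  "exchange_out =
     assign_local OutTodo (\<lambda>_ M. M EdgeEls \<and> \<not> M VertEq) ;;
     forl OutTodo OutCur (compare OutCur OutEq ;; exchange_in)"

text \<open>The mark \<open>Bad\<close> becomes nonempty iff some exchange refutes that the vertex is uniform in \<open>Rest\<close>.\<close>

definition check_vertex :: "mark prog" where
  "check_vertex =
     compare VertCur VertEq ;;
     assign_local Bad (\<lambda>_ _. False) ;;
     assign_local Dom (\<lambda>_ _. False) ;;
     assign_local EdgeTodo (\<lambda>a _. a = 4) ;;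
     forl EdgeTodo EdgeCur (
       mark_edge EdgeEls Occs EdgeCur ;;
       cond (\<lambda>w \<sigma>. occurs (\<lambda>_ M. M EdgeEls \<and> M VertEq) w \<sigma> \<and> \<not> occurs (\<lambda>_ M. M EdgeEls \<and> \<not> M Rest) w \<sigma>)
         (assign_local Dom (\<lambda>_ _. True) ;; span ;; exchange_out) skip)"

section \<open>Frames and computability of the vertex test\<close>

abbreviation "span_marks \<equiv> cmp_marks \<union> {SpanTodo, SpanCur, SpanEq, Span}"
abbreviation "probe_marks \<equiv> {ProbeTodo, ProbeCur, ProbeEls, Found}"
abbreviation "in_marks \<equiv> cmp_marks \<union> probe_marks \<union> {InTodo, InCur, InEq, Target, Bad}"
abbreviation "out_marks \<equiv> in_marks \<union> {OutTodo, OutCur, OutEq}"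
abbreviation "check_marks \<equiv> out_marks \<union> span_marks \<union> {EdgeTodo, EdgeCur, EdgeEls, VertEq, Dom}"

lemma preserves_span: "m \<notin> span_marks \<Longrightarrow> preserves m span"
  unfolding span_def by (intro preserves_intros preserves_compare) auto

lemma computable_span: "computable span"
  unfolding span_def by (intro computable_intros computable_compare preserves_intros preserves_compare) auto

lemma preserves_probe: "m \<notin> probe_marks \<Longrightarrow> preserves m probe"
  unfolding probe_def by (intro preserves_intros preserves_mark_edge) auto

lemma computable_probe: "computable probe"
  unfolding probe_def by (intro computable_intros preserves_intros preserves_mark_edge) auto

lemma preserves_exchange_in: "m \<notin> in_marks \<Longrightarrow> preserves m exchange_in"
  unfolding exchange_in_def by (intro preserves_intros preserves_compare preserves_probe) auto

lemma computable_exchange_in: "computable exchange_in"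
  unfolding exchange_in_def
  by (intro computable_intros computable_compare computable_probe preserves_intros
      preserves_compare preserves_probe) auto

lemma preserves_exchange_out: "m \<notin> out_marks \<Longrightarrow> preserves m exchange_out"
  unfolding exchange_out_def by (intro preserves_intros preserves_compare preserves_exchange_in) auto

lemma computable_exchange_out: "computable exchange_out"
  unfolding exchange_out_def
  by (intro computable_intros computable_compare computable_exchange_in preserves_intros
      preserves_compare preserves_exchange_in) auto

lemma preserves_check_vertex: "m \<notin> check_marks \<Longrightarrow> preserves m check_vertex"
  unfolding check_vertex_def
  by (intro preserves_intros preserves_compare preserves_exchange_out preserves_span preserves_mark_edge) auto

lemma computable_check_vertex: "computable check_vertex"
  unfolding check_vertex_def
  by (intro computable_intros computable_compare computable_exchange_out computable_span preserves_intros
      preserves_compare preserves_exchange_out preserves_span preserves_mark_edge) auto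

section \<open>Correctness of the vertex test on an encoded hypergraph\<close>

locale hypergraph_word =
  fixes w :: "nat list" and k :: nat and V :: "nat set" and H :: "nat set set"
  assumes numbers: "\<And>i. occ w i \<Longrightarrow> starts_number w i"
    and verts: "val w ` vertex_occs w = V" "inj_on (val w) (vertex_occs w)"
    and edges: "{val w ` edge_occs w e | e. e < length w \<and> w ! e = 4 \<and> edge_occs w e \<noteq> {}} = H"
    and short: "card (vertex_occs w) < length w"
    and hyp: "k_hypergraph k V H" and k: "k \<ge> 1"
begin

text \<open>A set of vertices is represented on the tape by all occurrences of its numbers. Set
  operations then act position by position.\<close>

definition occs_of :: "nat set \<Rightarrow> nat set" where
  "occs_of A = {i. occ w i \<and> val w i \<in> A}"

lemma occ_less: "occ w i \<Longrightarrow> i < length w"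
  by (simp add: occ_def)

lemma edge_occs_occ: "i \<in> edge_occs w e \<Longrightarrow> occ w i"
  by (simp add: edge_occs_def)

lemma vertex_occs_occ: "i \<in> vertex_occs w \<Longrightarrow> occ w i"
  by (simp add: vertex_occs_def)

lemma advance_pointers_apply:
  assumes "\<sigma> PtrA = {p}" "\<sigma> PtrB = {q}" "\<sigma> BitTodo = {..<length w}" "occ w p" "occ w q"
  shows "(occurs (\<lambda>a M. a = 3 \<and> M PtrA) w (advance_pointers w \<sigma>) \<and> occurs (\<lambda>a M. a = 3 \<and> M PtrB) w (advance_pointers w \<sigma>))
    \<longleftrightarrow> val w p = val w q" (is "?eq (advance_pointers w \<sigma>)")
    and "m \<notin> {PtrA, PtrB, BitTodo, BitCur} \<Longrightarrow> advance_pointers w \<sigma> m = \<sigma> m"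
proof -
  show "m \<notin> {PtrA, PtrB, BitTodo, BitCur} \<Longrightarrow> advance_pointers w \<sigma> m = \<sigma> m"
    using preserves_advance_pointers by (simp add: preserves_def)
  let ?p = "block w p" and ?q = "block w q"
  note bp = starts_number_block[OF numbers[OF assms(4)]]
  note bq = starts_number_block[OF numbers[OF assms(5)]]
  let ?same = "\<lambda>j. j < length ?p \<and> j < length ?q \<and> ?p ! j = ?q ! j"
  have sym: "(\<exists>i<length w. w ! i = a \<and> i \<in> X) \<longleftrightarrow> w ! i = a" if "X = {i}" "i < length w" for X i a
    using that by auto
  \<comment> \<open>\<open>j\<close> is the common progress of the pointers; it keeps up with the
    number of iterations until the pointers get stuck.\<close>
  define I where "I D \<tau> \<longleftrightarrow> (\<exists>j \<le> length ?p. j \<le> length ?q \<and> take j ?p = take j ?q \<and>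
      \<tau> PtrA = {p + j} \<and> \<tau> PtrB = {q + j} \<and> (j = card D \<or> \<not> ?same j))" for D :: "nat set" and \<tau> :: "mark state"
  have sp: "w ! (p + j) = (if j < length ?p then ?p ! j else 3)" "p + j < length w" if "j \<le> length ?p" for j
    using that bp by (auto simp: order_le_less)
  have sq: "w ! (q + j) = (if j < length ?q then ?q ! j else 3)" "q + j < length w" if "j \<le> length ?q" for j
    using that bq by (auto simp: order_le_less)
  have set_p: "?p ! j = 1 \<or> ?p ! j = 2" if "j < length ?p" for j using bp(4) nth_mem[OF that] by blast
  have set_q: "?q ! j = 1 \<or> ?q ! j = 2" if "j < length ?q" for j using bq(4) nth_mem[OF that] by blast
  let ?t = "\<lambda>w \<tau>. (occurs (\<lambda>a M. a = 1 \<and> M PtrA) w \<tau> \<and> occurs (\<lambda>a M. a = 1 \<and> M PtrB) w \<tau>) \<or>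
       (occurs (\<lambda>a M. a = 2 \<and> M PtrA) w \<tau> \<and> occurs (\<lambda>a M. a = 2 \<and> M PtrB) w \<tau>)"
  have test: "?t w \<tau> \<longleftrightarrow> ?same j"
    if "j \<le> length ?p" "j \<le> length ?q" "\<tau> PtrA = {p + j}" "\<tau> PtrB = {q + j}" for \<tau> j
    unfolding occurs_def sym[OF that(3) sp(2)[OF that(1)]] sym[OF that(4) sq(2)[OF that(2)]]
    using sp(1)[OF that(1)] sq(1)[OF that(2)] set_p[of j] set_q[of j] by (auto split: if_splits)
  show "?eq (advance_pointers w \<sigma>)"
    unfolding advance_pointers_def
  proof (rule forl_invariant[where I = I])
    show "I {} \<sigma>" unfolding I_def using assms by (intro exI[of _ 0]) auto
  next
    fix D i \<tau> T assume D: "D \<subseteq> \<sigma> BitTodo" "i \<in> \<sigma> BitTodo - D" "I D \<tau>"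
    let ?\<tau> = "\<tau>(BitTodo := T, BitCur := {i})"
    obtain j where j: "j \<le> length ?p" "j \<le> length ?q" "take j ?p = take j ?q" "\<tau> PtrA = {p + j}"
      "\<tau> PtrB = {q + j}" "j = card D \<or> \<not> ?same j" using D(3) unfolding I_def by blast
    have "finite D" using D(1) assms(3) finite_subset by auto
    then have card: "card (insert i D) = Suc (card D)" using D(2) by simp
    have t: "?t w ?\<tau> \<longleftrightarrow> ?same j" using j by (intro test) auto
    show "I (insert i D) (cond ?t (shift PtrA ;; shift PtrB) skip w ?\<tau>)"
    proof (cases "?same j")
      case True
      have "Suc (p + j) < length w" "Suc (q + j) < length w"
        using sp(2)[of "Suc j"] sq(2)[of "Suc j"] True by auto
      then show ?thesis
        using True t j card unfolding I_def
        by (intro exI[of _ "Suc j"])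
           (auto simp: cond_def seq_def shift_apply take_Suc_conv_app_nth)
    next
      case False
      then show ?thesis
        using t j unfolding I_def by (intro exI[of _ j]) (auto simp: cond_def skip_def)
    qed
  next
    fix \<tau> assume "I (\<sigma> BitTodo) \<tau>"
    then obtain j where j: "j \<le> length ?p" "j \<le> length ?q" "take j ?p = take j ?q" "\<tau> PtrA = {p + j}"
      "\<tau> PtrB = {q + j}" "j = length w \<or> \<not> ?same j" unfolding I_def assms(3) by auto
    \<comment> \<open>A block is shorter than the word, so not all iterations can have advanced the
      pointers.\<close>
    then have ns: "\<not> ?same j" using bp(1) by auto
    let ?\<tau> = "\<tau>(BitTodo := {}, BitCur := {})"
    have AB: "?\<tau> PtrA = {p + j}" "?\<tau> PtrB = {q + j}" using j by auto
    have "occurs (\<lambda>a M. a = 3 \<and> M PtrA) w ?\<tau> \<longleftrightarrow> j = length ?p"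
      unfolding occurs_def sym[OF AB(1) sp(2)[OF j(1)]] using sp(1)[OF j(1)] j(1) set_p[of j] by auto
    moreover have "occurs (\<lambda>a M. a = 3 \<and> M PtrB) w ?\<tau> \<longleftrightarrow> j = length ?q"
      unfolding occurs_def sym[OF AB(2) sq(2)[OF j(2)]] using sq(1)[OF j(2)] j(2) set_q[of j] by auto
    moreover have "?p = ?q \<longleftrightarrow> j = length ?p \<and> j = length ?q"
    proof
      assume eq: "?p = ?q"
      then have "\<not> j < length ?p" using ns by simp
      with j(1) eq show "j = length ?p \<and> j = length ?q" by simp
    next
      assume "j = length ?p \<and> j = length ?q"
      with j(3) show "?p = ?q" by simp
    qed
    ultimately show "?eq ?\<tau>"
      using val_eq_iff[OF numbers[OF assms(4)] numbers[OF assms(5)]] by blast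
  next
    show "preserves BitTodo (cond ?t (shift PtrA ;; shift PtrB) skip)"
      by (intro preserves_intros preserves_shift) auto
    show "finite (\<sigma> BitTodo)" using assms by simp
  qed simp
qed

lemma compare_apply:
  assumes "\<sigma> a = {p}" "occ w p" "\<sigma> Occs = {i. occ w i}" "a \<notin> cmp_marks" "b \<notin> cmp_marks" "a \<noteq> b" "b \<noteq> Occs"
    and "m \<notin> cmp_marks"
  shows "compare a b w \<sigma> m = (if m = b then occs_of {val w p} else \<sigma> m)"
proof (cases "m = b")
  case False
  then show ?thesis using preserves_compare[of m b a] assms(8) by (simp add: preserves_def)
next
  case True
  let ?\<sigma> = "\<sigma>(b := {}, CmpTodo := {i. occ w i})"
  let ?F = "assign_local PtrA (\<lambda>_ M. M a) ;; assign_local PtrB (\<lambda>_ M. M CmpCur) ;; assign_local BitTodo (\<lambda>_ _. True) ;;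
       advance_pointers ;;
       cond (\<lambda>w \<sigma>. occurs (\<lambda>a M. a = 3 \<and> M PtrA) w \<sigma> \<and> occurs (\<lambda>a M. a = 3 \<and> M PtrB) w \<sigma>)
         (assign_local b (\<lambda>_ M. M b \<or> M CmpCur)) skip"
  have S: "?\<sigma> CmpTodo = {i. occ w i}" by simp
  have "forl CmpTodo CmpCur ?F w ?\<sigma> b = occs_of {val w p}"
  proof (rule forl_invariant[where
      I = "\<lambda>D \<tau>. \<tau> a = {p} \<and> \<tau> b = {i \<in> D. val w i = val w p}"], unfold S)
    fix D i \<tau> T
    assume D: "D \<subseteq> {i. occ w i}" "i \<in> {i. occ w i} - D" "\<tau> a = {p} \<and> \<tau> b = {i \<in> D. val w i = val w p}"
    let ?\<tau> = "\<tau>(CmpTodo := T, CmpCur := {i})"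
    let ?\<rho> = "?\<tau>(PtrA := {p}, PtrB := {i}, BitTodo := {..<length w})"
    have 1: "?F w ?\<tau> = cond (\<lambda>w \<sigma>. occurs (\<lambda>a M. a = 3 \<and> M PtrA) w \<sigma> \<and> occurs (\<lambda>a M. a = 3 \<and> M PtrB) w \<sigma>)
         (assign_local b (\<lambda>_ M. M b \<or> M CmpCur)) skip w (advance_pointers w ?\<rho>)"
    proof -
      have "assign_local BitTodo (\<lambda>_ _. True) w (assign_local PtrB (\<lambda>_ M. M CmpCur) w (assign_local PtrA (\<lambda>_ M. M a) w ?\<tau>)) = ?\<rho>"
        using D assms occ_less by (auto simp: assign_local_apply fun_eq_iff)
      then show ?thesis by (simp add: seq_def)
    qed
    have occ: "occ w i" using D by simp
    have val: "occurs (\<lambda>a M. a = 3 \<and> M PtrA) w (advance_pointers w ?\<rho>) \<and> occurs (\<lambda>a M. a = 3 \<and> M PtrB) w (advance_pointers w ?\<rho>)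
      \<longleftrightarrow> val w p = val w i"
      by (rule advance_pointers_apply) (use assms occ in auto)
    have fr: "advance_pointers w ?\<rho> m = ?\<rho> m" if "m \<notin> {PtrA, PtrB, BitTodo, BitCur}" for m
      by (rule advance_pointers_apply(2)[OF _ _ _ assms(2) occ]) (use that in auto)
    have fa: "advance_pointers w ?\<rho> a = {p}"
      by (subst fr) (use D(3) assms(4) in simp_all)
    have fb: "advance_pointers w ?\<rho> b = {i \<in> D. val w i = val w p}"
      by (subst fr) (use D(3) assms(5) in simp_all)
    have fc: "advance_pointers w ?\<rho> CmpCur = {i}"
      by (subst fr) simp_all
    have Dl: "j < length w" if "j \<in> insert i D" for j using that D(1) occ occ_less by blast
    show "?F w ?\<tau> a = {p} \<and> ?F w ?\<tau> b = {j \<in> insert i D. val w j = val w p}"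
    proof (cases "val w p = val w i")
      case True
      then have "?F w ?\<tau> = assign_local b (\<lambda>_ M. M b \<or> M CmpCur) w (advance_pointers w ?\<rho>)"
        unfolding 1 cond_def val by simp
      moreover have "{j. j < length w \<and> (j \<in> {j \<in> D. val w j = val w p} \<or> j \<in> {i})} =
          {j \<in> insert i D. val w j = val w p}"
        using True Dl by auto
      ultimately show ?thesis using assms(6) by (simp only: assign_local_apply fun_upd_apply fa fb fc if_True if_False simp_thms)
    next
      case False
      then have "?F w ?\<tau> = advance_pointers w ?\<rho>"
        unfolding 1 cond_def val skip_def by simp
      moreover have "{j \<in> D. val w j = val w p} = {j \<in> insert i D. val w j = val w p}"
        using False by auto
      ultimately show ?thesis by (simp only: fa fb simp_thms)
    qed
  next
    show "finite {i. occ w i}" by (rule finite_subset[of _ "{..<length w}"]) (auto simp: occ_def)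
    show "preserves CmpTodo ?F"
      by (intro preserves_intros preserves_advance_pointers) (use assms in auto)
    show "?\<sigma> a = {p} \<and> ?\<sigma> b = {i \<in> {}. val w i = val w p}" using assms by auto
  next
    fix \<tau> assume "\<tau> a = {p} \<and> \<tau> b = {i \<in> {i. occ w i}. val w i = val w p}"
    then show "(\<tau>(CmpTodo := {}, CmpCur := {})) b = occs_of {val w p}"
      using assms(5) by (simp add: occs_of_def)
  qed simp
  moreover have "compare a b w \<sigma> = forl CmpTodo CmpCur ?F w ?\<sigma>"
  proof -
    have "assign_local CmpTodo (\<lambda>_ M. M Occs) w (assign_local b (\<lambda>_ _. False) w \<sigma>) = ?\<sigma>"
      using assms occ_less by (auto simp: assign_local_apply fun_eq_iff)
    then show ?thesis by (simp add: compare_def seq_def)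
  qed
  ultimately show ?thesis using True by simp
qed

end

lemma preservesD: "preserves m F \<Longrightarrow> F w \<sigma> m = \<sigma> m"
  by (simp add: preserves_def)

lemma fill_apply: "assign_local x (\<lambda>_ _. True) w \<sigma> = \<sigma>(x := {..<length w})"
  by (auto simp: assign_local_apply fun_eq_iff)

context hypergraph_word
begin

lemma in_occs_of [simp]: "i \<in> occs_of A \<longleftrightarrow> occ w i \<and> val w i \<in> A"
  by (simp add: occs_of_def)

lemma finite_occs: "finite {i. occ w i}"
  by (rule finite_subset[of _ "{..<length w}"]) (auto simp: occ_def)

lemma nonempty_word: "0 < length w"
  by (rule le_less_trans[OF le0 short])

lemma span_apply:
  assumes "\<sigma> Occs = {i. occ w i}" "\<sigma> EdgeEls \<subseteq> {i. occ w i}"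
  shows "span w \<sigma> Span = occs_of (val w ` \<sigma> EdgeEls)"
proof -
  let ?\<sigma> = "\<sigma>(Span := {}, SpanTodo := \<sigma> EdgeEls)"
  let ?F = "compare SpanCur SpanEq ;; assign_local Span (\<lambda>_ M. M Span \<or> M SpanEq)"
  have S: "?\<sigma> SpanTodo = \<sigma> EdgeEls" by simp
  have "assign_local SpanTodo (\<lambda>_ M. M EdgeEls) w (assign_local Span (\<lambda>_ _. False) w \<sigma>) = ?\<sigma>"
    using assms occ_less by (auto simp: assign_local_apply fun_eq_iff)
  then have "span w \<sigma> = forl SpanTodo SpanCur ?F w ?\<sigma>"
    by (simp add: span_def seq_def)
  moreover have "forl SpanTodo SpanCur ?F w ?\<sigma> Span = occs_of (val w ` \<sigma> EdgeEls)"
  proof (rule forl_invariant[where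
      I = "\<lambda>D \<tau>. \<tau> Occs = {i. occ w i} \<and> \<tau> Span = occs_of (val w ` D)"], unfold S)
    fix D i \<tau> T
    assume D: "D \<subseteq> \<sigma> EdgeEls" "i \<in> \<sigma> EdgeEls - D" "\<tau> Occs = {i. occ w i} \<and> \<tau> Span = occs_of (val w ` D)"
    let ?\<tau> = "\<tau>(SpanTodo := T, SpanCur := {i})"
    let ?\<rho> = "compare SpanCur SpanEq w ?\<tau>"
    have "occ w i" using D assms(2) by auto
    then have \<rho>: "?\<rho> m = (if m = SpanEq then occs_of {val w i} else ?\<tau> m)" if "m \<notin> cmp_marks" for m
      using D(3) that by (intro compare_apply) auto
    then have "?\<rho> Occs = {i. occ w i}" "?\<rho> Span = occs_of (val w ` D)" "?\<rho> SpanEq = occs_of {val w i}"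
      using D(3) by (auto simp: \<rho>)
    then show "?F w ?\<tau> Occs = {i. occ w i} \<and> ?F w ?\<tau> Span = occs_of (val w ` insert i D)"
      by (auto simp: seq_def assign_local_apply occ_less)
  next
    show "preserves SpanTodo ?F"
      by (intro preserves_intros preserves_compare) auto
    show "finite (\<sigma> EdgeEls)" using assms(2) finite_occs finite_subset by blast
    show "?\<sigma> Occs = {i. occ w i} \<and> ?\<sigma> Span = occs_of (val w ` {})"
      using assms by auto
  qed simp_all
  ultimately show ?thesis by simp
qed

lemma probe_apply:
  assumes "\<sigma> Occs = {i. occ w i}" "\<sigma> Target = occs_of A"
  shows "probe w \<sigma> Found \<subseteq> {..<length w}"
    and "probe w \<sigma> Found \<noteq> {} \<longleftrightarrow> (\<exists>E\<in>H. E \<subseteq> A)"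
proof -
  let ?S = "{e. e < length w \<and> w ! e = 4}"
  let ?\<sigma> = "\<sigma>(Found := {}, ProbeTodo := ?S)"
  let ?F = "mark_edge ProbeEls Occs ProbeCur ;;
       cond (\<lambda>w \<sigma>. occurs (\<lambda>_ M. M ProbeEls) w \<sigma> \<and> \<not> occurs (\<lambda>_ M. M ProbeEls \<and> \<not> M Target) w \<sigma>)
         (assign_local Found (\<lambda>_ _. True)) skip"
  let ?ok = "\<lambda>e. edge_occs w e \<noteq> {} \<and> val w ` edge_occs w e \<subseteq> A"
  have S: "?\<sigma> ProbeTodo = ?S" by simp
  have "assign_local ProbeTodo (\<lambda>a _. a = 4) w (assign_local Found (\<lambda>_ _. False) w \<sigma>) = ?\<sigma>"
    by (auto simp: assign_local_apply fun_eq_iff)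
  then have eq: "probe w \<sigma> = forl ProbeTodo ProbeCur ?F w ?\<sigma>"
    by (simp add: probe_def seq_def)
  have inv: "probe w \<sigma> Found \<subseteq> {..<length w} \<and> (probe w \<sigma> Found \<noteq> {} \<longleftrightarrow> (\<exists>e\<in>?S. ?ok e))"
    unfolding eq
  proof (rule forl_invariant[where
      I = "\<lambda>D \<tau>. \<tau> Occs = {i. occ w i} \<and> \<tau> Target = occs_of A \<and> \<tau> Found \<subseteq> {..<length w} \<and> (\<tau> Found \<noteq> {} \<longleftrightarrow> (\<exists>e\<in>D. ?ok e))"],
      unfold S)
    fix D i \<tau> T
    assume D: "D \<subseteq> ?S" "i \<in> ?S - D"
      "\<tau> Occs = {i. occ w i} \<and> \<tau> Target = occs_of A \<and> \<tau> Found \<subseteq> {..<length w} \<and> (\<tau> Found \<noteq> {} \<longleftrightarrow> (\<exists>e\<in>D. ?ok e))"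
    let ?\<tau> = "\<tau>(ProbeTodo := T, ProbeCur := {i})"
    let ?\<rho> = "?\<tau>(ProbeEls := edge_occs w i)"
    have m: "mark_edge ProbeEls Occs ProbeCur w ?\<tau> = ?\<rho>"
      using D by (intro mark_edge_apply) auto
    have "occurs (\<lambda>_ M. M ProbeEls) w ?\<rho> \<longleftrightarrow> edge_occs w i \<noteq> {}"
      using occ_less edge_occs_occ by (auto simp: occurs_def)
    moreover have "\<not> occurs (\<lambda>_ M. M ProbeEls \<and> \<not> M Target) w ?\<rho> \<longleftrightarrow> val w ` edge_occs w i \<subseteq> A"
      using D(3) occ_less edge_occs_occ by (auto simp: occurs_def)
    ultimately have F: "?F w ?\<tau> = (if ?ok i then ?\<rho>(Found := {..<length w}) else ?\<rho>)"
      by (auto simp: seq_def m cond_def skip_def assign_local_apply fun_eq_iff)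
    show "?F w ?\<tau> Occs = {i. occ w i} \<and> ?F w ?\<tau> Target = occs_of A \<and>
        ?F w ?\<tau> Found \<subseteq> {..<length w} \<and>
        (?F w ?\<tau> Found \<noteq> {} \<longleftrightarrow> (\<exists>e\<in>insert i D. ?ok e))"
      unfolding F using D(3) nonempty_word by auto
  next
    show "preserves ProbeTodo ?F"
      by (intro preserves_intros preserves_mark_edge) auto
  qed (use assms in simp_all)
  moreover have "(\<exists>e\<in>?S. ?ok e) \<longleftrightarrow> (\<exists>E\<in>H. E \<subseteq> A)"
    unfolding edges[symmetric] by blast
  ultimately show "probe w \<sigma> Found \<subseteq> {..<length w}"
    "probe w \<sigma> Found \<noteq> {} \<longleftrightarrow> (\<exists>E\<in>H. E \<subseteq> A)"
    using inv by simp_all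
qed

definition exchangeable where
  "exchangeable E x y \<longleftrightarrow> (\<exists>E'\<in>H. E' \<subseteq> insert y (E - {x}))"

text \<open>Within the nested loops \<open>Bad\<close> is only switched on, so each level
  contributes a disjunct to its previous value.\<close>

lemma exchange_in_apply:
  assumes "\<sigma> Occs = {i. occ w i}" "\<sigma> Span = occs_of E" "\<sigma> OutEq = occs_of {x}" "\<sigma> Rest = occs_of R"
    "\<sigma> Verts = vertex_occs w" "R \<subseteq> V"
  shows "exchange_in w \<sigma> Bad \<noteq> {} \<longleftrightarrow> \<sigma> Bad \<noteq> {} \<or> (\<exists>y\<in>R - (E - {x}). \<not> exchangeable E x y)"
proof -
  let ?S = "{i \<in> vertex_occs w. val w i \<in> R - (E - {x})}"
  let ?\<sigma> = "\<sigma>(InTodo := ?S)"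
  let ?F = "compare InCur InEq ;;
       assign_local Target (\<lambda>_ M. (M Span \<and> \<not> M OutEq) \<or> M InEq) ;;
       probe ;;
       cond (occurs (\<lambda>_ M. M Found)) skip (assign_local Bad (\<lambda>_ _. True))"
  have S: "?\<sigma> InTodo = ?S" by simp
  have "assign_local InTodo (\<lambda>_ M. M Verts \<and> M Rest \<and> \<not> (M Span \<and> \<not> M OutEq)) w \<sigma> = ?\<sigma>"
    using assms occ_less vertex_occs_occ by (auto simp: assign_local_apply fun_eq_iff)
  then have "exchange_in w \<sigma> = forl InTodo InCur ?F w ?\<sigma>"
    by (simp add: exchange_in_def seq_def)
  moreover have "forl InTodo InCur ?F w ?\<sigma> Bad \<noteq> {} \<longleftrightarrow>
    \<sigma> Bad \<noteq> {} \<or> (\<exists>i\<in>?S. \<not> exchangeable E x (val w i))"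
  proof (rule forl_invariant[where
      I = "\<lambda>D \<tau>. \<tau> Occs = {i. occ w i} \<and> \<tau> Span = occs_of E \<and> \<tau> OutEq = occs_of {x} \<and>
        (\<tau> Bad \<noteq> {} \<longleftrightarrow> \<sigma> Bad \<noteq> {} \<or> (\<exists>i\<in>D. \<not> exchangeable E x (val w i)))"], unfold S)
    fix D i \<tau> T
    assume D: "D \<subseteq> ?S" "i \<in> ?S - D"
      "\<tau> Occs = {i. occ w i} \<and> \<tau> Span = occs_of E \<and> \<tau> OutEq = occs_of {x} \<and>
        (\<tau> Bad \<noteq> {} \<longleftrightarrow> \<sigma> Bad \<noteq> {} \<or> (\<exists>i\<in>D. \<not> exchangeable E x (val w i)))"
    let ?\<tau> = "\<tau>(InTodo := T, InCur := {i})"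
    let ?\<rho> = "compare InCur InEq w ?\<tau>"
    let ?\<rho>1 = "assign_local Target (\<lambda>_ M. (M Span \<and> \<not> M OutEq) \<or> M InEq) w ?\<rho>"
    let ?\<rho>2 = "probe w ?\<rho>1"
    have "occ w i" using D vertex_occs_occ by auto
    then have \<rho>: "?\<rho> m = (if m = InEq then occs_of {val w i} else ?\<tau> m)" if "m \<notin> cmp_marks" for m
      using D(3) that by (intro compare_apply) auto
    have tg: "?\<rho>1 Target = occs_of (insert (val w i) (E - {x}))"
      using D(3) occ_less by (auto simp: assign_local_apply \<rho>)
    have oc: "?\<rho>1 Occs = {i. occ w i}" using D(3) by (simp add: assign_local_apply \<rho>)
    have found: "?\<rho>2 Found \<noteq> {} \<longleftrightarrow> exchangeable E x (val w i)"
      unfolding exchangeable_def by (rule probe_apply(2)[OF oc tg])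
    have fr: "?\<rho>2 m = ?\<rho>1 m" if "m \<notin> probe_marks" for m
      using preserves_probe[OF that] by (rule preservesD)
    have occ: "occurs (\<lambda>_ M. M Found) w ?\<rho>2 \<longleftrightarrow> ?\<rho>2 Found \<noteq> {}"
      using probe_apply(1)[OF oc tg] unfolding occurs_def by blast
    have F: "?F w ?\<tau> = (if exchangeable E x (val w i) then ?\<rho>2 else assign_local Bad (\<lambda>_ _. True) w ?\<rho>2)"
      unfolding seq_def cond_def occ found skip_def ..
    have v: "?\<rho>2 Occs = {i. occ w i}" "?\<rho>2 Span = occs_of E" "?\<rho>2 OutEq = occs_of {x}" "?\<rho>2 Bad = \<tau> Bad"
    proof -
      have "?\<rho>1 Span = occs_of E" "?\<rho>1 OutEq = occs_of {x}" "?\<rho>1 Bad = \<tau> Bad"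
        using D(3) by (simp_all add: assign_local_apply \<rho>)
      with oc show "?\<rho>2 Occs = {i. occ w i}" "?\<rho>2 Span = occs_of E" "?\<rho>2 OutEq = occs_of {x}" "?\<rho>2 Bad = \<tau> Bad"
        by (simp_all add: fr)
    qed
    show "?F w ?\<tau> Occs = {i. occ w i} \<and> ?F w ?\<tau> Span = occs_of E \<and> ?F w ?\<tau> OutEq = occs_of {x} \<and>
        (?F w ?\<tau> Bad \<noteq> {} \<longleftrightarrow> \<sigma> Bad \<noteq> {} \<or> (\<exists>i\<in>insert i D. \<not> exchangeable E x (val w i)))"
    proof (cases "exchangeable E x (val w i)")
      case True
      then have F': "?F w ?\<tau> = ?\<rho>2" using F by simp
      show ?thesis unfolding F' v using D(3) True by blast
    next
      case False
      then have F': "?F w ?\<tau> = ?\<rho>2(Bad := {..<length w})" using F by (simp add: fill_apply)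
      have "{..<length w} \<noteq> {}" using nonempty_word by blast
      then show ?thesis
        unfolding F' using v(1-3) False by (simp del: lessThan_eq_iff)
    qed
  next
    show "preserves InTodo ?F"
      by (intro preserves_intros preserves_compare preserves_probe) auto
    show "finite ?S" using finite_occs by (rule rev_finite_subset) (auto simp: vertex_occs_def)
  qed (use assms in simp_all)
  moreover have "(\<exists>i\<in>?S. \<not> exchangeable E x (val w i)) \<longleftrightarrow> (\<exists>y\<in>R - (E - {x}). \<not> exchangeable E x y)"
    using assms(6) unfolding verts(1)[symmetric] by blast
  ultimately show ?thesis by simp
qed

lemma exchange_out_apply:
  assumes "\<sigma> Occs = {i. occ w i}" "\<sigma> Span = occs_of E" "\<sigma> VertEq = occs_of {v}" "\<sigma> Rest = occs_of R"
    "\<sigma> Verts = vertex_occs w" "R \<subseteq> V" "\<sigma> EdgeEls \<subseteq> {i. occ w i}" "E = val w ` \<sigma> EdgeEls"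
  shows "exchange_out w \<sigma> Bad \<noteq> {} \<longleftrightarrow>
    \<sigma> Bad \<noteq> {} \<or> (\<exists>x\<in>E - {v}. \<exists>y\<in>R - (E - {x}). \<not> exchangeable E x y)"
proof -
  let ?S = "{i \<in> \<sigma> EdgeEls. val w i \<noteq> v}"
  let ?\<sigma> = "\<sigma>(OutTodo := ?S)"
  let ?F = "compare OutCur OutEq ;; exchange_in"
  let ?bad = "\<lambda>x. \<exists>y\<in>R - (E - {x}). \<not> exchangeable E x y"
  have S: "?\<sigma> OutTodo = ?S" by simp
  have "assign_local OutTodo (\<lambda>_ M. M EdgeEls \<and> \<not> M VertEq) w \<sigma> = ?\<sigma>"
    using assms occ_less by (auto simp: assign_local_apply fun_eq_iff)
  then have "exchange_out w \<sigma> = forl OutTodo OutCur ?F w ?\<sigma>"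
    by (simp add: exchange_out_def seq_def)
  moreover have "forl OutTodo OutCur ?F w ?\<sigma> Bad \<noteq> {} \<longleftrightarrow> \<sigma> Bad \<noteq> {} \<or> (\<exists>i\<in>?S. ?bad (val w i))"
  proof (rule forl_invariant[where
      I = "\<lambda>D \<tau>. \<tau> Occs = {i. occ w i} \<and> \<tau> Span = occs_of E \<and> \<tau> Rest = occs_of R \<and>
        \<tau> Verts = vertex_occs w \<and> (\<tau> Bad \<noteq> {} \<longleftrightarrow> \<sigma> Bad \<noteq> {} \<or> (\<exists>i\<in>D. ?bad (val w i)))"], unfold S)
    fix D i \<tau> T
    assume D: "D \<subseteq> ?S" "i \<in> ?S - D"
      "\<tau> Occs = {i. occ w i} \<and> \<tau> Span = occs_of E \<and> \<tau> Rest = occs_of R \<and>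
        \<tau> Verts = vertex_occs w \<and> (\<tau> Bad \<noteq> {} \<longleftrightarrow> \<sigma> Bad \<noteq> {} \<or> (\<exists>i\<in>D. ?bad (val w i)))"
    let ?\<tau> = "\<tau>(OutTodo := T, OutCur := {i})"
    let ?\<rho> = "compare OutCur OutEq w ?\<tau>"
    have "occ w i" using D assms(7) by auto
    then have \<rho>: "?\<rho> m = (if m = OutEq then occs_of {val w i} else ?\<tau> m)" if "m \<notin> cmp_marks" for m
      using D(3) that by (intro compare_apply) auto
    have bad: "exchange_in w ?\<rho> Bad \<noteq> {} \<longleftrightarrow> ?\<rho> Bad \<noteq> {} \<or> ?bad (val w i)"
      by (rule exchange_in_apply) (use D(3) assms(6) in \<open>simp_all add: \<rho>\<close>)
    have fr: "exchange_in w ?\<rho> m = ?\<rho> m" if "m \<notin> in_marks" for m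
      using preserves_exchange_in[OF that] by (rule preservesD)
    show "?F w ?\<tau> Occs = {i. occ w i} \<and> ?F w ?\<tau> Span = occs_of E \<and> ?F w ?\<tau> Rest = occs_of R \<and>
        ?F w ?\<tau> Verts = vertex_occs w \<and>
        (?F w ?\<tau> Bad \<noteq> {} \<longleftrightarrow> \<sigma> Bad \<noteq> {} \<or> (\<exists>i\<in>insert i D. ?bad (val w i)))"
      unfolding seq_def bad using D(3) by (simp add: fr \<rho>) blast
  next
    show "preserves OutTodo ?F"
      by (intro preserves_intros preserves_compare preserves_exchange_in) auto
    show "finite ?S" using finite_occs by (rule rev_finite_subset) (use assms(7) in auto)
  qed (use assms in simp_all)
  moreover have "(\<exists>i\<in>?S. ?bad (val w i)) \<longleftrightarrow> (\<exists>x\<in>E - {v}. ?bad x)"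
    using assms(8) by blast
  ultimately show ?thesis by simp
qed

lemma check_vertex_apply:
  assumes "\<sigma> Occs = {i. occ w i}" "\<sigma> Rest = occs_of R" "\<sigma> Verts = vertex_occs w" "R \<subseteq> V"
    "\<sigma> VertCur = {p}" "occ w p" "val w p \<in> R"
  shows "check_vertex w \<sigma> Bad = {} \<longleftrightarrow> uniform k H R (val w p)"
    "check_vertex w \<sigma> Dom \<noteq> {} \<longleftrightarrow> (\<exists>E\<in>H. val w p \<in> E \<and> E \<subseteq> R)"
    "check_vertex w \<sigma> VertEq = occs_of {val w p}"
proof -
  let ?v = "val w p"
  let ?S = "{e. e < length w \<and> w ! e = 4}"
  let ?init = "compare VertCur VertEq w \<sigma>"
  let ?\<sigma> = "?init(Bad := {}, Dom := {}, EdgeTodo := ?S)"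
  let ?F = "mark_edge EdgeEls Occs EdgeCur ;;
       cond (\<lambda>w \<sigma>. occurs (\<lambda>_ M. M EdgeEls \<and> M VertEq) w \<sigma> \<and> \<not> occurs (\<lambda>_ M. M EdgeEls \<and> \<not> M Rest) w \<sigma>)
         (assign_local Dom (\<lambda>_ _. True) ;; span ;; exchange_out) skip"
  let ?E = "\<lambda>e. val w ` edge_occs w e"
  let ?ok = "\<lambda>e. ?v \<in> ?E e \<and> ?E e \<subseteq> R"
  let ?bad = "\<lambda>E. \<exists>x\<in>E - {?v}. \<exists>y\<in>R - (E - {x}). \<not> exchangeable E x y"
  have \<sigma>0: "?init m = (if m = VertEq then occs_of {?v} else \<sigma> m)" if "m \<notin> cmp_marks" for m
    using assms that by (intro compare_apply) auto
  let ?I = "\<lambda>D \<tau>. \<tau> Occs = {i. occ w i} \<and> \<tau> Rest = occs_of R \<and> \<tau> Verts = vertex_occs w \<and>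
      \<tau> VertEq = occs_of {?v} \<and> (\<tau> Bad \<noteq> {} \<longleftrightarrow> (\<exists>e\<in>D. ?ok e \<and> ?bad (?E e))) \<and>
      (\<tau> Dom \<noteq> {} \<longleftrightarrow> (\<exists>e\<in>D. ?ok e))"
  have S: "?\<sigma> EdgeTodo = ?S" by simp
  have "assign_local EdgeTodo (\<lambda>a _. a = 4) w (assign_local Dom (\<lambda>_ _. False) w (assign_local Bad (\<lambda>_ _. False) w ?init)) = ?\<sigma>"
    by (auto simp: assign_local_apply fun_eq_iff)
  then have eq: "check_vertex w \<sigma> = forl EdgeTodo EdgeCur ?F w ?\<sigma>"
    by (simp add: check_vertex_def seq_def)
  have inv: "?I ?S (check_vertex w \<sigma>)"
    unfolding eq
  proof (rule forl_invariant[where I = ?I], unfold S)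
    fix D i \<tau> T
    assume D: "D \<subseteq> ?S" "i \<in> ?S - D" "?I D \<tau>"
    let ?\<tau> = "\<tau>(EdgeTodo := T, EdgeCur := {i})"
    let ?\<rho> = "?\<tau>(EdgeEls := edge_occs w i)"
    have m: "mark_edge EdgeEls Occs EdgeCur w ?\<tau> = ?\<rho>"
      using D by (intro mark_edge_apply) auto
    have t: "occurs (\<lambda>_ M. M EdgeEls \<and> M VertEq) w ?\<rho> \<and> \<not> occurs (\<lambda>_ M. M EdgeEls \<and> \<not> M Rest) w ?\<rho> \<longleftrightarrow> ?ok i"
    proof -
      have "occurs (\<lambda>_ M. M EdgeEls \<and> M VertEq) w ?\<rho> \<longleftrightarrow> ?v \<in> ?E i"
        using D(3) occ_less edge_occs_occ by (auto simp: occurs_def) (metis image_eqI)+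
      moreover have "\<not> occurs (\<lambda>_ M. M EdgeEls \<and> \<not> M Rest) w ?\<rho> \<longleftrightarrow> ?E i \<subseteq> R"
        using D(3) occ_less edge_occs_occ by (auto simp: occurs_def)
      ultimately show ?thesis by simp
    qed
    show "?I (insert i D) (?F w ?\<tau>)"
    proof (cases "?ok i")
      case False
      have F: "?F w ?\<tau> = ?\<rho>"
        unfolding seq_def m cond_def t skip_def using False by (rule if_not_P)
      have n: "(\<exists>e\<in>insert i D. ?ok e \<and> ?bad (?E e)) \<longleftrightarrow> (\<exists>e\<in>D. ?ok e \<and> ?bad (?E e))"
        "(\<exists>e\<in>insert i D. ?ok e) \<longleftrightarrow> (\<exists>e\<in>D. ?ok e)"
        using False by blast+
      show ?thesis unfolding F n using D(3) by simp
    next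
      case True
      let ?\<rho>1 = "?\<rho>(Dom := {..<length w})"
      let ?\<rho>2 = "span w ?\<rho>1"
      have F: "?F w ?\<tau> = exchange_out w ?\<rho>2"
        unfolding seq_def m cond_def t fill_apply using True by (rule if_P)
      have sp: "?\<rho>2 Span = occs_of (?E i)"
        using span_apply[of ?\<rho>1] D(3) edge_occs_occ by auto
      have fr: "?\<rho>2 m = ?\<rho>1 m" if "m \<notin> span_marks" for m
        using preserves_span[OF that] by (rule preservesD)
      have fo: "exchange_out w ?\<rho>2 m = ?\<rho>2 m" if "m \<notin> out_marks" for m
        using preserves_exchange_out[OF that] by (rule preservesD)
      have bad: "exchange_out w ?\<rho>2 Bad \<noteq> {} \<longleftrightarrow> ?\<rho>2 Bad \<noteq> {} \<or> ?bad (?E i)"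
        by (rule exchange_out_apply) (use D(3) assms(4) sp edge_occs_occ in \<open>auto simp: fr\<close>)
      have \<rho>2: "?\<rho>2 Bad = \<tau> Bad" by (simp add: fr)
      have "exchange_out w ?\<rho>2 Bad \<noteq> {} \<longleftrightarrow> (\<exists>e\<in>insert i D. ?ok e \<and> ?bad (?E e))"
      proof -
        have d: "\<tau> Bad \<noteq> {} \<longleftrightarrow> (\<exists>e\<in>D. ?ok e \<and> ?bad (?E e))" using D(3) by (elim conjE)
        have ins: "(\<exists>e\<in>insert i D. P e) \<longleftrightarrow> P i \<or> (\<exists>e\<in>D. P e)" for P by simp
        show ?thesis unfolding bad \<rho>2 d ins by (simp only: True simp_thms disj_commute)
      qed
      moreover have "exchange_out w ?\<rho>2 Dom \<noteq> {}" "\<exists>e\<in>insert i D. ?ok e"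
        using nonempty_word True by (auto simp: fr fo)
      moreover have "exchange_out w ?\<rho>2 Occs = {i. occ w i}" "exchange_out w ?\<rho>2 Rest = occs_of R"
        "exchange_out w ?\<rho>2 Verts = vertex_occs w" "exchange_out w ?\<rho>2 VertEq = occs_of {?v}"
        using D(3) by (simp_all add: fr fo)
      ultimately show ?thesis unfolding F by blast
    qed
  next
    show "preserves EdgeTodo ?F"
      by (intro preserves_intros preserves_mark_edge preserves_span preserves_exchange_out) auto
  qed (use assms in \<open>simp_all add: \<sigma>0\<close>)
  \<comment> \<open>A \<open>4\<close> without numbers drops out by itself, since \<open>?ok\<close>
    puts the vertex into the edge.\<close>
  have ed: "(\<exists>e\<in>?S. ?ok e \<and> P (?E e)) \<longleftrightarrow> (\<exists>E\<in>H. ?v \<in> E \<and> E \<subseteq> R \<and> P E)" for P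
    unfolding edges[symmetric] by blast
  have fin: "finite R" using assms(4) hyp finite_subset unfolding k_hypergraph_def by blast
  have card: "\<And>E. E \<in> H \<Longrightarrow> card E = k" using hyp unfolding k_hypergraph_def by blast
  show "check_vertex w \<sigma> Bad = {} \<longleftrightarrow> uniform k H R ?v"
  proof -
    have "check_vertex w \<sigma> Bad \<noteq> {} \<longleftrightarrow> (\<exists>e\<in>?S. ?ok e \<and> ?bad (?E e))" using inv by (elim conjE)
    then have "check_vertex w \<sigma> Bad \<noteq> {} \<longleftrightarrow> (\<exists>E\<in>H. ?v \<in> E \<and> E \<subseteq> R \<and> ?bad E)"
      unfolding ed[of ?bad] .
    moreover have "uniform k H R ?v \<longleftrightarrow> (\<forall>E\<in>H. ?v \<in> E \<longrightarrow> E \<subseteq> R \<longrightarrow> \<not> ?bad E)"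
      by (simp only: exchangeable_def bex_simps ball_simps not_not,
          rule uniform_iff_exchange[OF fin _ assms(7) k], rule card)
    moreover have "(\<forall>E\<in>H. A E \<longrightarrow> B E \<longrightarrow> \<not> C E) \<longleftrightarrow> \<not> (\<exists>E\<in>H. A E \<and> B E \<and> C E)" for A B C
      by blast
    ultimately show ?thesis by (simp only: not_not) argo
  qed
  show "check_vertex w \<sigma> Dom \<noteq> {} \<longleftrightarrow> (\<exists>E\<in>H. ?v \<in> E \<and> E \<subseteq> R)"
  proof -
    have "check_vertex w \<sigma> Dom \<noteq> {} \<longleftrightarrow> (\<exists>e\<in>?S. ?ok e)" using inv by (elim conjE)
    then show ?thesis using ed[of "\<lambda>_. True"] by (simp only: simp_thms)
  qed
  show "check_vertex w \<sigma> VertEq = occs_of {?v}" using inv by (elim conjE)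
qed

end

section \<open>The decision procedures\<close>

lemma computable_wf: "computable F \<Longrightarrow> wf_state w \<sigma> \<Longrightarrow> wf_state w (F w \<sigma>)"
  unfolding computable_def computes_with_def by blast

lemma occurs_mark: "wf_state w \<sigma> \<Longrightarrow> occurs (\<lambda>_ M. M x) w \<sigma> \<longleftrightarrow> \<sigma> x \<noteq> {}"
  unfolding occurs_def wf_state_def by blast

text \<open>The guard skips vertices that are already gone. \<open>act\<close> runs only upon a
  removal and learns from \<open>Dom\<close> which kind of vertex was removed.\<close>

definition visit :: "mark prog \<Rightarrow> mark prog" where
  "visit act = cond (occurs (\<lambda>_ M. M VertCur \<and> M Rest))
     (check_vertex ;;
      cond (occurs (\<lambda>_ M. M Bad)) skip (assign_local Rest (\<lambda>_ M. M Rest \<and> \<not> M VertEq) ;; act))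
     skip"

text \<open>A vertex refused once may become uniform after others have left, hence repeated passes
  over all vertices. The round positions only count the passes.\<close>

definition eliminate :: "mark prog \<Rightarrow> mark prog" where
  "eliminate act =
     assign_local RoundTodo (\<lambda>_ _. True) ;;
     forl RoundTodo RoundCur (
       assign_local VertTodo (\<lambda>_ M. M Verts) ;; forl VertTodo VertCur (visit act))"

definition initialize :: "mark prog" where
  "initialize = mark_occs Occs ;; mark_vertices Verts Occs ;; assign_local Rest (\<lambda>_ M. M Occs)"

definition decide_orderable :: "mark prog" where
  "decide_orderable = initialize ;; eliminate skip ;;
     cond (occurs (\<lambda>_ M. M Verts \<and> M Rest)) (assign_local Accept (\<lambda>_ _. False)) (assign_local Accept (\<lambda>_ _. True))"

primrec add_many :: "nat \<Rightarrow> mark prog" where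
  "add_many 0 = skip"
| "add_many (Suc n) = add_one Cnt ;; add_many n"

text \<open>The counter is capped at the length of the word, which exceeds the number of vertices.\<close>

definition count_slots :: "nat \<Rightarrow> mark prog" where
  "count_slots k = cond (occurs (\<lambda>_ M. M Dom)) (add_many (k - 1))
     (cond (occurs (\<lambda>_ M. M Cnt)) (remove_one Cnt) (assign_local Fail (\<lambda>_ _. True)))"

definition decide_matching :: "nat \<Rightarrow> mark prog" where
  "decide_matching k = initialize ;; eliminate (count_slots k) ;;
     cond (\<lambda>w \<sigma>. count_dvd k Verts w \<sigma> \<and> \<not> occurs (\<lambda>_ M. M Fail) w \<sigma>)
       (assign_local Accept (\<lambda>_ _. True)) (assign_local Accept (\<lambda>_ _. False))"

section \<open>Computability of the decision procedures\<close>

lemma preserves_visit: "m \<notin> check_marks \<Longrightarrow> m \<noteq> Rest \<Longrightarrow> preserves m act \<Longrightarrow> preserves m (visit act)"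
  unfolding visit_def by (intro preserves_intros preserves_check_vertex) auto

lemma computable_visit: "computable act \<Longrightarrow> computable (visit act)"
  unfolding visit_def by (intro computable_intros computable_check_vertex)

lemma computable_eliminate:
  assumes "computable act" "preserves VertTodo act" "preserves RoundTodo act"
  shows "computable (eliminate act)"
  unfolding eliminate_def
  by (intro computable_intros computable_visit preserves_intros preserves_visit assms) auto

lemma computable_initialize: "computable initialize"
proof -
  have "computable (mark_occs Occs)"
    unfolding mark_occs_def by (rule computable_assign[where B = 2]) auto
  moreover have "computable (mark_vertices Verts Occs)"
    unfolding mark_vertices_def by (rule computable_assign[where B = 2]) auto
  ultimately show ?thesis
    unfolding initialize_def by (intro computable_intros)
qed

lemma computable_add_one: "computable (add_one x)"
  unfolding add_one_def by (rule computable_assign[where B = 2]) auto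

lemma computable_add_many: "computable (add_many n)"
  by (induction n) (auto intro: computable_intros computable_add_one)

lemma preserves_add_many: "m \<noteq> Cnt \<Longrightarrow> preserves m (add_many n)"
  by (induction n) (auto intro!: preserves_intros simp: add_one_def preserves_assign)

lemma computable_count_slots: "computable (count_slots k)"
proof -
  have "computable (remove_one Cnt)"
    unfolding remove_one_def by (rule computable_assign[where B = 2]) auto
  then show ?thesis
    unfolding count_slots_def by (intro computable_intros computable_add_many)
qed

lemma preserves_count_slots: "m \<noteq> Cnt \<Longrightarrow> m \<noteq> Fail \<Longrightarrow> preserves m (count_slots k)"
  unfolding count_slots_def
  by (intro preserves_intros preserves_add_many) (simp_all add: remove_one_def preserves_assign)

lemma computable_decide_orderable: "computable decide_orderable"
  unfolding decide_orderable_def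
  by (intro computable_intros computable_initialize computable_eliminate preserves_intros)

lemma computable_decide_matching: "k \<ge> 1 \<Longrightarrow> computable (decide_matching k)"
  unfolding decide_matching_def
  by (intro computable_intros computable_initialize computable_eliminate computable_count_slots
      preserves_count_slots testable_count_dvd) auto

lemma add_many_card:
  assumes "\<sigma> Cnt \<subseteq> {..<length w}"
  shows "card (add_many n w \<sigma> Cnt) = min (length w) (card (\<sigma> Cnt) + n)"
  using assms
proof (induction n arbitrary: \<sigma>)
  case 0
  then have "card (\<sigma> Cnt) \<le> length w" using card_mono[of "{..<length w}" "\<sigma> Cnt"] by simp
  then show ?case by (simp add: skip_def)
next
  case (Suc n)
  obtain X where X: "add_one Cnt w \<sigma> = \<sigma>(Cnt := X)" "X \<subseteq> {..<length w}"
    "card X = min (length w) (Suc (card (\<sigma> Cnt)))"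
    using add_one_apply[where x = Cnt and \<sigma> = \<sigma> and w = w, OF Suc.prems] .
  let ?\<sigma> = "\<sigma>(Cnt := X)"
  have "card (add_many n w ?\<sigma> Cnt) = min (length w) (card (?\<sigma> Cnt) + n)"
    by (rule Suc.IH) (simp add: X(2))
  moreover have "add_many (Suc n) w \<sigma> = add_many n w ?\<sigma>"
    by (simp only: add_many.simps seq_def X(1))
  ultimately show ?case using X(3) by (simp only: fun_upd_same)
qed

text \<open>\<open>Q\<close> relates the vertices that remain to the bookkeeping that \<open>act\<close> performs whenever a vertex is removed.\<close>

locale elimination = hypergraph_word +
  fixes act :: "mark prog" and Q :: "nat set \<Rightarrow> mark state \<Rightarrow> bool"
  assumes act: "computable act" "\<And>m. m \<noteq> Cnt \<Longrightarrow> m \<noteq> Fail \<Longrightarrow> preserves m act"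
    and Q_cong: "\<And>R \<sigma> \<tau>. Q R \<sigma> \<Longrightarrow> \<tau> Cnt = \<sigma> Cnt \<Longrightarrow> \<tau> Fail = \<sigma> Fail \<Longrightarrow> Q R \<tau>"
    and Q_step: "\<And>R \<sigma> v. R \<subseteq> V \<Longrightarrow> v \<in> R \<Longrightarrow> uniform k H R v \<Longrightarrow> wf_state w \<sigma> \<Longrightarrow>
      (\<sigma> Dom \<noteq> {} \<longleftrightarrow> (\<exists>E\<in>H. v \<in> E \<and> E \<subseteq> R)) \<Longrightarrow> Q R \<sigma> \<Longrightarrow> Q (R - {v}) (act w \<sigma>)"
begin

section \<open>The invariant of the elimination\<close>

lemma finite_V: "finite V"
  using hyp by (simp add: k_hypergraph_def)

definition reduced :: "nat set \<Rightarrow> mark state \<Rightarrow> bool" where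
  "reduced R \<sigma> \<longleftrightarrow> R \<subseteq> V \<and> \<sigma> Occs = {i. occ w i} \<and> \<sigma> Verts = vertex_occs w \<and> \<sigma> Rest = occs_of R \<and>
     (orderable k R H \<longleftrightarrow> orderable k V H) \<and> Q R \<sigma> \<and> wf_state w \<sigma>"

lemma reduced_cong:
  assumes "reduced R \<sigma>" "wf_state w \<tau>" "\<And>m. m \<in> {Occs, Verts, Rest, Cnt, Fail} \<Longrightarrow> \<tau> m = \<sigma> m"
  shows "reduced R \<tau>"
  using assms Q_cong[of R \<sigma> \<tau>] by (simp add: reduced_def)

lemma reduced_visit:
  assumes "reduced R \<sigma>" "\<sigma> VertCur = {p}" "p \<in> vertex_occs w"
  shows "\<exists>R'. reduced R' (visit act w \<sigma>) \<and>
    (R' = R \<and> (val w p \<in> R \<longrightarrow> \<not> uniform k H R (val w p)) \<or> val w p \<in> R \<and> R' = R - {val w p})"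
proof -
  let ?v = "val w p"
  have p: "occ w p" using vertex_occs_occ assms(3) .
  have \<sigma>: "\<sigma> Occs = {i. occ w i}" "\<sigma> Rest = occs_of R" "\<sigma> Verts = vertex_occs w" "R \<subseteq> V"
    and wf: "wf_state w \<sigma>" using assms(1) by (simp_all add: reduced_def)
  have t: "occurs (\<lambda>_ M. M VertCur \<and> M Rest) w \<sigma> \<longleftrightarrow> ?v \<in> R"
    using p occ_less[OF p] assms(2) \<sigma> by (auto simp: occurs_def)
  show ?thesis
  proof (cases "?v \<in> R")
    case False
    then have "visit act w \<sigma> = \<sigma>" unfolding visit_def cond_def t skip_def by simp
    with assms(1) False show ?thesis by auto
  next
    case True
    let ?\<rho> = "check_vertex w \<sigma>"
    have fr: "?\<rho> m = \<sigma> m" if "m \<notin> check_marks" for m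
      using preserves_check_vertex[OF that] by (rule preservesD)
    have wf\<rho>: "wf_state w ?\<rho>" by (rule computable_wf[OF computable_check_vertex wf])
    have \<rho>: "reduced R ?\<rho>"
      by (rule reduced_cong[OF assms(1) wf\<rho>]) (auto simp: fr)
    note chk = check_vertex_apply[OF \<sigma> assms(2) p True]
    have V: "visit act w \<sigma> = (if uniform k H R ?v
        then act w (assign_local Rest (\<lambda>_ M. M Rest \<and> \<not> M VertEq) w ?\<rho>) else ?\<rho>)"
      unfolding visit_def cond_def seq_def t skip_def using True
      by (simp add: occurs_mark[OF wf\<rho>] chk(1))
    show ?thesis
    proof (cases "uniform k H R ?v")
      case False
      with V \<rho> show ?thesis by auto
    next
      case True': True
      let ?\<rho>1 = "?\<rho>(Rest := occs_of (R - {?v}))"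
      have "assign_local Rest (\<lambda>_ M. M Rest \<and> \<not> M VertEq) w ?\<rho> = ?\<rho>1"
        using chk(3) \<sigma>(2) occ_less by (auto simp: assign_local_apply fun_eq_iff fr)
      then have V': "visit act w \<sigma> = act w ?\<rho>1" using V True' by simp
      have wf1: "wf_state w ?\<rho>1" using wf\<rho> occ_less by (auto simp: wf_state_def)
      have "Q R ?\<rho>" using \<rho> by (simp add: reduced_def)
      then have "Q R ?\<rho>1" by (rule Q_cong) simp_all
      moreover have "?\<rho>1 Dom \<noteq> {} \<longleftrightarrow> (\<exists>E\<in>H. ?v \<in> E \<and> E \<subseteq> R)" using chk(2) by simp
      ultimately have "Q (R - {?v}) (act w ?\<rho>1)"
        using Q_step[OF \<sigma>(4) True True' wf1] by blast
      moreover have "wf_state w (act w ?\<rho>1)" by (rule computable_wf[OF act(1) wf1])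
      moreover have "orderable k (R - {?v}) H \<longleftrightarrow> orderable k V H"
        using orderable_remove[OF finite_subset[OF \<sigma>(4) finite_V] True True'] assms(1)
        by (simp add: reduced_def)
      moreover have fa: "act w ?\<rho>1 m = ?\<rho>1 m" if "m \<noteq> Cnt" "m \<noteq> Fail" for m
        using act(2)[OF that] by (rule preservesD)
      moreover have "R - {?v} \<subseteq> V" using \<sigma>(4) by blast
      ultimately have "reduced (R - {?v}) (act w ?\<rho>1)"
        using \<sigma> by (simp add: reduced_def fr)
      with V' True show ?thesis by auto
    qed
  qed
qed

text \<open>Each pass removes a vertex or shows that no remaining one is uniform. The sum
  \<open>card R + card D\<close> of remaining vertices and passes made thus stays below
  \<open>card V\<close> unless the elimination is settled, and there are more passes than
  vertices.\<close>

lemma reduced_eliminate: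
  assumes "reduced V \<sigma>"
  shows "\<exists>R. reduced R (eliminate act w \<sigma>) \<and> (R = {} \<or> \<not> orderable k R H)"
proof -
  let ?F = "assign_local VertTodo (\<lambda>_ M. M Verts) ;; forl VertTodo VertCur (visit act)"
  let ?\<sigma> = "\<sigma>(RoundTodo := {..<length w})"
  let ?done = "\<lambda>R. R = {} \<or> \<not> orderable k R H"
  have S: "?\<sigma> RoundTodo = {..<length w}" by simp
  have eq: "eliminate act w \<sigma> = forl RoundTodo RoundCur ?F w ?\<sigma>"
    by (simp add: eliminate_def seq_def fill_apply)
  have wfup: "wf_state w (\<tau>(m := X))" if "wf_state w \<tau>" "X \<subseteq> {..<length w}" for \<tau> :: "mark state" and m X
    using that by (simp add: wf_state_def)
  have wfr: "wf_state w \<tau>" if "reduced R \<tau>" for R \<tau> using that by (simp add: reduced_def)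
  have presV: "preserves VertTodo (visit act)"
    by (intro preserves_visit act) auto
  show ?thesis
    unfolding eq
  proof (rule forl_invariant[where
      I = "\<lambda>D \<tau>. \<exists>R. reduced R \<tau> \<and> (?done R \<or> card R + card D \<le> card V)"], unfold S)
    fix D i \<tau> T
    assume D: "D \<subseteq> {..<length w}" "i \<in> {..<length w} - D"
      "\<exists>R. reduced R \<tau> \<and> (?done R \<or> card R + card D \<le> card V)" "T \<subseteq> {..<length w}"
    then obtain R0 where R0: "reduced R0 \<tau>" "?done R0 \<or> card R0 + card D \<le> card V" by blast
    have R0V: "R0 \<subseteq> V" "finite R0" "orderable k R0 H \<longleftrightarrow> orderable k V H"
      using R0(1) finite_V finite_subset by (auto simp: reduced_def)
    let ?\<tau> = "\<tau>(RoundTodo := T, RoundCur := {i}, VertTodo := vertex_occs w)"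
    have VS: "?\<tau> VertTodo = vertex_occs w" by simp
    have vl: "vertex_occs w \<subseteq> {..<length w}" using vertex_occs_occ occ_less by blast
    have F: "?F w (\<tau>(RoundTodo := T, RoundCur := {i})) = forl VertTodo VertCur (visit act) w ?\<tau>"
    proof -
      have "assign_local VertTodo (\<lambda>_ M. M Verts) w (\<tau>(RoundTodo := T, RoundCur := {i})) = ?\<tau>"
        using R0(1) vl by (auto simp: assign_local_apply fun_eq_iff reduced_def)
      then show ?thesis by (simp add: seq_def)
    qed
    \<comment> \<open>Within a pass, refusals refer to the set at the time of the visit. They are
      remembered only as long as that set is still \<open>R0\<close>; after any removal the smaller
      cardinality is all that matters.\<close>
    let ?K = "\<lambda>D R. R \<subseteq> R0 \<and> (R = R0 \<and> (\<forall>i\<in>D. val w i \<in> R0 \<longrightarrow> \<not> uniform k H R0 (val w i)) \<or> card R < card R0)"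
    have "\<exists>R. reduced R (forl VertTodo VertCur (visit act) w ?\<tau>) \<and> ?K (vertex_occs w) R"
    proof (rule forl_invariant[where I = "\<lambda>D \<tau>. \<exists>R. reduced R \<tau> \<and> ?K D R"], unfold VS)
      fix D' p \<rho> T'
      assume D': "D' \<subseteq> vertex_occs w" "p \<in> vertex_occs w - D'" "\<exists>R. reduced R \<rho> \<and> ?K D' R" "T' \<subseteq> vertex_occs w"
      then obtain R where R: "reduced R \<rho>" "?K D' R" by blast
      let ?\<rho> = "\<rho>(VertTodo := T', VertCur := {p})"
      have "wf_state w ?\<rho>" using D' vl by (intro wfup wfr[OF R(1)]) auto
      then have "reduced R ?\<rho>" by (rule reduced_cong[OF R(1)]) auto
      moreover have "p \<in> vertex_occs w" using D' by blast
      ultimately obtain R' where R': "reduced R' (visit act w ?\<rho>)"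
        "R' = R \<and> (val w p \<in> R \<longrightarrow> \<not> uniform k H R (val w p)) \<or> val w p \<in> R \<and> R' = R - {val w p}"
        using reduced_visit[of R ?\<rho> p] by auto
      have "?K (insert p D') R'"
        using R'(2)
      proof
        assume "R' = R \<and> (val w p \<in> R \<longrightarrow> \<not> uniform k H R (val w p))"
        with R(2) show ?thesis by auto
      next
        assume *: "val w p \<in> R \<and> R' = R - {val w p}"
        then have "R' \<subset> R0" using R(2) by blast
        then show ?thesis using psubset_card_mono[OF R0V(2)] by blast
      qed
      with R'(1) show "\<exists>R. reduced R (visit act w ?\<rho>) \<and> ?K (insert p D') R" by blast
    next
      have "wf_state w ?\<tau>" using D vl by (intro wfup wfr[OF R0(1)]) auto
      then have "reduced R0 ?\<tau>" by (rule reduced_cong[OF R0(1)]) auto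
      then show "\<exists>R. reduced R ?\<tau> \<and> ?K {} R" by blast
    next
      fix \<rho> assume "\<exists>R. reduced R \<rho> \<and> ?K (vertex_occs w) R"
      then obtain R where R: "reduced R \<rho>" "?K (vertex_occs w) R" by blast
      have "wf_state w (\<rho>(VertTodo := {}, VertCur := {}))" by (intro wfup wfr[OF R(1)]) auto
      then have "reduced R (\<rho>(VertTodo := {}, VertCur := {}))" by (rule reduced_cong[OF R(1)]) auto
      with R(2) show "\<exists>R. reduced R (\<rho>(VertTodo := {}, VertCur := {})) \<and> ?K (vertex_occs w) R" by blast
    next
      show "finite (vertex_occs w)" using vl finite_subset by blast
    qed (use presV in simp_all)
    then obtain R where R: "reduced R (?F w (\<tau>(RoundTodo := T, RoundCur := {i})))" "?K (vertex_occs w) R"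
      unfolding F by blast
    have "?done R \<or> card R + card (insert i D) \<le> card V"
    proof (cases "R = R0")
      case True
      \<comment> \<open>A whole pass without removal: by \<open>orderable_last\<close> the set is
        empty or not orderable.\<close>
      then have "\<forall>v\<in>R0. \<not> uniform k H R0 v" using R(2) R0V(1) unfolding verts(1)[symmetric] by auto
      then show ?thesis using orderable_last[of k R0 H] True by blast
    next
      case False
      then have less: "card R < card R0" using R(2) by blast
      \<comment> \<open>Removals do not change orderability, so a set recognised as not orderable
        remains so.\<close>
      have "orderable k R H \<longleftrightarrow> orderable k R0 H" using R(1) R0V(3) by (simp add: reduced_def)
      moreover have "card (insert i D) = Suc (card D)"
        using D finite_subset[OF D(1)] by simp
      ultimately show ?thesis using R0(2) less by auto
    qed
    with R(1) show "\<exists>R. reduced R (?F w (\<tau>(RoundTodo := T, RoundCur := {i}))) \<and>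
        (?done R \<or> card R + card (insert i D) \<le> card V)" by blast
  next
    have "wf_state w ?\<sigma>" by (intro wfup wfr[OF assms]) auto
    then have "reduced V ?\<sigma>" by (rule reduced_cong[OF assms]) auto
    then show "\<exists>R. reduced R ?\<sigma> \<and> (?done R \<or> card R + card {} \<le> card V)" by auto
  next
    fix \<tau> assume "\<exists>R. reduced R \<tau> \<and> (?done R \<or> card R + card {..<length w} \<le> card V)"
    then obtain R where R: "reduced R \<tau>" "?done R \<or> card R + length w \<le> card V" by auto
    have "card V < length w" using short card_image[OF verts(2)] verts(1) by simp
    with R(2) have "?done R" by linarith
    moreover have "wf_state w (\<tau>(RoundTodo := {}, RoundCur := {}))" by (intro wfup wfr[OF R(1)]) auto
    then have "reduced R (\<tau>(RoundTodo := {}, RoundCur := {}))" by (rule reduced_cong[OF R(1)]) auto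
    ultimately show "\<exists>R. reduced R (\<tau>(RoundTodo := {}, RoundCur := {})) \<and> ?done R" by blast
  next
    show "preserves RoundTodo ?F"
      by (intro preserves_intros preserves_visit act) auto
  qed simp_all
qed

end

section \<open>Correctness of the two decision procedures\<close>

context hypergraph_word
begin

text \<open>An occurrence behind the vertex list belongs to the edge whose marker is the last
  \<open>4\<close> before it. Hence marking all occurrences represents the full vertex set at the
  start.\<close>

lemma val_in_V:
  assumes "occ w i"
  shows "val w i \<in> V"
proof (cases "\<exists>j<i. w ! j = 4")
  case False
  with assms have "i \<in> vertex_occs w" by (simp add: vertex_occs_def)
  then show ?thesis using verts(1) by blast
next
  case True
  let ?J = "{j. j < i \<and> w ! j = 4}"
  have fin: "finite ?J" "?J \<noteq> {}" using True by auto
  obtain e where e: "e < i" "w ! e = 4" and max: "\<And>j. j < i \<Longrightarrow> w ! j = 4 \<Longrightarrow> j \<le> e"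
    using Max_in[OF fin] Max_ge[OF fin(1)] by blast
  have "w ! j \<noteq> 4" if "e < j" "j < i" for j
    using max[of j] that by auto
  with assms e(1) have ie: "i \<in> edge_occs w e" by (simp add: edge_occs_def)
  have "e < length w" using e(1) occ_less[OF assms] by (rule less_trans)
  then have "val w ` edge_occs w e \<in> H"
    unfolding edges[symmetric] using ie e(2) by (intro CollectI exI[of _ e]) auto
  then have "val w ` edge_occs w e \<subseteq> V" using hyp unfolding k_hypergraph_def by blast
  with ie show ?thesis by blast
qed

lemma wf_empty: "wf_state w (\<lambda>_. {})"
  by (simp add: wf_state_def)

lemma initialize_apply:
  "initialize w (\<lambda>_. {}) = (\<lambda>_. {})(Occs := {i. occ w i}, Verts := vertex_occs w, Rest := occs_of V)"
proof -
  have "mark_vertices Verts Occs w ((\<lambda>_. {})(Occs := {i. occ w i})) =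
      (\<lambda>_. {})(Occs := {i. occ w i}, Verts := vertex_occs w)"
    by (rule mark_vertices_apply) simp
  then have "initialize w (\<lambda>_. {}) =
      assign_local Rest (\<lambda>_ M. M Occs) w ((\<lambda>_. {})(Occs := {i. occ w i}, Verts := vertex_occs w))"
    by (simp add: initialize_def seq_def mark_occs_apply)
  also have "\<dots> = (\<lambda>_. {})(Occs := {i. occ w i}, Verts := vertex_occs w, Rest := occs_of V)"
    using occ_less val_in_V by (auto simp: assign_local_apply fun_eq_iff)
  finally show ?thesis .
qed

lemma wf_initialize: "wf_state w (initialize w (\<lambda>_. {}))"
  by (rule computable_wf[OF computable_initialize wf_empty])

lemma fill_nonempty: "assign_local x (\<lambda>_ _. True) w \<sigma> x \<noteq> {}"
  unfolding fill_apply using nonempty_word by auto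

lemma clear_empty: "assign_local x (\<lambda>_ _. False) w \<sigma> x = {}"
  by (simp add: assign_local_apply)

lemma decide_orderable_correct:
  "decide_orderable w (\<lambda>_. {}) Accept \<noteq> {} \<longleftrightarrow> orderable k V H"
proof -
  interpret elimination w k V H skip "\<lambda>_ _. True"
    by unfold_locales (auto intro: computable_skip preserves_skip)
  have "reduced V (initialize w (\<lambda>_. {}))"
    using wf_initialize unfolding reduced_def initialize_apply by simp
  then obtain R where R: "reduced R (eliminate skip w (initialize w (\<lambda>_. {})))" "R = {} \<or> \<not> orderable k R H"
    using reduced_eliminate by blast
  let ?\<sigma> = "eliminate skip w (initialize w (\<lambda>_. {}))"
  have \<sigma>: "?\<sigma> Rest = occs_of R" "?\<sigma> Verts = vertex_occs w" "R \<subseteq> V" "orderable k R H \<longleftrightarrow> orderable k V H"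
    using R(1) by (simp_all add: reduced_def)
  have "occurs (\<lambda>_ M. M Verts \<and> M Rest) w ?\<sigma> \<longleftrightarrow> (\<exists>i \<in> vertex_occs w. val w i \<in> R)"
    unfolding occurs_def \<sigma>(1,2) in_occs_of using vertex_occs_occ occ_less by blast
  also have "\<dots> \<longleftrightarrow> R \<noteq> {}" using \<sigma>(3) unfolding verts(1)[symmetric] by blast
  \<comment> \<open>The empty set is orderable, so exactly one of the two outcomes of the
    elimination holds.\<close>
  also have "\<dots> \<longleftrightarrow> \<not> orderable k V H" using \<sigma>(4) R(2) orderable_empty by blast
  finally have t: "occurs (\<lambda>_ M. M Verts \<and> M Rest) w ?\<sigma> \<longleftrightarrow> \<not> orderable k V H" .
  show ?thesis
    unfolding decide_orderable_def seq_def cond_def t by (simp add: fill_nonempty clear_empty)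
qed

text \<open>Divisibility is claimed only while the open places do not suffice, as the subtraction is
  truncated afterwards. \<open>Fail\<close> is never cleared; once set, it stands for a final
  negative answer, whatever happens to the counter.\<close>

definition matching_invariant :: "nat set \<Rightarrow> mark state \<Rightarrow> bool" where
  "matching_invariant R \<sigma> \<longleftrightarrow>
     (if \<sigma> Fail = {} then (card (\<sigma> Cnt) < card R \<longrightarrow> k dvd card R - card (\<sigma> Cnt)) \<and>
        (fillable H R (card (\<sigma> Cnt)) \<longleftrightarrow> has_perfect_matching V H)
      else \<not> has_perfect_matching V H)"

lemma matching_invariant_step:
  assumes R: "R \<subseteq> V" and v: "v \<in> R" and u: "uniform k H R v" and wf: "wf_state w \<sigma>"
    and dom: "\<sigma> Dom \<noteq> {} \<longleftrightarrow> (\<exists>E\<in>H. v \<in> E \<and> E \<subseteq> R)" and inv: "matching_invariant R \<sigma>"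
  shows "matching_invariant (R - {v}) (count_slots k w \<sigma>)"
proof -
  let ?\<rho> = "count_slots k w \<sigma>"
  have fin: "finite R" using R hyp finite_subset unfolding k_hypergraph_def by blast
  have cardH: "card E = k" if "E \<in> H" for E using hyp that unfolding k_hypergraph_def by blast
  have cnt: "\<sigma> Cnt \<subseteq> {..<length w}" "finite (\<sigma> Cnt)"
    using wf finite_subset[of "\<sigma> Cnt" "{..<length w}"] unfolding wf_state_def by auto
  have RN: "card R \<le> length w"
  proof -
    have "card R \<le> card V" using R hyp card_mono unfolding k_hypergraph_def by blast
    also have "card V < length w" using short card_image[OF verts(2)] verts(1) by simp
    finally show ?thesis by simp
  qed
  show ?thesis
  proof (cases "\<sigma> Dom \<noteq> {}")
    case True
    then have F: "?\<rho> = add_many (k - 1) w \<sigma>"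
      unfolding count_slots_def cond_def occurs_mark[OF wf] by simp
    have f: "?\<rho> Fail = \<sigma> Fail" unfolding F by (rule preservesD[OF preserves_add_many]) simp
    have c: "card (?\<rho> Cnt) = min (length w) (card (\<sigma> Cnt) + k - 1)"
      unfolding F add_many_card[where \<sigma> = \<sigma> and w = w, OF cnt(1)] using k by simp
    \<comment> \<open>The edge witnessed by \<open>Dom\<close> refutes the isolating alternative of
      uniformity.\<close>
    have all: "E \<in> H" if "card E = k" "v \<in> E" "E \<subseteq> R" for E
      using True dom u cardH that unfolding uniform_def by blast
    show ?thesis
    proof (cases "\<sigma> Fail = {}")
      case fail: True
      then have i: "card (\<sigma> Cnt) < card R \<Longrightarrow> k dvd card R - card (\<sigma> Cnt)"
        "fillable H R (card (\<sigma> Cnt)) \<longleftrightarrow> has_perfect_matching V H"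
        using inv by (simp_all add: matching_invariant_def)
      note fd = fillable_dominating[OF fin v k _ _ i(1) RN, where H = H, folded c]
      have "fillable H (R - {v}) (card (?\<rho> Cnt)) \<longleftrightarrow> fillable H R (card (\<sigma> Cnt))"
        "card (?\<rho> Cnt) < card (R - {v}) \<Longrightarrow> k dvd card (R - {v}) - card (?\<rho> Cnt)"
        using fd cardH all by blast+
      with i fail f show ?thesis by (simp add: matching_invariant_def)
    next
      case False
      with f inv show ?thesis by (simp add: matching_invariant_def)
    qed
  next
    case nodom: False
    then have iso: "\<And>E. E \<in> H \<Longrightarrow> v \<in> E \<Longrightarrow> \<not> E \<subseteq> R" using dom by blast
    show ?thesis
    proof (cases "\<sigma> Cnt = {}")
      case True
      have F: "?\<rho> = \<sigma>(Fail := {..<length w})"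
        unfolding count_slots_def cond_def occurs_mark[OF wf] fill_apply using nodom True by simp
      have "\<not> has_perfect_matching V H"
        using inv True fillable_isolating(1)[OF fin v iso] by (auto simp: matching_invariant_def split: if_splits)
      moreover have "?\<rho> Fail \<noteq> {}" unfolding F using nonempty_word by auto
      ultimately show ?thesis by (simp add: matching_invariant_def)
    next
      case False
      obtain X where X: "remove_one Cnt w \<sigma> = \<sigma>(Cnt := X)" "X \<subseteq> {..<length w}"
        "card X = card (\<sigma> Cnt) - 1"
        using remove_one_apply[where x = Cnt and \<sigma> = \<sigma> and w = w, OF cnt(1)] .
      have F: "?\<rho> = \<sigma>(Cnt := X)"
        unfolding count_slots_def cond_def occurs_mark[OF wf] X(1)[symmetric] using nodom False by simp
      have pos: "0 < card (\<sigma> Cnt)" using False cnt(2) by (simp add: card_gt_0_iff)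
      have cR: "card (R - {v}) = card R - 1" "0 < card R" using fin v by (auto simp: card_gt_0_iff)
      \<comment> \<open>A vertex and a place disappear together, so the difference that
        \<open>k\<close> has to divide is unchanged.\<close>
      have d: "card (R - {v}) - card X = card R - card (\<sigma> Cnt)"
        "card X < card (R - {v}) \<longleftrightarrow> card (\<sigma> Cnt) < card R"
        using X(3) pos cR by linarith+
      have "fillable H (R - {v}) (card X) \<longleftrightarrow> fillable H R (card (\<sigma> Cnt))"
        unfolding X(3) by (rule fillable_isolating(2)[OF fin v iso pos])
      then show ?thesis
        using inv unfolding F matching_invariant_def by (simp only: fun_upd_apply mark.distinct if_False if_True refl d)
    qed
  qed
qed

lemma decide_matching_correct:
  assumes "orderable k V H"
  shows "decide_matching k w (\<lambda>_. {}) Accept \<noteq> {} \<longleftrightarrow> has_perfect_matching V H"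
proof -
  let ?init = "initialize w (\<lambda>_. {})"
  let ?\<sigma> = "eliminate (count_slots k) w ?init"
  have finV: "finite V" using hyp unfolding k_hypergraph_def by blast
  have "preserves Verts (eliminate (count_slots k))"
    unfolding eliminate_def by (intro preserves_intros preserves_visit preserves_count_slots) auto
  then have "?\<sigma> Verts = vertex_occs w" by (simp add: preservesD initialize_apply)
  moreover have "vertex_occs w \<inter> {..<length w} = vertex_occs w"
    using vertex_occs_occ occ_less by blast
  ultimately have dv: "count_dvd k Verts w ?\<sigma> \<longleftrightarrow> k dvd card V"
    using card_image[OF verts(2)] verts(1) by (simp add: count_dvd_def)
  have wf: "wf_state w ?\<sigma>"
    by (intro computable_wf[OF computable_eliminate] computable_count_slots preserves_count_slots wf_initialize) auto
  have "count_dvd k Verts w ?\<sigma> \<and> \<not> occurs (\<lambda>_ M. M Fail) w ?\<sigma> \<longleftrightarrow> has_perfect_matching V H"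
  proof (cases "k dvd card V")
    case False
    \<comment> \<open>Here the invariant would fail at the start already, so this case is settled by
      counting vertices alone.\<close>
    have "\<not> has_perfect_matching V H"
      using perfect_matching_card[OF finV, of H k] False hyp unfolding k_hypergraph_def by blast
    with False dv show ?thesis by simp
  next
    case True
    interpret elimination w k V H "count_slots k" matching_invariant
    proof unfold_locales
      show "computable (count_slots k)" by (rule computable_count_slots)
      show "\<And>m. m \<noteq> Cnt \<Longrightarrow> m \<noteq> Fail \<Longrightarrow> preserves m (count_slots k)" by (rule preserves_count_slots)
      show "matching_invariant R \<sigma> \<Longrightarrow> \<tau> Cnt = \<sigma> Cnt \<Longrightarrow> \<tau> Fail = \<sigma> Fail \<Longrightarrow> matching_invariant R \<tau>" for R \<sigma> \<tau>
        by (simp add: matching_invariant_def)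
    qed (rule matching_invariant_step)
    have "matching_invariant V ?init"
      using True fillable_zero[OF finV] by (simp add: matching_invariant_def initialize_apply)
    then have "reduced V ?init"
      using wf_initialize unfolding reduced_def initialize_apply by simp
    then obtain R where R: "reduced R ?\<sigma>" "R = {} \<or> \<not> orderable k R H"
      using reduced_eliminate by blast
    then have "R = {}" using assms by (simp add: reduced_def)
    with R(1) have "matching_invariant {} ?\<sigma>" by (simp add: reduced_def)
    \<comment> \<open>With no vertex left everything fits, and the invariant ties the answer to
      \<open>Fail\<close> alone.\<close>
    moreover have "fillable H {} c" for c by (simp add: fillable_def)
    ultimately show ?thesis
      unfolding dv occurs_mark[OF wf] using True by (auto simp: matching_invariant_def split: if_splits)
  qed
  then show ?thesis
    unfolding decide_matching_def seq_def cond_def by (simp add: fill_nonempty clear_empty)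
qed

end

text \<open>\<open>k \<ge> 1\<close> rules out an empty edge, whose encoding could not be told apart
  from the final \<open>4\<close>.\<close>

lemma hypergraph_word_enc_input:
  assumes "k \<ge> 1" "k_hypergraph k V H" "represents V H vs es"
  shows "hypergraph_word (enc_input vs es) k V H"
proof -
  have r: "distinct vs" "set vs = V" "set ` set es = H" using assms(3) by (auto simp: represents_def)
  have "[] \<notin> set es"
  proof
    assume "[] \<in> set es"
    then have "{} \<in> H" unfolding r(3)[symmetric] by force
    then have "card ({} :: nat set) = k" using assms(2) unfolding k_hypergraph_def by blast
    with assms(1) show False by simp
  qed
  note occs = enc_input_occs[OF refl this r(1)]
  show ?thesis
    by unfold_locales (use occs r assms in simp_all)
qed

theorem theorem1:
  fixes k :: nat
  assumes "k \<ge> 1"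
  shows "(\<exists>M. is_TM M \<and>
            poly_time_decides M (\<lambda>V H. k_hypergraph k V H) (\<lambda>V H. orderable k V H))
       \<and> (\<exists>M. is_TM M \<and>
            poly_time_decides M (\<lambda>V H. k_hypergraph k V H \<and> orderable k V H)
                                (\<lambda>V H. has_perfect_matching V H))"
proof (intro conjI)
  show "\<exists>M. is_TM M \<and> poly_time_decides M (\<lambda>V H. k_hypergraph k V H) (\<lambda>V H. orderable k V H)"
  proof (rule computable_poly_time_decides[OF computable_decide_orderable])
    fix V H vs es assume "k_hypergraph k V H" "represents V H vs es"
    then interpret hypergraph_word "enc_input vs es" k V H
      using assms by (intro hypergraph_word_enc_input)
    show "decide_orderable (enc_input vs es) (\<lambda>_. {}) Accept \<noteq> {} \<longleftrightarrow> orderable k V H"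
      by (rule decide_orderable_correct)
  qed
  show "\<exists>M. is_TM M \<and> poly_time_decides M (\<lambda>V H. k_hypergraph k V H \<and> orderable k V H)
      (\<lambda>V H. has_perfect_matching V H)"
  proof (rule computable_poly_time_decides[OF computable_decide_matching[OF assms]])
    fix V H vs es assume *: "k_hypergraph k V H \<and> orderable k V H" "represents V H vs es"
    then interpret hypergraph_word "enc_input vs es" k V H
      using assms by (intro hypergraph_word_enc_input) auto
    show "decide_matching k (enc_input vs es) (\<lambda>_. {}) Accept \<noteq> {} \<longleftrightarrow> has_perfect_matching V H"
      using * by (intro decide_matching_correct) blast
  qed
qed

end
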